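(* Let $(W_L)_{L\ge1}$ be a family of $L$-periodic real-valued measurable functions on $\mathbb{R}^d$ satisfying: (i) there is a constant $C$ such that $|W_L(x)|\le C\langle x\rangle$ for all $L$ and all $x\in\Lambda_L$; (ii) with $O=\Lambda_{1/2}$, there exist a constant $C$ and $\alpha,\epsilon>0$ such that for all sufficiently large $1\le L\le L'$, $$\sup_{x\in\Lambda_L}\big|1_{L^{1/2+\alpha}O}(x)\,(W_L(x)-W_{L'}(x))\big|\le CL^{-\epsilon}.$$ Let $\varphi\in L^2(\mathbb{R}^d)$. Then for any $z\in\mathbb{C}\setminus\mathbb{R}$ the limit $$\lim_{L\to\infty}\langle\varphi,(T_L+W_L-z)^{-1}\varphi\rangle_L$$ exists. Moreover, for any $f\in C_\infty(\mathbb{R})$ (continuous functions $\mathbb{R}\to\mathbb{C}$ vanishing at infinity) the limit $\lim_{L\to\infty}\langle\varphi,f(T_L+W_L)\varphi\rangle_L$ exists.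
   Context: $\Lambda_L=[-L/2,L/2)^d$, $\langle x\rangle=\sqrt{1+|x|^2}$, and $\langle f,g\rangle_L=\int_{\Lambda_L}\overline{f}g\,dx$, where $\varphi\in L^2(\mathbb{R}^d)$ is restricted to $\Lambda_L$. $T_L=-\Delta_L$ is the Laplacian on $L^2(\Lambda_L)$ (identified with $L$-periodic locally $L^2$ functions) with periodic boundary conditions, i.e. with domain $\{\psi\in H^2_{\rm loc}(\mathbb{R}^d):\psi\ L\text{-periodic}\}$; equivalently it acts as multiplication by $|2\pi p|^2$ on Fourier coefficients indexed by $p\in(\frac1L\mathbb{Z})^d$. $W_L$ acts as a multiplication operator; $T_L+W_L$ is self-adjoint since $W_L$ is bounded. For $a>0$ and a set $O$, $aO=\{ax:x\in O\}$, and $1_A$ is the indicator of $A$. *)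

theory Defs
  imports "HOL-Analysis.Analysis"
begin

definition box_L :: "real \<Rightarrow> (real^'d) set" where
  "box_L L = {x. \<forall>i. - L / 2 \<le> x $ i \<and> x $ i < L / 2}"

definition jbr :: "real^'d \<Rightarrow> real" where
  "jbr x = sqrt (1 + (norm x)\<^sup>2)"

definition periodic_L :: "real \<Rightarrow> (real^'d \<Rightarrow> 'b) \<Rightarrow> bool" where
  "periodic_L L f \<longleftrightarrow> (\<forall>x i. f (x + L *\<^sub>R axis i 1) = f x)"

definition inner_L :: "real \<Rightarrow> (real^'d \<Rightarrow> complex) \<Rightarrow> (real^'d \<Rightarrow> complex) \<Rightarrow> complex" where
  "inner_L L f g = (LINT x : box_L L | lborel. cnj (f x) * g x)"

definition L2_on :: "real \<Rightarrow> (real^'d \<Rightarrow> complex) \<Rightarrow> bool" where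
  "L2_on L f \<longleftrightarrow> f \<in> borel_measurable lborel \<and>
                  set_integrable lborel (box_L L) (\<lambda>x. (cmod (f x))\<^sup>2)"

definition dual_lattice :: "real \<Rightarrow> (real^'d) set" where
  "dual_lattice L = {p. \<forall>i. L * p $ i \<in> \<int>}"

definition fourier_coeff :: "real \<Rightarrow> (real^'d \<Rightarrow> complex) \<Rightarrow> real^'d \<Rightarrow> complex" where
  "fourier_coeff L f p =
     (LINT x : box_L L | lborel. exp (- 2 * pi * \<i> * complex_of_real (p \<bullet> x)) * f x)"

text \<open>g = T_L u, where T_L = -Delta with periodic boundary conditions: u is an
  L-periodic L^2 function and g is an L^2 function whose Fourier coefficients are
  |2 pi p|^2 times those of u (this also expresses u \<in> dom T_L).\<close>
definition laplace_L :: "real \<Rightarrow> (real^'d \<Rightarrow> complex) \<Rightarrow> (real^'d \<Rightarrow> complex) \<Rightarrow> bool" where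
  "laplace_L L u g \<longleftrightarrow> periodic_L L u \<and> L2_on L u \<and> L2_on L g \<and>
     (\<forall>p \<in> dual_lattice L.
        fourier_coeff L g p = complex_of_real ((2 * pi * norm p)\<^sup>2) * fourier_coeff L u p)"

definition resolvent_sol ::
  "real \<Rightarrow> (real^'d \<Rightarrow> real) \<Rightarrow> complex \<Rightarrow> (real^'d \<Rightarrow> complex) \<Rightarrow> (real^'d \<Rightarrow> complex) \<Rightarrow> bool" where
  "resolvent_sol L V z phi u \<longleftrightarrow>
     (\<exists>g. laplace_L L u g \<and>
          (AE x in lborel. x \<in> box_L L \<longrightarrow>
              g x + complex_of_real (V x) * u x - z * u x = phi x))"

text \<open><phi, (T_L + V - z)^{-1} phi>_L (independent of the a.e.-representative chosen).\<close>
definition resolvent_form ::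
  "real \<Rightarrow> (real^'d \<Rightarrow> real) \<Rightarrow> complex \<Rightarrow> (real^'d \<Rightarrow> complex) \<Rightarrow> complex" where
  "resolvent_form L V z phi = (THE c. \<exists>u. resolvent_sol L V z phi u \<and> c = inner_L L phi u)"

text \<open>Spectral measure of phi w.r.t. T_L + V: the finite Borel measure mu on R with
  <phi,(T_L+V-z)^{-1}phi>_L = int 1/(lambda - z) dmu(lambda) for all non-real z
  (by Stieltjes inversion there is at most one such measure).\<close>
definition spectral_measure ::
  "real \<Rightarrow> (real^'d \<Rightarrow> real) \<Rightarrow> (real^'d \<Rightarrow> complex) \<Rightarrow> real measure \<Rightarrow> bool" where
  "spectral_measure L V phi \<mu> \<longleftrightarrow> sets \<mu> = sets borel \<and> finite_measure \<mu> \<and>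
     (\<forall>z. Im z \<noteq> 0 \<longrightarrow>
        resolvent_form L V z phi = (LINT t | \<mu>. 1 / (complex_of_real t - z)))"

definition fcalc_form ::
  "real \<Rightarrow> (real^'d \<Rightarrow> real) \<Rightarrow> (real \<Rightarrow> complex) \<Rightarrow> (real^'d \<Rightarrow> complex) \<Rightarrow> complex" where
  "fcalc_form L V f phi = (THE c. \<exists>\<mu>. spectral_measure L V phi \<mu> \<and> c = (LINT t | \<mu>. f t))"

definition C_infty :: "(real \<Rightarrow> complex) \<Rightarrow> bool" where
  "C_infty f \<longleftrightarrow> continuous_on UNIV f \<and> (f \<longlongrightarrow> 0) at_top \<and> (f \<longlongrightarrow> 0) at_bot"

end

theory Submission
  imports Defs "HOL-Probability.Probability"
begin

text \<open>Let \<open>u = (T\<^sub>L + W\<^sub>L - z)\<^sup>-\<^sup>1 \<phi>\<close> and let \<open>\<chi>\<close> be a smooth cutoff at scale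
  \<open>R = L powr (1/2 + \<alpha>) / 4\<close>. Since \<open>\<chi> u\<close> is supported well inside the smaller box, it also lies in
  the domain of \<open>T\<^sub>L'\<close>, and \<open>(T\<^sub>L' + W\<^sub>L' - z) (\<chi> u)\<close> differs from \<open>\<phi>\<close> by
  \<open>(\<chi> - 1) \<phi> + (W\<^sub>L' - W\<^sub>L) \<chi> u - 2 \<nabla>\<chi> \<cdot> \<nabla>u - (\<Delta>\<chi>) u\<close>. As \<open>\<bar>W\<^sub>L\<bar> \<le> C L\<close> on the box, the energy
  identity gives \<open>\<parallel>\<nabla>u\<parallel> \<le> C L powr (1/2)\<close>, which the factor \<open>1 / R\<close> from \<open>\<nabla>\<chi>\<close> turns into
  \<open>C L powr (- \<alpha>)\<close>; so the resolvent forms are Cauchy in \<open>L\<close>. The spectral measures have total mass at most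
  \<open>\<parallel>\<phi>\<parallel>\<^sup>2\<close>, and Poisson smoothing expresses \<open>f \<in> C\<^sub>\<infinity>\<close>, uniformly up to a small error, through
  the resolvent forms; this carries the limit over to \<open>f\<close>.\<close>

section \<open>The Hilbert space of square-integrable functions\<close>

text \<open>\<open>resolvent_form\<close> and \<open>fcalc_form\<close> are definite descriptions,
  so before any estimate the resolvent and the spectral measure must be shown to exist and to be
  unique. For the resolvent, the plane waves form an orthonormal basis, which turns the Laplacian
  into a multiplier that is inverted coefficient by coefficient, and the potential on a fixed box is
  a bounded perturbation. For the measure, the Cayley transform is isometric, so its powers applied
  to a vector form a stationary sequence, to which Herglotz' theorem applies. Uniqueness of the
  integrals of \<open>f\<close> comes from the same Poisson smoothing that later carries the limit
  over.

  The obstacle in the comparison is that the frequency lattices of two periods need not be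
  commensurable, while the domains are described by Fourier coefficients alone. All boxes are
  therefore embedded into one L2 space over the whole of space by extension by zero, the gradient is
  the vector field with the expected Fourier coefficients, and the product rule for the cutoff
  becomes an identity between its matrix elements in plane waves of the two periods.\<close>

class chilbert = real_inner + complete_space +
  fixes scaleC :: "complex \<Rightarrow> 'a \<Rightarrow> 'a" (infixr "*\<^sub>C" 75)
    and cinner :: "'a \<Rightarrow> 'a \<Rightarrow> complex"
  assumes scaleC_add_right: "a *\<^sub>C (x + y) = a *\<^sub>C x + a *\<^sub>C y"
    and scaleC_add_left: "(a + b) *\<^sub>C x = a *\<^sub>C x + b *\<^sub>C x"
    and scaleC_scaleC: "a *\<^sub>C b *\<^sub>C x = (a * b) *\<^sub>C x"
    and scaleC_of_real: "complex_of_real r *\<^sub>C x = r *\<^sub>R x"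
    and cinner_commute: "cinner x y = cnj (cinner y x)"
    and cinner_add_right: "cinner x (y + z) = cinner x y + cinner x z"
    and cinner_scaleC_right: "cinner x (a *\<^sub>C y) = a * cinner x y"
    and Re_cinner: "Re (cinner x y) = x \<bullet> y"

definition l2_fun :: "('a::euclidean_space \<Rightarrow> complex) \<Rightarrow> bool" where
  "l2_fun f \<longleftrightarrow> f \<in> borel_measurable lborel \<and> integrable lborel (\<lambda>x. (cmod (f x))\<^sup>2)"

definition l2_rel :: "('a::euclidean_space \<Rightarrow> complex) \<Rightarrow> ('a \<Rightarrow> complex) \<Rightarrow> bool" where
  "l2_rel f g \<longleftrightarrow> l2_fun f \<and> l2_fun g \<and> (AE x in lborel. f x = g x)"

lemma l2_fun_meas: "l2_fun f \<Longrightarrow> f \<in> borel_measurable lborel"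
  by (simp add: l2_fun_def)

lemma l2_fun_int: "l2_fun f \<Longrightarrow> integrable lborel (\<lambda>x. (cmod (f x))\<^sup>2)"
  by (simp add: l2_fun_def)

lemma l2_fun_0 [simp]: "l2_fun (\<lambda>x. 0)"
  by (simp add: l2_fun_def)

lemma cmod_mult_le_squares: "cmod (a * b) \<le> (cmod a)\<^sup>2 + (cmod b)\<^sup>2"
proof -
  have "0 \<le> (cmod a - cmod b)\<^sup>2" "0 \<le> cmod a * cmod b" by auto
  then have "cmod a * cmod b \<le> (cmod a)\<^sup>2 + (cmod b)\<^sup>2"
    unfolding power2_diff by linarith
  then show ?thesis by (simp add: norm_mult)
qed

lemma borel_measurable_cnj [measurable (raw)]:
  "f \<in> borel_measurable M \<Longrightarrow> (\<lambda>x. cnj (f x)) \<in> borel_measurable M"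
  by (rule measurable_compose[where N = borel and g = cnj, OF _ borel_measurable_continuous_onI])
     (auto intro: continuous_intros)

lemma l2_fun_prod_integrable:
  assumes "l2_fun f" "l2_fun g"
  shows "integrable lborel (\<lambda>x. cnj (f x) * g x)"
proof (rule Bochner_Integration.integrable_bound)
  show "integrable lborel (\<lambda>x. (cmod (f x))\<^sup>2 + (cmod (g x))\<^sup>2)"
    using assms by (auto simp: l2_fun_int)
  note [measurable] = assms[THEN l2_fun_meas]
  show "(\<lambda>x. cnj (f x) * g x) \<in> borel_measurable lborel"
    by measurable
  show "AE x in lborel. cmod (cnj (f x) * g x) \<le> norm ((cmod (f x))\<^sup>2 + (cmod (g x))\<^sup>2)"
    using cmod_mult_le_squares[of "cnj (f _)"] by (auto intro!: AE_I2 order_trans[OF cmod_mult_le_squares])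
qed

lemma l2_fun_add:
  assumes "l2_fun f" "l2_fun g"
  shows "l2_fun (\<lambda>x. f x + g x)"
  unfolding l2_fun_def
proof
  have *: "(cmod (a + b))\<^sup>2 \<le> 2 * (cmod a)\<^sup>2 + 2 * (cmod b)\<^sup>2" for a b
  proof -
    have "(cmod (a + b))\<^sup>2 \<le> (cmod a + cmod b)\<^sup>2"
      by (intro power_mono norm_triangle_ineq) auto
    moreover have "0 \<le> (cmod a - cmod b)\<^sup>2" by simp
    ultimately show ?thesis by (simp add: power2_diff power2_sum)
  qed
  note [measurable] = assms[THEN l2_fun_meas]
  show "(\<lambda>x. f x + g x) \<in> borel_measurable lborel"
    by measurable
  show "integrable lborel (\<lambda>x. (cmod (f x + g x))\<^sup>2)"
  proof (rule Bochner_Integration.integrable_bound)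
    show "integrable lborel (\<lambda>x. 2 * (cmod (f x))\<^sup>2 + 2 * (cmod (g x))\<^sup>2)"
      using assms[THEN l2_fun_int] by simp
    show "AE x in lborel. norm ((cmod (f x + g x))\<^sup>2) \<le> norm (2 * (cmod (f x))\<^sup>2 + 2 * (cmod (g x))\<^sup>2)"
      using * by (intro AE_I2) simp
  qed measurable
qed

lemma l2_fun_mult_bounded:
  assumes "l2_fun f" and [measurable]: "m \<in> borel_measurable lborel" and "\<And>x. cmod (m x) \<le> B"
  shows "l2_fun (\<lambda>x. m x * f x)"
  unfolding l2_fun_def
proof
  note [measurable] = l2_fun_meas[OF assms(1)]
  show "(\<lambda>x. m x * f x) \<in> borel_measurable lborel"
    by measurable
  show "integrable lborel (\<lambda>x. (cmod (m x * f x))\<^sup>2)"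
  proof (rule Bochner_Integration.integrable_bound[of lborel "\<lambda>x. B\<^sup>2 * (cmod (f x))\<^sup>2"])
    show "integrable lborel (\<lambda>x. B\<^sup>2 * (cmod (f x))\<^sup>2)"
      using assms(1) by (auto simp: l2_fun_int)
    have "(cmod (m x * f x))\<^sup>2 \<le> B\<^sup>2 * (cmod (f x))\<^sup>2" for x
      using assms(3)[of x] by (auto simp: norm_mult power_mult_distrib intro!: mult_right_mono power_mono)
    then show "AE x in lborel. norm ((cmod (m x * f x))\<^sup>2) \<le> norm (B\<^sup>2 * (cmod (f x))\<^sup>2)"
      by auto
  qed measurable
qed

lemma l2_fun_cmult: "l2_fun f \<Longrightarrow> l2_fun (\<lambda>x. c * f x)"
  by (rule l2_fun_mult_bounded[of _ _ "cmod c"]) auto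

lemma l2_fun_uminus: "l2_fun f \<Longrightarrow> l2_fun (\<lambda>x. - f x)"
  using l2_fun_cmult[of f "-1"] by simp

lemma l2_fun_diff: "l2_fun f \<Longrightarrow> l2_fun g \<Longrightarrow> l2_fun (\<lambda>x. f x - g x)"
  using l2_fun_add[of f "\<lambda>x. - g x"] l2_fun_uminus[of g] by simp

\<comment> \<open>A partial quotient: a function that is not square-integrable is related to
  nothing, not even to itself, so only classes of square-integrable functions arise.\<close>
quotient_type (overloaded) 'a L2 = "'a::euclidean_space \<Rightarrow> complex" / partial: l2_rel
proof (rule part_equivpI)
  show "\<exists>x. l2_rel x x" by (rule exI[of _ "\<lambda>x. 0"]) (simp add: l2_rel_def)
  show "symp l2_rel" by (auto intro!: sympI simp: l2_rel_def elim: AE_mp)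
  show "transp l2_rel"
    unfolding l2_rel_def by (rule transpI) (auto elim: AE_mp)
qed

instantiation L2 :: (euclidean_space) ab_group_add
begin

lift_definition zero_L2 :: "'a L2" is "\<lambda>x. 0" by (simp add: l2_rel_def)
lift_definition plus_L2 :: "'a L2 \<Rightarrow> 'a L2 \<Rightarrow> 'a L2" is "\<lambda>f g x. f x + g x"
  by (auto simp: l2_rel_def l2_fun_add elim: AE_mp)
lift_definition uminus_L2 :: "'a L2 \<Rightarrow> 'a L2" is "\<lambda>f x. - f x"
  by (auto simp: l2_rel_def l2_fun_uminus)
lift_definition minus_L2 :: "'a L2 \<Rightarrow> 'a L2 \<Rightarrow> 'a L2" is "\<lambda>f g x. f x - g x"
  by (auto simp: l2_rel_def l2_fun_diff elim: AE_mp)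

instance
  by standard (transfer; auto simp: l2_rel_def l2_fun_add l2_fun_uminus l2_fun_diff algebra_simps)+

end

lift_definition scaleC_L2' :: "complex \<Rightarrow> 'a::euclidean_space L2 \<Rightarrow> 'a L2" is "\<lambda>c f x. c * f x"
  by (auto simp: l2_rel_def l2_fun_cmult)

lift_definition cinner_L2' :: "'a::euclidean_space L2 \<Rightarrow> 'a L2 \<Rightarrow> complex" is
  "\<lambda>f g. LINT x|lborel. cnj (f x) * (g x :: complex) :: complex"
proof -
  fix f1 f2 g1 g2 :: "'a \<Rightarrow> complex"
  assume "l2_rel f1 f2" "l2_rel g1 g2"
  then have [simp]: "l2_fun f1" "l2_fun f2" "l2_fun g1" "l2_fun g2"
    and AE: "AE x in lborel. f1 x = f2 x" "AE x in lborel. g1 x = g2 x"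
    by (auto simp: l2_rel_def)
  show "(LINT x|lborel. cnj (f1 x) * g1 x) = (LINT x|lborel. cnj (f2 x) * g2 x)"
    by (rule integral_cong_AE[OF borel_measurable_integrable borel_measurable_integrable])
       (use AE in \<open>auto intro: l2_fun_prod_integrable\<close>)
qed

instantiation L2 :: (euclidean_space) real_vector
begin

definition "scaleR_L2 r (f :: 'a L2) = scaleC_L2' (complex_of_real r) f"

instance
proof
  fix a b :: real and x y z :: "'a L2"
  show "a *\<^sub>R (x + y) = a *\<^sub>R x + a *\<^sub>R y"
    unfolding scaleR_L2_def
    by transfer (auto simp: l2_rel_def l2_fun_add l2_fun_cmult distrib_left distrib_right mult.assoc)
  show "(a + b) *\<^sub>R x = a *\<^sub>R x + b *\<^sub>R x"
    unfolding scaleR_L2_def of_real_add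
    by transfer (auto simp: l2_rel_def l2_fun_add l2_fun_cmult distrib_left distrib_right mult.assoc)
  show "a *\<^sub>R b *\<^sub>R x = (a * b) *\<^sub>R x"
    unfolding scaleR_L2_def of_real_mult
    by transfer (auto simp: l2_rel_def l2_fun_add l2_fun_cmult distrib_left distrib_right mult.assoc)
  show "1 *\<^sub>R x = x"
    unfolding scaleR_L2_def of_real_1
    by transfer (auto simp: l2_rel_def l2_fun_add l2_fun_cmult distrib_left distrib_right mult.assoc)
qed

end

text \<open>The real part of the complex inner product supplies norm, metric and topology through
  the standard real classes; the complex structure is put on top of it by
  \<open>chilbert\<close>.\<close>

instantiation L2 :: (euclidean_space) real_inner
begin

definition "inner_L2 (f :: 'a L2) g = Re (cinner_L2' f g)"
definition "norm_L2 (f :: 'a L2) = sqrt (inner f f)"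
definition "dist_L2 (f :: 'a L2) g = norm (f - g)"
definition "sgn_L2 (f :: 'a L2) = f /\<^sub>R norm f"
definition [code del]: "uniformity_L2 = (INF e\<in>{0<..}. principal {(x, y). dist x (y::'a L2) < e})"
definition [code del]: "open_L2 (U :: 'a L2 set) =
  (\<forall>x\<in>U. eventually (\<lambda>(x', y). x' = x \<longrightarrow> y \<in> U) uniformity)"

lemma inner_L2_self_abs:
  fixes f :: "'b::euclidean_space \<Rightarrow> complex"
  assumes f: "l2_fun f"
  shows "Re (LINT x|lborel. cnj (f x) * f x) = (LINT x|lborel. (cmod (f x))\<^sup>2)"
proof -
  have "Re (LINT x|lborel. cnj (f x) * f x) = (LINT x|lborel. Re (cnj (f x) * f x))"
    by (rule integral_Re[symmetric, OF l2_fun_prod_integrable[OF f f]])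
  then show ?thesis by (simp add: cmod_power2 flip: power2_eq_square)
qed

instance
proof
  fix a b :: real and x y z :: "'a L2"
  show "dist x y = norm (x - y)" by (simp add: dist_L2_def)
  show "sgn x = inverse (norm x) *\<^sub>R x" by (simp add: sgn_L2_def)
  show "uniformity = (INF e\<in>{0<..}. principal {(x, y). dist x (y::'a L2) < e})"
    by (simp add: uniformity_L2_def)
  show "open U = (\<forall>x\<in>U. eventually (\<lambda>(x', y). x' = x \<longrightarrow> y \<in> U) uniformity)" for U :: "'a L2 set"
    by (simp add: open_L2_def)
  show "norm x = sqrt (inner x x)" by (simp add: norm_L2_def)
  show "inner x y = inner y x"
    unfolding inner_L2_def
  proof transfer
    fix x y :: "'a \<Rightarrow> complex"
    assume "l2_rel x x" "l2_rel y y"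
    then have 1: "l2_fun x" "l2_fun y" by (auto simp: l2_rel_def)
    show "Re (LINT xa|lborel. cnj (x xa) * y xa) = Re (LINT xa|lborel. cnj (y xa) * x xa)"
      using integral_Re[OF l2_fun_prod_integrable[OF 1(1,2)]] integral_Re[OF l2_fun_prod_integrable[OF 1(2,1)]]
      by (simp add: mult_ac)
  qed
  show "inner (x + y) z = inner x z + inner y z"
    unfolding inner_L2_def
    by transfer (auto simp: l2_rel_def l2_fun_prod_integrable distrib_right)
  show "inner (a *\<^sub>R x) y = a * inner x y"
    unfolding inner_L2_def scaleR_L2_def
    by transfer (auto simp: l2_rel_def mult.assoc)
  show "0 \<le> inner x x"
    unfolding inner_L2_def
    by transfer (auto simp: l2_rel_def inner_L2_self_abs)
  show "inner x x = 0 \<longleftrightarrow> x = 0"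
    unfolding inner_L2_def
    by transfer (auto simp: l2_rel_def inner_L2_self_abs integral_nonneg_eq_0_iff_AE l2_fun_int)
qed

end

lemma l2_fun_rep_L2 [simp]: "l2_fun (rep_L2 f)"
  using Quotient3_rep_reflp[OF Quotient3_L2, of f] by (simp add: l2_rel_def)

lemma abs_rep_L2 [simp]: "abs_L2 (rep_L2 f) = f"
  by (rule Quotient3_abs_rep[OF Quotient3_L2])

lemma abs_L2_eq_iff: "l2_fun f \<Longrightarrow> l2_fun g \<Longrightarrow> abs_L2 f = abs_L2 g \<longleftrightarrow> (AE x in lborel. f x = g x)"
  using Quotient3_rel[OF Quotient3_L2, of f g] by (auto simp: l2_rel_def)

lemma abs_L2_cases: obtains g where "l2_fun g" "f = abs_L2 g"
  using l2_fun_rep_L2[of f] abs_rep_L2[of f] by metis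

lemma abs_L2_add: "l2_fun f \<Longrightarrow> l2_fun g \<Longrightarrow> abs_L2 f + abs_L2 g = abs_L2 (\<lambda>x. f x + g x)"
  by (rule plus_L2.abs_eq) (auto simp: l2_rel_def)

lemma abs_L2_diff: "l2_fun f \<Longrightarrow> l2_fun g \<Longrightarrow> abs_L2 f - abs_L2 g = abs_L2 (\<lambda>x. f x - g x)"
  by (rule minus_L2.abs_eq) (auto simp: l2_rel_def)

lemma norm_abs_L2_sq:
  assumes "l2_fun f"
  shows "(norm (abs_L2 f))\<^sup>2 = (LINT x|lborel. (cmod (f x))\<^sup>2)"
proof -
  have "cinner_L2' (abs_L2 f) (abs_L2 f) = (LINT x|lborel. cnj (f x) * f x)"
    by (rule cinner_L2'.abs_eq) (auto simp: l2_rel_def assms)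
  then have "inner (abs_L2 f) (abs_L2 f) = (LINT x|lborel. (cmod (f x))\<^sup>2)"
    by (simp add: inner_L2_def inner_L2_self_abs assms)
  then show ?thesis by (simp add: power2_norm_eq_inner)
qed

lemma nn_integral_abs_L2:
  assumes "l2_fun f"
  shows "(\<integral>\<^sup>+x. ennreal ((cmod (f x))\<^sup>2) \<partial>lborel) = ennreal ((norm (abs_L2 f))\<^sup>2)"
  unfolding norm_abs_L2_sq[OF assms]
  by (rule nn_integral_eq_integral) (auto simp: l2_fun_int assms)

text \<open>Prepares the completeness proof: pointwise convergence almost everywhere can be expected
  only along a subsequence whose steps shrink at a prescribed rate.\<close>

lemma Cauchy_fast_subseq:
  assumes "Cauchy (X :: nat \<Rightarrow> 'a::metric_space)" "\<And>k::nat. 0 < e k"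
  obtains r where "strict_mono r" "\<And>k m. r k \<le> m \<Longrightarrow> dist (X m) (X (r k)) < e k"
proof -
  have "\<exists>N. \<forall>m\<ge>N. \<forall>n\<ge>N. dist (X m) (X n) < e k" for k
    using metric_CauchyD[OF assms(1) assms(2)] by blast
  then obtain N where N: "\<And>k m n. N k \<le> m \<Longrightarrow> N k \<le> n \<Longrightarrow> dist (X m) (X n) < e k"
    by metis
  define r where "r = rec_nat (N 0) (\<lambda>k rk. Suc (max rk (N (Suc k))))"
  have r: "r (Suc k) = Suc (max (r k) (N (Suc k)))" for k by (simp add: r_def)
  have "N k \<le> r k" for k
    by (cases k) (simp_all add: r, simp add: r_def)
  moreover have "strict_mono r"
    by (auto simp: strict_mono_Suc_iff r)
  ultimately show ?thesis
    using that N by (meson order_trans)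
qed

text \<open>The classical argument: a subsequence with geometrically small steps converges almost
  everywhere, Fatou's lemma identifies the pointwise limit as the limit in norm, and a Cauchy
  sequence follows its convergent subsequence.\<close>

instance L2 :: (euclidean_space) complete_space
proof
  fix X :: "nat \<Rightarrow> 'a L2"
  assume C: "Cauchy X"
  obtain r where r: "strict_mono r" "\<And>k m. r k \<le> m \<Longrightarrow> dist (X m) (X (r k)) < (1/2)^k"
    using Cauchy_fast_subseq[OF C, of "\<lambda>k. (1/2)^k"] by auto
  define a where "a k = rep_L2 (X (r k))" for k
  have a [simp]: "l2_fun (a k)" for k by (simp add: a_def)
  have [measurable]: "a k \<in> borel_measurable lborel" for k
    using l2_fun_meas[OF a] by simp
  have dist_a: "(\<integral>\<^sup>+x. ennreal ((cmod (a m x - a k x))\<^sup>2) \<partial>lborel) \<le> ennreal ((1/4)^k)" if "k \<le> m" for k m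
  proof -
    have "(\<integral>\<^sup>+x. ennreal ((cmod (a m x - a k x))\<^sup>2) \<partial>lborel) = ennreal ((norm (abs_L2 (\<lambda>x. a m x - a k x)))\<^sup>2)"
      by (rule nn_integral_abs_L2) (simp add: l2_fun_diff)
    also have "abs_L2 (\<lambda>x. a m x - a k x) = X (r m) - X (r k)"
      by (subst abs_L2_diff[symmetric]) (simp_all add: a_def)
    also have "norm (X (r m) - X (r k)) \<le> (1/2)^k"
      using r(2)[of k "r m"] r(1) that by (simp add: dist_norm strict_mono_less_eq)
    then have "(norm (X (r m) - X (r k)))\<^sup>2 \<le> ((1/2)^k)\<^sup>2"
      by (rule power_mono) simp
    also have "((1/2::real)^k)\<^sup>2 = (1/4)^k"
      by (simp add: power2_eq_square power_mult_distrib[symmetric])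
    finally show ?thesis by (simp add: ennreal_leI)
  qed
  \<comment> \<open>The squared norm of \<open>d k\<close> is at most \<open>(1/4)^k\<close>, which
    leaves room for the weight \<open>2^k\<close>: the weighted squares still have a finite total
    integral. Hence almost everywhere \<open>2^k * (cmod (d k x))\<^sup>2\<close> is bounded in
    \<open>k\<close>, the increments decay geometrically, and the telescoping series
    converges.\<close>
  define d where "d k x = a (Suc k) x - a k x" for k x
  have [measurable]: "d k \<in> borel_measurable lborel" for k unfolding d_def by measurable
  have "(\<integral>\<^sup>+x. (\<Sum>k. ennreal (2^k * (cmod (d k x))\<^sup>2)) \<partial>lborel)
      = (\<Sum>k. \<integral>\<^sup>+x. ennreal (2^k * (cmod (d k x))\<^sup>2) \<partial>lborel)"
    by (rule nn_integral_suminf) measurable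
  also have "\<dots> \<le> (\<Sum>k. ennreal ((1/2)^k))"
  proof (rule suminf_le)
    fix k
    have "(\<integral>\<^sup>+x. ennreal (2^k * (cmod (d k x))\<^sup>2) \<partial>lborel) = ennreal (2^k) * (\<integral>\<^sup>+x. ennreal ((cmod (d k x))\<^sup>2) \<partial>lborel)"
      by (subst nn_integral_cmult[symmetric]) (auto simp: ennreal_mult)
    also have "\<dots> \<le> ennreal (2^k) * ennreal ((1/4)^k)"
      using dist_a[of k "Suc k"] by (intro mult_left_mono) (auto simp: d_def)
    also have "\<dots> = ennreal ((1/2)^k)"
      by (simp add: ennreal_mult[symmetric] power_mult_distrib[symmetric])
    finally show "(\<integral>\<^sup>+x. ennreal (2^k * (cmod (d k x))\<^sup>2) \<partial>lborel) \<le> ennreal ((1/2)^k)" .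
  qed auto
  also have "\<dots> < top"
  proof -
    have "summable (\<lambda>k. (1/2::real)^k)" by (rule summable_geometric) simp
    then have "(\<Sum>k. ennreal ((1/2)^k)) = ennreal (\<Sum>k. (1/2)^k)"
      by (intro suminf_ennreal2) auto
    then show ?thesis by simp
  qed
  finally have "(\<integral>\<^sup>+x. (\<Sum>k. ennreal (2^k * (cmod (d k x))\<^sup>2)) \<partial>lborel) \<noteq> \<infinity>"
    by simp
  then have "AE x in lborel. (\<Sum>k. ennreal (2^k * (cmod (d k x))\<^sup>2)) \<noteq> \<infinity>"
    by (intro nn_integral_noteq_infinite) measurable
  then have conv: "AE x in lborel. convergent (\<lambda>k. a k x)"
  proof (rule AE_mp, intro AE_I2 impI)
    fix x assume "(\<Sum>k. ennreal (2^k * (cmod (d k x))\<^sup>2)) \<noteq> \<infinity>"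
    then have "summable (\<lambda>k. 2^k * (cmod (d k x))\<^sup>2)"
      by (intro summable_suminf_not_top) auto
    then have "(\<lambda>k. 2^k * (cmod (d k x))\<^sup>2) \<longlonglongrightarrow> 0" by (rule summable_LIMSEQ_zero)
    then have "Bseq (\<lambda>k. 2^k * (cmod (d k x))\<^sup>2)" by (intro convergent_imp_Bseq) (auto simp: convergent_def)
    then obtain B where B: "B > 0" "\<And>k. norm (2^k * (cmod (d k x))\<^sup>2) \<le> B" by (auto simp: Bseq_def)
    have le: "cmod (d k x) \<le> sqrt B * (sqrt (1/2))^k" for k
    proof (rule power2_le_imp_le)
      have "(sqrt B * sqrt (1/2) ^ k)\<^sup>2 = B * (1/2)^k"
        using B(1) by (simp add: power_mult_distrib power_even_eq[symmetric] power_mult[symmetric] mult.commute[of k])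
          (simp add: power_mult)
      moreover have "(cmod (d k x))\<^sup>2 \<le> B * (1/2)^k"
        using B(2)[of k] by (simp add: field_simps power_divide)
      ultimately show "(cmod (d k x))\<^sup>2 \<le> (sqrt B * sqrt (1/2) ^ k)\<^sup>2" by simp
    qed (use B(1) in auto)
    have "summable (\<lambda>k. d k x)"
    proof (rule summable_comparison_test[OF exI, OF allI, OF impI])
      show "summable (\<lambda>k. sqrt B * (sqrt (1/2))^k)"
        by (intro summable_mult summable_geometric) (simp add: real_sqrt_lt_1_iff)
    qed (rule le)
    then show "convergent (\<lambda>k. a k x)"
      unfolding d_def summable_iff_convergent sum_lessThan_telescope[of "\<lambda>k. a k x"]
      by (simp add: convergent_diff_const_right_iff)
  qed
  define F where "F x = lim (\<lambda>k. a k x)" for x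
  have [measurable]: "F \<in> borel_measurable lborel" unfolding F_def by measurable
  have lim: "AE x in lborel. (\<lambda>k. a k x) \<longlonglongrightarrow> F x"
    using conv by (auto simp: F_def convergent_LIMSEQ_iff)
  \<comment> \<open>Fatou's lemma in the index \<open>m\<close>, with \<open>k\<close>
    fixed.\<close>
  have Fa: "(\<integral>\<^sup>+x. ennreal ((cmod (F x - a k x))\<^sup>2) \<partial>lborel) \<le> ennreal ((1/4)^k)" for k
  proof -
    have "AE x in lborel. ennreal ((cmod (F x - a k x))\<^sup>2) = liminf (\<lambda>m. ennreal ((cmod (a m x - a k x))\<^sup>2))"
      using lim
    proof eventually_elim
      fix x assume "(\<lambda>k. a k x) \<longlonglongrightarrow> F x"
      then have "(\<lambda>m. ennreal ((cmod (a m x - a k x))\<^sup>2)) \<longlonglongrightarrow> ennreal ((cmod (F x - a k x))\<^sup>2)"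
        by (intro tendsto_ennrealI tendsto_power tendsto_norm tendsto_diff tendsto_const)
      then show "ennreal ((cmod (F x - a k x))\<^sup>2) = liminf (\<lambda>m. ennreal ((cmod (a m x - a k x))\<^sup>2))"
        by (rule lim_imp_Liminf[symmetric, rotated]) simp
    qed
    then have "(\<integral>\<^sup>+x. ennreal ((cmod (F x - a k x))\<^sup>2) \<partial>lborel)
        = (\<integral>\<^sup>+x. liminf (\<lambda>m. ennreal ((cmod (a m x - a k x))\<^sup>2)) \<partial>lborel)"
      by (rule nn_integral_cong_AE)
    also have "\<dots> \<le> liminf (\<lambda>m. \<integral>\<^sup>+x. ennreal ((cmod (a m x - a k x))\<^sup>2) \<partial>lborel)"
      by (rule nn_integral_liminf) measurable
    also have "\<dots> \<le> ennreal ((1/4)^k)"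
    proof -
      have "liminf (\<lambda>m. \<integral>\<^sup>+x. ennreal ((cmod (a m x - a k x))\<^sup>2) \<partial>lborel) \<le> liminf (\<lambda>m. ennreal ((1/4)^k))"
        by (rule Liminf_mono) (use dist_a in \<open>auto simp: eventually_sequentially\<close>)
      then show ?thesis by (simp add: Liminf_const)
    qed
    finally show ?thesis .
  qed
  have Fal: "l2_fun (\<lambda>x. F x - a k x)" for k
    unfolding l2_fun_def
  proof
    show "integrable lborel (\<lambda>x. (cmod (F x - a k x))\<^sup>2)"
      using Fa[of k] by (intro integrableI_nonneg) (auto simp: less_top[symmetric] top_unique)
  qed measurable
  then have "l2_fun (\<lambda>x. (F x - a 0 x) + a 0 x)" by (intro l2_fun_add) auto
  then have F [simp]: "l2_fun F" by simp
  have "norm (X (r k) - abs_L2 F) \<le> (1/2)^k" for k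
  proof (rule power2_le_imp_le)
    have "norm (X (r k) - abs_L2 F) = norm (abs_L2 F - abs_L2 (a k))"
      by (simp add: a_def norm_minus_commute)
    also have "abs_L2 F - abs_L2 (a k) = abs_L2 (\<lambda>x. F x - a k x)" by (simp add: abs_L2_diff)
    finally have "ennreal ((norm (X (r k) - abs_L2 F))\<^sup>2) \<le> ennreal ((1/4)^k)"
      using Fa[of k] by (simp add: nn_integral_abs_L2 Fal)
    then have "(norm (X (r k) - abs_L2 F))\<^sup>2 \<le> (1/4)^k" by simp
    also have "(1/4)^k = ((1/2::real)^k)\<^sup>2"
      by (simp add: power2_eq_square power_mult_distrib[symmetric])
    finally show "(norm (X (r k) - abs_L2 F))\<^sup>2 \<le> ((1/2)^k)\<^sup>2" .
  qed simp
  then have ev: "\<forall>\<^sub>F k in sequentially. norm (X (r k) - abs_L2 F) \<le> (1/2)^k"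
    by (rule always_eventually[OF allI])
  have "(\<lambda>k. (1/2)^k :: real) \<longlonglongrightarrow> 0"
    by (rule LIMSEQ_power_zero) simp
  then have "(\<lambda>k. X (r k) - abs_L2 F) \<longlonglongrightarrow> 0"
    by (rule Lim_null_comparison[OF ev])
  then have "(X \<circ> r) \<longlonglongrightarrow> abs_L2 F"
    unfolding o_def by (rule LIM_zero_cancel)
  then show "convergent X"
    using Cauchy_converges_subseq[OF C r(1)] by (auto simp: convergent_def)
qed

instantiation L2 :: (euclidean_space) chilbert
begin

definition "scaleC_L2 c (f :: 'a L2) = scaleC_L2' c f"
definition "cinner_L2 (f :: 'a L2) g = cinner_L2' f g"

instance
proof
  fix a b :: complex and r :: real and x y z :: "'a L2"
  show "a *\<^sub>C (x + y) = a *\<^sub>C x + a *\<^sub>C y"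
    unfolding scaleC_L2_def
    by transfer (auto simp: l2_rel_def l2_fun_add l2_fun_cmult distrib_left)
  show "(a + b) *\<^sub>C x = a *\<^sub>C x + b *\<^sub>C x"
    unfolding scaleC_L2_def
    by transfer (auto simp: l2_rel_def l2_fun_add l2_fun_cmult distrib_right)
  show "a *\<^sub>C b *\<^sub>C x = (a * b) *\<^sub>C x"
    unfolding scaleC_L2_def
    by transfer (auto simp: l2_rel_def l2_fun_cmult mult.assoc)
  show "complex_of_real r *\<^sub>C x = r *\<^sub>R x"
    by (simp add: scaleC_L2_def scaleR_L2_def)
  show "cinner x y = cnj (cinner y x)"
    unfolding cinner_L2_def
  proof transfer
    fix x y :: "'a \<Rightarrow> complex"
    show "(LINT t|lborel. cnj (x t) * y t) = cnj (LINT t|lborel. cnj (y t) * x t)"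
    proof -
      have "(LINT t|lborel. cnj (x t) * y t) = (LINT t|lborel. cnj (cnj (y t) * x t))"
        by (simp only: complex_cnj_mult complex_cnj_cnj mult.commute)
      also have "\<dots> = cnj (LINT t|lborel. cnj (y t) * x t)"
        by (rule Bochner_Integration.integral_cnj)
      finally show ?thesis .
    qed
  qed
  show "cinner x (y + z) = cinner x y + cinner x z"
    unfolding cinner_L2_def
    by transfer (auto simp: l2_rel_def l2_fun_prod_integrable distrib_left)
  show "cinner x (a *\<^sub>C y) = a * cinner x y"
    unfolding cinner_L2_def scaleC_L2_def
    by transfer (auto simp: l2_rel_def mult.left_commute)
  show "Re (cinner x y) = x \<bullet> y"
    by (simp add: inner_L2_def cinner_L2_def)
qed

end

lemma abs_L2_scaleC: "l2_fun f \<Longrightarrow> c *\<^sub>C abs_L2 f = abs_L2 (\<lambda>x. c * f x)"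
  unfolding scaleC_L2_def by (rule scaleC_L2'.abs_eq) (auto simp: l2_rel_def)

lemma cinner_abs_L2: "l2_fun f \<Longrightarrow> l2_fun g \<Longrightarrow> cinner (abs_L2 f) (abs_L2 g) = (LINT x|lborel. cnj (f x) * g x)"
  unfolding cinner_L2_def by (rule cinner_L2'.abs_eq) (auto simp: l2_rel_def)

text \<open>An operator for every \<open>m\<close>: the default value zero for multipliers that are
  unbounded or not measurable keeps the result square-integrable.\<close>

lift_definition mult_L2 :: "('a \<Rightarrow> complex) \<Rightarrow> 'a::euclidean_space L2 \<Rightarrow> 'a L2" is
  "\<lambda>m f. if m \<in> borel_measurable lborel \<and> bounded (range m) then (\<lambda>x. m x * f x) else (\<lambda>x. 0)"
  by (auto simp: l2_rel_def bounded_iff intro!: l2_fun_mult_bounded)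

definition bdd_meas :: "('a::euclidean_space \<Rightarrow> complex) \<Rightarrow> bool" where
  "bdd_meas m \<longleftrightarrow> m \<in> borel_measurable lborel \<and> (\<exists>B. \<forall>x. cmod (m x) \<le> B)"

lemma l2_fun_bdd_meas: "bdd_meas m \<Longrightarrow> l2_fun f \<Longrightarrow> l2_fun (\<lambda>x. m x * f x)"
  unfolding bdd_meas_def using l2_fun_mult_bounded by blast

lemma mult_abs_L2: "bdd_meas m \<Longrightarrow> l2_fun f \<Longrightarrow> mult_L2 m (abs_L2 f) = abs_L2 (\<lambda>x. m x * f x)"
  by (subst mult_L2.abs_eq) (auto simp: l2_rel_def bdd_meas_def bounded_iff)

lemma mult_L2_add: "bdd_meas m \<Longrightarrow> mult_L2 m (f + g) = mult_L2 m f + mult_L2 m g"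
  by (cases f rule: abs_L2_cases; cases g rule: abs_L2_cases)
     (simp add: mult_abs_L2 abs_L2_add l2_fun_add l2_fun_bdd_meas distrib_left)

lemma mult_L2_scaleC: "bdd_meas m \<Longrightarrow> mult_L2 m (c *\<^sub>C f) = c *\<^sub>C mult_L2 m f"
  by (cases f rule: abs_L2_cases)
     (simp add: mult_abs_L2 abs_L2_scaleC l2_fun_cmult l2_fun_bdd_meas mult.left_commute)

lemma norm_mult_L2_le:
  assumes "bdd_meas m" "\<And>x. cmod (m x) \<le> B"
  shows "norm (mult_L2 m f) \<le> B * norm f"
proof (cases f rule: abs_L2_cases)
  case (1 g)
  have B: "0 \<le> B" using assms(2) norm_ge_zero order_trans by blast
  have "(norm (mult_L2 m f))\<^sup>2 = (LINT x|lborel. (cmod (m x * g x))\<^sup>2)"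
    using 1 assms(1) by (simp add: mult_abs_L2 norm_abs_L2_sq l2_fun_bdd_meas)
  also have "\<dots> \<le> (LINT x|lborel. B\<^sup>2 * (cmod (g x))\<^sup>2)"
    using l2_fun_int[OF l2_fun_bdd_meas[OF assms(1) 1(1)]] l2_fun_int[OF 1(1)] assms(2)
    by (intro integral_mono) (auto simp: norm_mult power_mult_distrib intro!: mult_right_mono power_mono)
  also have "\<dots> = (B * norm f)\<^sup>2"
    using 1 by (simp add: norm_abs_L2_sq power_mult_distrib)
  finally show ?thesis
    by (rule power2_le_imp_le) (simp add: B)
qed

section \<open>Orthonormal bases and resolvents of self-adjoint relations\<close>

hide_const (open) Tree.complete

section \<open>Calculus of the complex inner product\<close>

lemma cinner_add_left: "cinner (x + y) z = cinner x z + cinner (y :: 'a::chilbert) z"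
  by (metis cinner_commute cinner_add_right complex_cnj_add)

lemma cinner_scaleC_left: "cinner (a *\<^sub>C x) y = cnj a * cinner x (y :: 'a::chilbert)"
  by (metis cinner_commute cinner_scaleC_right complex_cnj_mult)

lemma scaleC_one [simp]: "1 *\<^sub>C x = (x :: 'a::chilbert)"
  using scaleC_of_real[of 1 x] by simp

lemma scaleC_zero_left [simp]: "0 *\<^sub>C x = (0 :: 'a::chilbert)"
  using scaleC_of_real[of 0 x] by simp

lemma scaleC_minus_left: "(- a) *\<^sub>C x = - (a *\<^sub>C (x :: 'a::chilbert))"
  using scaleC_add_left[of a "- a" x] by (simp add: eq_neg_iff_add_eq_0 add.commute)

lemma scaleC_minus_one: "(- 1) *\<^sub>C x = - (x :: 'a::chilbert)"
  by (simp add: scaleC_minus_left)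

lemma scaleC_zero_right [simp]: "a *\<^sub>C 0 = (0 :: 'a::chilbert)"
  using scaleC_add_right[of a 0 0] by simp

lemma scaleC_minus_right: "a *\<^sub>C (- x) = - (a *\<^sub>C (x :: 'a::chilbert))"
  using scaleC_add_right[of a x "- x"] by (simp add: eq_neg_iff_add_eq_0 add.commute)

lemma scaleC_diff_right: "a *\<^sub>C (x - y) = a *\<^sub>C x - a *\<^sub>C (y :: 'a::chilbert)"
  using scaleC_add_right[of a x "- y"] by (simp add: scaleC_minus_right)

lemma scaleC_diff_left: "(a - b) *\<^sub>C x = a *\<^sub>C x - b *\<^sub>C (x :: 'a::chilbert)"
  using scaleC_add_left[of a "- b" x] by (simp add: scaleC_minus_left)

lemma cinner_zero_right [simp]: "cinner x (0 :: 'a::chilbert) = 0"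
  using cinner_add_right[of x 0 0] by simp

lemma cinner_zero_left [simp]: "cinner (0 :: 'a::chilbert) x = 0"
  using cinner_add_left[of 0 0 x] by simp

lemma cinner_minus_right: "cinner x (- y) = - cinner x (y :: 'a::chilbert)"
  using cinner_scaleC_right[of x "-1" y] by (simp add: scaleC_minus_one)

lemma cinner_minus_left: "cinner (- x) y = - cinner x (y :: 'a::chilbert)"
  using cinner_scaleC_left[of "-1" x y] by (simp add: scaleC_minus_one)

lemma cinner_diff_right: "cinner x (y - z) = cinner x y - cinner x (z :: 'a::chilbert)"
  using cinner_add_right[of x y "- z"] by (simp add: cinner_minus_right)

lemma cinner_diff_left: "cinner (x - y) z = cinner x z - cinner (y :: 'a::chilbert) z"
  using cinner_add_left[of x "- y" z] by (simp add: cinner_minus_left)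

lemma cinner_sum_right: "cinner x (\<Sum>i\<in>A. f i) = (\<Sum>i\<in>A. cinner x (f i :: 'a::chilbert))"
  by (induction A rule: infinite_finite_induct) (auto simp: cinner_add_right)

lemma cinner_sum_left: "cinner (\<Sum>i\<in>A. f i) x = (\<Sum>i\<in>A. cinner (f i :: 'a::chilbert) x)"
  by (induction A rule: infinite_finite_induct) (auto simp: cinner_add_left)

lemma cinner_self: "cinner x x = complex_of_real ((norm (x :: 'a::chilbert))\<^sup>2)"
proof (rule complex_eqI)
  show "Re (cinner x x) = Re (complex_of_real ((norm x)\<^sup>2))"
    by (simp add: Re_cinner power2_norm_eq_inner)
  have "Im (cinner x x) = Im (cnj (cinner x x))"
    using cinner_commute[of x x] by simp
  then show "Im (cinner x x) = Im (complex_of_real ((norm x)\<^sup>2))" by simp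
qed

lemma norm_scaleC [simp]: "norm (a *\<^sub>C x) = cmod a * norm (x :: 'a::chilbert)"
proof (rule power2_eq_imp_eq)
  have "complex_of_real ((norm (a *\<^sub>C x))\<^sup>2) = cnj a * a * cinner x x"
    unfolding cinner_self[symmetric] cinner_scaleC_left cinner_scaleC_right mult.assoc
    by (simp add: mult.left_commute)
  also have "cnj a * a = complex_of_real ((cmod a)\<^sup>2)"
    by (metis complex_norm_square mult.commute)
  also have "complex_of_real ((cmod a)\<^sup>2) * cinner x x = complex_of_real ((cmod a * norm x)\<^sup>2)"
    by (simp add: cinner_self power_mult_distrib)
  finally show "(norm (a *\<^sub>C x))\<^sup>2 = (cmod a * norm x)\<^sup>2"
    using of_real_eq_iff by blast
qed auto

text \<open>Rotating \<open>y\<close> by a phase makes the inner product real and nonnegative, and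
  then the real inequality applies.\<close>

lemma cinner_Cauchy_Schwarz: "cmod (cinner x y) \<le> norm x * norm (y :: 'a::chilbert)"
proof -
  obtain c where c: "cmod c = 1" "c * cinner x y = complex_of_real (cmod (cinner x y))"
  proof (cases "cinner x y = 0")
    case True then show ?thesis using that[of 1] by simp
  next
    case False
    then show ?thesis
      using that[of "complex_of_real (cmod (cinner x y)) / cinner x y"] by (simp add: norm_divide)
  qed
  have "cmod (cinner x y) = Re (cinner x (c *\<^sub>C y))"
    by (simp add: cinner_scaleC_right c)
  also have "\<dots> \<le> norm x * norm (c *\<^sub>C y)"
    unfolding Re_cinner by (rule norm_cauchy_schwarz)
  finally show ?thesis by (simp add: c)
qed

lemma bounded_linear_cinner: "bounded_linear (cinner (x :: 'a::chilbert))"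
proof (rule bounded_linear_intro)
  show "cinner x (r *\<^sub>R y) = r *\<^sub>R cinner x y" for r y
    unfolding scaleC_of_real[symmetric] cinner_scaleC_right by (simp add: scaleR_conv_of_real)
  show "norm (cinner x y) \<le> norm y * norm x" for y
    using cinner_Cauchy_Schwarz[of x y] by (simp add: mult.commute)
qed (rule cinner_add_right)

text \<open>Completeness is expressed as a trivial orthogonal complement inside the closed subspace
  \<open>H\<close>, which is the form in which it will be verified for plane waves. The index set
  carries no order, so all expansions are unordered sums.\<close>

locale onb =
  fixes e :: "'i \<Rightarrow> 'a::chilbert" and I :: "'i set" and H :: "'a set"
  assumes orth: "\<And>p q. p \<in> I \<Longrightarrow> q \<in> I \<Longrightarrow> cinner (e p) (e q) = (if p = q then 1 else 0)"
    and closed_H: "closed H"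
    and H_0: "0 \<in> H"
    and H_add: "\<And>x y. x \<in> H \<Longrightarrow> y \<in> H \<Longrightarrow> x + y \<in> H"
    and H_scaleC: "\<And>c x. x \<in> H \<Longrightarrow> c *\<^sub>C x \<in> H"
    and e_H: "\<And>p. p \<in> I \<Longrightarrow> e p \<in> H"
    and total: "\<And>x. x \<in> H \<Longrightarrow> (\<And>p. p \<in> I \<Longrightarrow> cinner (e p) x = 0) \<Longrightarrow> x = 0"
begin

lemma H_diff: "x \<in> H \<Longrightarrow> y \<in> H \<Longrightarrow> x - y \<in> H"
  using H_add[of x "(-1) *\<^sub>C y"] H_scaleC[of y "-1"] by (simp add: scaleC_minus_one)

lemma H_sum: "(\<And>i. i \<in> F \<Longrightarrow> f i \<in> H) \<Longrightarrow> (\<Sum>i\<in>F. f i) \<in> H"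
  by (induction F rule: infinite_finite_induct) (auto simp: H_0 H_add)

lemma cinner_e_sum:
  assumes "finite F" "F \<subseteq> I" "p \<in> I"
  shows "cinner (e p) (\<Sum>q\<in>F. a q *\<^sub>C e q) = (if p \<in> F then a p else 0)"
proof -
  have "cinner (e p) (\<Sum>q\<in>F. a q *\<^sub>C e q) = (\<Sum>q\<in>F. if p = q then a q else 0)"
    unfolding cinner_sum_right using assms by (intro sum.cong) (auto simp: cinner_scaleC_right orth)
  then show ?thesis using assms(1) by simp
qed

lemma norm_sum_e:
  assumes "finite F" "F \<subseteq> I"
  shows "(norm (\<Sum>q\<in>F. a q *\<^sub>C e q))\<^sup>2 = (\<Sum>q\<in>F. (cmod (a q))\<^sup>2)"
proof -
  have "cinner (\<Sum>q\<in>F. a q *\<^sub>C e q) (\<Sum>q\<in>F. a q *\<^sub>C e q) = (\<Sum>p\<in>F. cnj (a p) * a p)"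
    unfolding cinner_sum_left[of _ F]
    using assms by (intro sum.cong refl) (subst cinner_scaleC_left, subst cinner_e_sum, auto)
  also have "\<dots> = complex_of_real (\<Sum>q\<in>F. (cmod (a q))\<^sup>2)"
    unfolding of_real_sum by (intro sum.cong refl) (metis complex_norm_square mult.commute)
  finally show ?thesis unfolding cinner_self using of_real_eq_iff by blast
qed

lemma Bessel:
  assumes "finite F" "F \<subseteq> I"
  shows "(\<Sum>p\<in>F. (cmod (cinner (e p) x))\<^sup>2) \<le> (norm x)\<^sup>2"
proof -
  define y where "y = (\<Sum>q\<in>F. cinner (e q) x *\<^sub>C e q)"
  have "cinner y x = (\<Sum>p\<in>F. cnj (cinner (e p) x) * cinner (e p) x)"
    unfolding y_def cinner_sum_left by (simp add: cinner_scaleC_left)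
  also have "\<dots> = complex_of_real (\<Sum>q\<in>F. (cmod (cinner (e q) x))\<^sup>2)"
    unfolding of_real_sum by (intro sum.cong refl) (metis complex_norm_square mult.commute)
  finally have "inner y x = (norm y)\<^sup>2"
    unfolding Re_cinner[symmetric] y_def by (simp add: norm_sum_e[OF assms])
  then have "(norm (x - y))\<^sup>2 = (norm x)\<^sup>2 - (norm y)\<^sup>2"
    by (simp add: power2_norm_eq_inner inner_diff inner_commute)
  moreover have "0 \<le> (norm (x - y))\<^sup>2" by simp
  ultimately show ?thesis unfolding y_def by (simp add: norm_sum_e[OF assms])
qed

lemma summable_coeffs: "(\<lambda>p. (cmod (cinner (e p) x))\<^sup>2) summable_on I"
  by (rule nonneg_bdd_above_summable_on)
     (auto simp: bdd_above_def intro!: exI[of _ "(norm x)\<^sup>2"] Bessel)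

text \<open>By Pythagoras, the squared distance between two nested finite partial sums is the
  corresponding piece of the convergent sum of the squared coefficients. The partial sums therefore
  form a Cauchy filter; membership in \<open>H\<close> and the coefficients pass to its
  limit.\<close>

lemma Riesz_Fischer:
  assumes "(\<lambda>p. (cmod (a p))\<^sup>2) summable_on I"
  obtains x where "x \<in> H" "\<And>p. p \<in> I \<Longrightarrow> cinner (e p) x = a p" "((\<lambda>p. a p *\<^sub>C e p) has_sum x) I"
proof -
  obtain s where s: "((\<lambda>p. (cmod (a p))\<^sup>2) has_sum s) I" using assms by (auto simp: summable_on_def)
  let ?S = "\<lambda>F. \<Sum>p\<in>F. a p *\<^sub>C e p" and ?N = "\<lambda>F. \<Sum>p\<in>F. (cmod (a p))\<^sup>2"
  have le: "?N F \<le> s" if "finite F" "F \<subseteq> I" for F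
    using s that by (intro has_sum_mono2[OF has_sum_finite s]) auto
  have close: "norm (?S G - ?S F) < d"
    if "finite G" "G \<subseteq> I" "F \<subseteq> G" "s - d\<^sup>2 < ?N F" "0 < d" for F G d
  proof -
    have "?S G - ?S F = ?S (G - F)" using that by (simp add: sum_diff)
    then have "(norm (?S G - ?S F))\<^sup>2 = ?N (G - F)" using that by (simp add: norm_sum_e subset_iff)
    also have "\<dots> = ?N G - ?N F" using that by (simp add: sum_diff)
    also have "\<dots> < d\<^sup>2" using le[of G] that by simp
    finally show ?thesis using that(5) by (simp add: power_less_imp_less_base)
  qed
  have "cauchy_filter (filtermap ?S (finite_subsets_at_top I))"
    unfolding cauchy_filter_metric_filtermap
  proof (intro allI impI)
    fix d :: real assume d: "0 < d"
    \<comment> \<open>\<open>F\<close> already carries all but \<open>(d/2)\<^sup>2\<close> of the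
      total mass. Two such sets are compared through their union, which is within \<open>d/2\<close>
      of each.\<close>
    define P where "P F \<longleftrightarrow> finite F \<and> F \<subseteq> I \<and> s - (d/2)\<^sup>2 < ?N F" for F
    have "(?N \<longlongrightarrow> s) (finite_subsets_at_top I)" using s by (simp add: has_sum_def)
    then have "\<forall>\<^sub>F F in finite_subsets_at_top I. s - (d/2)\<^sup>2 < ?N F"
      by (rule order_tendstoD) (use d in simp)
    then have "eventually P (finite_subsets_at_top I)"
      unfolding P_def conj_assoc[symmetric]
      by (intro eventually_conj[OF eventually_finite_subsets_at_top_weakI]) auto
    moreover have "dist (?S F) (?S G) < d" if "P F" "P G" for F G
    proof -
      have "norm (?S (F \<union> G) - ?S F) < d/2" "norm (?S (F \<union> G) - ?S G) < d/2"
        using that d by (intro close; auto simp: P_def)+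
      then show ?thesis
        using norm_triangle_ineq4[of "?S (F \<union> G) - ?S G" "?S (F \<union> G) - ?S F"]
        by (simp add: dist_norm)
    qed
    ultimately show "\<exists>P. eventually P (finite_subsets_at_top I) \<and> (\<forall>x y. P x \<and> P y \<longrightarrow> dist (?S x) (?S y) < d)"
      by blast
  qed
  moreover have "complete (UNIV::'a set)" by (rule complete_UNIV)
  ultimately obtain x where x: "(?S \<longlongrightarrow> x) (finite_subsets_at_top I)"
    using complete_uniform[where S=UNIV] by (force simp add: filterlim_def)
  then have hs: "((\<lambda>p. a p *\<^sub>C e p) has_sum x) I" by (simp add: has_sum_def)
  have "\<forall>\<^sub>F F in finite_subsets_at_top I. ?S F \<in> H"
    by (intro eventually_finite_subsets_at_top_weakI H_sum H_scaleC e_H) auto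
  then have "x \<in> H"
    using Lim_in_closed_set[OF closed_H _ _ x] by simp
  moreover have "cinner (e p) x = a p" if "p \<in> I" for p
  proof -
    have "((\<lambda>F. cinner (e p) (?S F)) \<longlongrightarrow> cinner (e p) x) (finite_subsets_at_top I)"
      by (rule bounded_linear.tendsto[OF bounded_linear_cinner x])
    moreover have "\<forall>\<^sub>F F in finite_subsets_at_top I. cinner (e p) (?S F) = a p"
      unfolding eventually_finite_subsets_at_top
      using that by (intro exI[of _ "{p}"]) (auto simp: cinner_e_sum)
    then have "((\<lambda>F. cinner (e p) (?S F)) \<longlongrightarrow> a p) (finite_subsets_at_top I)"
      by (rule tendsto_eventually)
    ultimately show ?thesis by (rule tendsto_unique[rotated]) simp
  qed
  ultimately show ?thesis using that hs by blast
qed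

lemma expansion:
  assumes "x \<in> H"
  shows "((\<lambda>p. cinner (e p) x *\<^sub>C e p) has_sum x) I"
proof -
  obtain y where y: "y \<in> H" "\<And>p. p \<in> I \<Longrightarrow> cinner (e p) y = cinner (e p) x"
     "((\<lambda>p. cinner (e p) x *\<^sub>C e p) has_sum y) I"
    using Riesz_Fischer[OF summable_coeffs] by metis
  have "x - y = 0" by (rule total) (auto simp: H_diff assms y cinner_diff_right)
  then show ?thesis using y by simp
qed

lemma Parseval:
  assumes "x \<in> H"
  shows "((\<lambda>p. cnj (cinner (e p) y) * cinner (e p) x) has_sum cinner y x) I"
proof -
  have "((\<lambda>p. cinner y (cinner (e p) x *\<^sub>C e p)) has_sum cinner y x) I"
    by (rule has_sum_bounded_linear[OF bounded_linear_cinner expansion[OF assms], unfolded o_def])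
  moreover have "cinner y (cinner (e p) x *\<^sub>C e p) = cnj (cinner (e p) y) * cinner (e p) x" for p
    using cinner_commute[of y "e p"] by (simp add: cinner_scaleC_right)
  ultimately show ?thesis by simp
qed

end

text \<open>An unbounded operator is given by its graph, so that no domain has to be carried along.
  Symmetry is asked for on the diagonal only; \<open>hermitian\<close> recovers the full identity by
  polarization.\<close>

locale symmetric_relation =
  fixes A :: "('a::chilbert \<times> 'a) set" and H :: "'a set"
  assumes closed_H: "closed H"
    and H_0: "0 \<in> H"
    and H_add: "\<And>x y. x \<in> H \<Longrightarrow> y \<in> H \<Longrightarrow> x + y \<in> H"
    and H_scaleC: "\<And>c x. x \<in> H \<Longrightarrow> c *\<^sub>C x \<in> H"
    and A_H: "\<And>u g. (u, g) \<in> A \<Longrightarrow> u \<in> H \<and> g \<in> H"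
    and A_add: "\<And>u g v h. (u, g) \<in> A \<Longrightarrow> (v, h) \<in> A \<Longrightarrow> (u + v, g + h) \<in> A"
    and A_scaleC: "\<And>u g c. (u, g) \<in> A \<Longrightarrow> (c *\<^sub>C u, c *\<^sub>C g) \<in> A"
    and A_sym: "\<And>u g. (u, g) \<in> A \<Longrightarrow> Im (cinner u g) = 0"
begin

lemma H_diff: "x \<in> H \<Longrightarrow> y \<in> H \<Longrightarrow> x - y \<in> H"
  using H_add[of x "(-1) *\<^sub>C y"] H_scaleC[of y "-1"] by (simp add: scaleC_minus_one)

lemma A_diff: "(u, g) \<in> A \<Longrightarrow> (v, h) \<in> A \<Longrightarrow> (u - v, g - h) \<in> A"
  using A_add[of u g "(-1) *\<^sub>C v" "(-1) *\<^sub>C h"] A_scaleC[of v h "-1"] by (simp add: scaleC_minus_one)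

lemma Im_cinner_solution:
  assumes "(u, g) \<in> A"
  shows "Im (cinner u (g - z *\<^sub>C u)) = - Im z * (norm u)\<^sup>2"
  using A_sym[OF assms] by (simp add: cinner_diff_right cinner_scaleC_right cinner_self)

text \<open>The quadratic form of \<open>A\<close> is real, so the imaginary part of
  \<open>cinner u (g - z *\<^sub>C u)\<close> is exactly \<open>- Im z\<close> times the squared
  norm of \<open>u\<close>; Cauchy-Schwarz finishes.\<close>

lemma resolvent_bound:
  assumes "(u, g) \<in> A"
  shows "\<bar>Im z\<bar> * norm u \<le> norm (g - z *\<^sub>C u)"
proof (cases "u = 0")
  case False
  have "\<bar>Im z\<bar> * (norm u)\<^sup>2 = \<bar>Im (cinner u (g - z *\<^sub>C u))\<bar>"
    unfolding Im_cinner_solution[OF assms] by (simp add: abs_mult)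
  also have "\<dots> \<le> norm u * norm (g - z *\<^sub>C u)"
    by (rule order_trans[OF abs_Im_le_cmod cinner_Cauchy_Schwarz])
  finally show ?thesis using False by (simp add: power2_eq_square)
qed simp

lemma solution_unique:
  assumes "Im z \<noteq> 0" "(u, g) \<in> A" "(v, h) \<in> A" "g - z *\<^sub>C u = h - z *\<^sub>C v"
  shows "u = v" "g = h"
proof -
  have "g - h - z *\<^sub>C (u - v) = 0"
    using assms(4) by (simp add: scaleC_diff_right algebra_simps)
  then have "\<bar>Im z\<bar> * norm (u - v) \<le> 0"
    using resolvent_bound[OF A_diff[OF assms(2,3)], of z] by simp
  then show "u = v" using assms(1) by (simp add: mult_le_0_iff)
  then show "g = h" using assms(4) by simp
qed

text \<open>With \<open>R\<close> the solution map of the unperturbed equation, the task is the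
  fixed-point equation \<open>u = R (\<phi> - B u)\<close>. By \<open>resolvent_bound\<close> the
  right-hand side is a contraction with factor at most \<open>max M 0 / \<bar>Im z\<bar>\<close>,
  and Banach's theorem replaces the Neumann series.\<close>

lemma perturbed_solution:
  assumes z: "Im z \<noteq> 0" and surj: "\<And>\<phi>. \<phi> \<in> H \<Longrightarrow> \<exists>u g. (u, g) \<in> A \<and> g - z *\<^sub>C u = \<phi>"
    and B_H: "\<And>x. x \<in> H \<Longrightarrow> B x \<in> H"
    and B_diff: "\<And>x y. x \<in> H \<Longrightarrow> y \<in> H \<Longrightarrow> B (x - y) = B x - B y"
    and B_bound: "\<And>x. x \<in> H \<Longrightarrow> norm (B x) \<le> M * norm x" and M: "M < \<bar>Im z\<bar>" and \<phi>: "\<phi> \<in> H"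
  shows "\<exists>u g. (u, g) \<in> A \<and> g + B u - z *\<^sub>C u = \<phi>"
proof -
  obtain R G where RG: "\<And>\<psi>. \<psi> \<in> H \<Longrightarrow> (R \<psi>, G \<psi>) \<in> A \<and> G \<psi> - z *\<^sub>C R \<psi> = \<psi>"
    using surj by metis
  \<comment> \<open>\<open>M\<close> may be negative when \<open>H\<close> is trivial, whereas a
    contraction factor has to be nonnegative.\<close>
  define M' where "M' = max M 0"
  have M': "0 \<le> M'" "M' < \<bar>Im z\<bar>" using M z by (auto simp: M'_def)
  have R: "norm (R \<psi> - R \<xi>) \<le> norm (\<psi> - \<xi>) / \<bar>Im z\<bar>" if "\<psi> \<in> H" "\<xi> \<in> H" for \<psi> \<xi>
  proof -
    have "G \<psi> - G \<xi> - z *\<^sub>C (R \<psi> - R \<xi>) = (G \<psi> - z *\<^sub>C R \<psi>) - (G \<xi> - z *\<^sub>C R \<xi>)"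
      by (simp add: scaleC_diff_right)
    also have "\<dots> = \<psi> - \<xi>" using RG that by simp
    finally have "\<bar>Im z\<bar> * norm (R \<psi> - R \<xi>) \<le> norm (\<psi> - \<xi>)"
      using resolvent_bound[OF A_diff, of "R \<psi>" "G \<psi>" "R \<xi>" "G \<xi>" z] RG that by simp
    then show ?thesis using z by (simp add: field_simps)
  qed
  have "\<exists>!x\<in>H. R (\<phi> - B x) = x"
  proof (rule Banach_fix)
    show "complete H" using closed_H by (simp add: complete_eq_closed)
    show "H \<noteq> {}" using H_0 by auto
    show "0 \<le> M' / \<bar>Im z\<bar>" "M' / \<bar>Im z\<bar> < 1" using M' z by auto
    show "(\<lambda>x. R (\<phi> - B x)) ` H \<subseteq> H"
    proof (intro image_subsetI)
      fix x assume "x \<in> H"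
      then show "R (\<phi> - B x) \<in> H"
        using RG[of "\<phi> - B x"] A_H by (blast intro: H_diff \<phi> B_H)
    qed
    fix x y assume xy: "x \<in> H" "y \<in> H"
    have "norm (R (\<phi> - B x) - R (\<phi> - B y)) \<le> norm (B (y - x)) / \<bar>Im z\<bar>"
      using R[of "\<phi> - B x" "\<phi> - B y"] xy by (simp add: H_diff \<phi> B_H B_diff)
    also have "norm (B (y - x)) \<le> M' * norm (y - x)"
      using order_trans[OF B_bound[of "y - x"] mult_right_mono[of M M' "norm (y - x)"]] xy
      by (simp add: H_diff M'_def)
    finally show "dist (R (\<phi> - B x)) (R (\<phi> - B y)) \<le> M' / \<bar>Im z\<bar> * dist x y"
      using z by (simp add: dist_norm norm_minus_commute divide_right_mono)
  qed
  then obtain x where x: "x \<in> H" "R (\<phi> - B x) = x" by auto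
  have "(x, G (\<phi> - B x)) \<in> A \<and> G (\<phi> - B x) - z *\<^sub>C x = \<phi> - B x"
    using RG[of "\<phi> - B x"] x by (simp add: H_diff \<phi> B_H)
  then show ?thesis by (intro exI[of _ x] exI[of _ "G (\<phi> - B x)"]) (auto simp: algebra_simps)
qed

end

text \<open>Surjectivity of \<open>A - z\<close> for every non-real \<open>z\<close> is the basic
  criterion for self-adjointness of a symmetric operator, and it is exactly what a resolvent
  requires.\<close>

locale selfadjoint_relation = symmetric_relation +
  assumes surj: "\<And>z \<phi>. Im z \<noteq> 0 \<Longrightarrow> \<phi> \<in> H \<Longrightarrow> \<exists>u g. (u, g) \<in> A \<and> g - z *\<^sub>C u = \<phi>"

text \<open>\<open>B\<close> may be large compared with \<open>Im z\<close>, so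
  \<open>perturbed_solution\<close> is applied twice: first at a point \<open>w\<close> so far from
  the real axis that \<open>B\<close> is small there, then to move from \<open>w\<close> back to
  \<open>z\<close>, the perturbation now being the scalar \<open>w - z\<close>.\<close>

lemma (in selfadjoint_relation) bounded_perturbation:
  assumes B_H: "\<And>x. x \<in> H \<Longrightarrow> B x \<in> H"
    and B_add: "\<And>x y. B (x + y) = B x + B y"
    and B_scaleC: "\<And>c x. B (c *\<^sub>C x) = c *\<^sub>C B x"
    and B_sym: "\<And>x. Im (cinner x (B x)) = 0"
    and B_bound: "\<And>x. x \<in> H \<Longrightarrow> norm (B x) \<le> M * norm x"
  shows "selfadjoint_relation {(u, g + B u) |u g. (u, g) \<in> A} H"
proof -
  let ?A = "{(u, g + B u) |u g. (u, g) \<in> A}"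
  have B_diff: "B (x - y) = B x - B y" for x y
    using B_add[of "x - y" y] by simp
  interpret P: symmetric_relation ?A H
  proof
    show "(u + v, g + h) \<in> ?A" if "(u, g) \<in> ?A" "(v, h) \<in> ?A" for u v g h
      using that by (fastforce intro: A_add simp: B_add algebra_simps)
    show "(c *\<^sub>C u, c *\<^sub>C g) \<in> ?A" if "(u, g) \<in> ?A" for u g c
      using that by (fastforce intro: A_scaleC simp: B_scaleC scaleC_add_right)
    show "Im (cinner u g) = 0" if "(u, g) \<in> ?A" for u g
      using that A_sym B_sym by (auto simp: cinner_add_right)
  qed (use A_H B_H in \<open>auto simp: closed_H H_0 H_add H_scaleC\<close>)
  show ?thesis
  proof
    fix z \<phi> assume z: "Im z \<noteq> 0" and \<phi>: "\<phi> \<in> H"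
    \<comment> \<open>\<open>w\<close> lies vertically beyond \<open>z\<close>, at distance exactly
      \<open>\<bar>M\<bar>\<close> from it, and has height \<open>Y\<close>. Since \<open>Y\<close>
      exceeds both \<open>M\<close> and \<open>\<bar>M\<bar>\<close>, each of the two perturbations
      is a contraction.\<close>
    define Y where "Y = \<bar>M\<bar> + \<bar>Im z\<bar>"
    define w where "w = Complex (Re z) (sgn (Im z) * Y)"
    have w: "Im w \<noteq> 0" "\<bar>Im w\<bar> = Y" "M < Y"
      using z by (auto simp: w_def Y_def abs_mult sgn_zero_iff)
    have surj_w: "\<exists>u g. (u, g) \<in> ?A \<and> g - w *\<^sub>C u = \<psi>" if "\<psi> \<in> H" for \<psi>
      using perturbed_solution[OF w(1) surj[OF w(1)] B_H B_diff B_bound _ that] w by auto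
    have "cmod (w - z) = \<bar>sgn (Im z) * Y - Im z\<bar>"
      by (simp add: w_def cmod_def)
    also have "sgn (Im z) * Y - Im z = sgn (Im z) * \<bar>M\<bar>"
      unfolding Y_def by (cases "Im z > 0") (auto simp: algebra_simps sgn_if)
    finally have "cmod (w - z) = \<bar>M\<bar>" using z by (simp add: abs_mult)
    then have "cmod (w - z) < \<bar>Im w\<bar>" using z by (simp add: w Y_def)
    then have "\<exists>u g. (u, g) \<in> ?A \<and> g + (w - z) *\<^sub>C u - w *\<^sub>C u = \<phi>"
      by (intro P.perturbed_solution[OF w(1) surj_w, where M = "cmod (w - z)"])
         (auto simp: H_scaleC scaleC_diff_right \<phi>)
    then show "\<exists>u g. (u, g) \<in> ?A \<and> g - z *\<^sub>C u = \<phi>"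
      by (simp add: scaleC_diff_left)
  qed
qed

text \<open>The equation is solved coefficientwise: the divisor \<open>of_real (l p) - z\<close> has
  modulus at least \<open>\<bar>Im z\<bar>\<close>, so the quotients remain square-summable and
  \<open>Riesz_Fischer\<close> returns a vector.\<close>

lemma (in onb) multiplier_selfadjoint:
  fixes l :: "'i \<Rightarrow> real"
  shows "selfadjoint_relation {(u, g). u \<in> H \<and> g \<in> H \<and> (\<forall>p\<in>I. cinner (e p) g = of_real (l p) * cinner (e p) u)} H"
    (is "selfadjoint_relation ?A H")
proof
  show "Im (cinner u g) = 0" if "(u, g) \<in> ?A" for u g
  proof -
    from that have "u \<in> H" "g \<in> H" and g: "\<And>p. p \<in> I \<Longrightarrow> cinner (e p) g = of_real (l p) * cinner (e p) u" by auto
    have "((\<lambda>p. Im (cnj (cinner (e p) u) * cinner (e p) g)) has_sum Im (cinner u g)) I"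
      by (rule has_sum_bounded_linear[OF bounded_linear_Im Parseval[OF \<open>g \<in> H\<close>], unfolded o_def])
    moreover have "Im (cnj (cinner (e p) u) * cinner (e p) g) = 0" if "p \<in> I" for p
      unfolding g[OF that] by simp
    ultimately have "((\<lambda>p. 0 :: real) has_sum Im (cinner u g)) I"
      using has_sum_cong[of I "\<lambda>p. Im (cnj (cinner (e p) u) * cinner (e p) g)" "\<lambda>p. 0"] by blast
    then show ?thesis using has_sum_unique[OF _ has_sum_0[of I "\<lambda>p. 0 :: real"]] by simp
  qed
next
  fix z \<phi> assume z: "Im z \<noteq> 0" and \<phi>: "\<phi> \<in> H"
  have z': "complex_of_real r - z \<noteq> 0" for r using z by (auto simp: complex_eq_iff)
  define a where "a p = cinner (e p) \<phi> / (of_real (l p) - z)" for p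
  have "cmod (a p) \<le> cmod (cinner (e p) \<phi>) / \<bar>Im z\<bar>" for p
    unfolding a_def norm_divide
    using z z' abs_Im_le_cmod[of "of_real (l p) - z"] by (intro divide_left_mono) auto
  then have *: "(cmod (a p))\<^sup>2 \<le> (1 / \<bar>Im z\<bar>)\<^sup>2 * (cmod (cinner (e p) \<phi>))\<^sup>2" for p
    using power_mono[of "cmod (a p)" "cmod (cinner (e p) \<phi>) / \<bar>Im z\<bar>" 2] by (simp add: power_divide)
  have "(\<lambda>p. (cmod (a p))\<^sup>2) summable_on I"
    by (rule summable_on_comparison_test[OF summable_on_cmult_right[OF summable_coeffs[of \<phi>]] *]) simp_all
  then obtain u where u: "u \<in> H" "\<And>p. p \<in> I \<Longrightarrow> cinner (e p) u = a p"
    using Riesz_Fischer by metis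
  \<comment> \<open>Reading \<open>g\<close> off from the equation places it in \<open>H\<close> at
    once; square-summability of \<open>l p * a p\<close>, with unbounded \<open>l\<close>, then
    comes for free.\<close>
  define g where "g = \<phi> + z *\<^sub>C u"
  have "g \<in> H" by (simp add: g_def H_add H_scaleC \<phi> u)
  moreover have "cinner (e p) g = of_real (l p) * cinner (e p) u" if "p \<in> I" for p
    using z'[of "l p"] by (simp add: g_def cinner_add_right cinner_scaleC_right u that a_def field_simps)
  ultimately show "\<exists>u g. (u, g) \<in> ?A \<and> g - z *\<^sub>C u = \<phi>"
    by (intro exI[of _ u] exI[of _ g]) (auto simp: u(1) g_def)
qed (auto simp: closed_H H_0 H_add H_scaleC cinner_add_right cinner_scaleC_right distrib_left)

section \<open>Spectral measures from the Cayley transform\<close>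

lemma integral_cis_period:
  fixes m :: int
  shows "has_bochner_integral lborel (\<lambda>\<theta>. indicator {0..2 * pi} \<theta> *\<^sub>R cis (of_int m * \<theta>))
           (if m = 0 then 2 * pi else 0)"
proof (cases "m = 0")
  case True
  have "has_bochner_integral lborel (\<lambda>\<theta>. indicator {0..2 * pi} \<theta> *\<^sub>R (1 :: complex))
     (complex_of_real (2 * pi) - complex_of_real 0)"
    by (intro has_bochner_integral_FTC_Icc has_vector_derivative_real_field[where f = "\<lambda>x. x"])
       (auto intro: DERIV_ident)
  then show ?thesis using True by simp
next
  case False
  have "has_bochner_integral lborel (\<lambda>\<theta>. indicator {0..2 * pi} \<theta> *\<^sub>R cis (of_int m * \<theta>))
     (cis (of_int m * (2 * pi)) / (\<i> * of_int m) - cis (of_int m * 0) / (\<i> * of_int m))"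
  proof (rule has_bochner_integral_FTC_Icc)
    fix \<theta> :: real
    show "((\<lambda>\<theta>. cis (of_int m * \<theta>) / (\<i> * of_int m)) has_vector_derivative cis (of_int m * \<theta>)) (at \<theta> within {0..2*pi})"
      unfolding cis_conv_exp using False
      by (auto intro!: derivative_eq_intros has_vector_derivative_real_field simp: field_simps)
  qed (auto intro!: continuous_intros)
  moreover have "cis (of_int m * (2 * pi)) = 1"
    using cis_multiple_2pi[of "of_int m"] by (simp add: mult.commute)
  ultimately show ?thesis using False by simp
qed

text \<open>Herglotz' theorem. The measure is a weak limit of the Fejer densities
  \<open>norm (\<Sum>k<N. cis (- k \<theta>) *\<^sub>C x k)\<^sup>2 / (2 \<pi> N)\<close>, which are nonnegative by construction.\<close>

lemma stationary_sequence_measure: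
  fixes x :: "nat \<Rightarrow> 'a::chilbert"
  assumes stat: "\<And>j k m. cinner (x (j + m)) (x (k + m)) = cinner (x j) (x k)"
    and nrm: "norm (x 0) = 1"
  obtains \<nu> where "real_distribution \<nu>" "\<And>n. cinner (x 0) (x n) = char \<nu> (real n)"
proof -
  define s where "s N \<theta> = (\<Sum>k\<le>N. cis (- (real k * \<theta>)) *\<^sub>C x k)" for N \<theta>
  define p where "p N \<theta> = (norm (s N \<theta>))\<^sup>2 / (2 * pi * real (Suc N))" for N \<theta>
  have s: "complex_of_real ((norm (s N \<theta>))\<^sup>2) =
      (\<Sum>j\<le>N. \<Sum>k\<le>N. cinner (x j) (x k) * cis (of_int (int j - int k) * \<theta>))" for N \<theta>
  proof -
    have *: "cinner (cis (- (real j * \<theta>)) *\<^sub>C x j) (cis (- (real k * \<theta>)) *\<^sub>C x k) =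
        cinner (x j) (x k) * cis (of_int (int j - int k) * \<theta>)" for j k
      unfolding cinner_scaleC_left cinner_scaleC_right cis_cnj mult.assoc[symmetric] cis_mult
      by (simp add: left_diff_distrib right_diff_distrib mult.commute)
    show ?thesis
      unfolding cinner_self[symmetric] s_def cinner_sum_left by (simp only: cinner_sum_right *)
  qed
  have p0: "0 \<le> p N \<theta>" for N \<theta> by (simp add: p_def)
  have meas_s: "(\<lambda>\<theta>. complex_of_real ((norm (s N \<theta>))\<^sup>2)) \<in> borel_measurable borel" for N
    unfolding s by (intro borel_measurable_continuous_onI continuous_intros)
  have meas_p [measurable]: "p N \<in> borel_measurable borel" for N
  proof -
    have "(\<lambda>\<theta>. Re (complex_of_real ((norm (s N \<theta>))\<^sup>2)) / (2 * pi * real (Suc N))) \<in> borel_measurable borel"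
      using meas_s[of N] by measurable
    then show ?thesis by (simp add: p_def[abs_def])
  qed
  \<comment> \<open>Orthogonality of the characters keeps only the pairs with
    \<open>k = j + n\<close>. There are \<open>Suc N - n\<close> of them, which is zero for
    \<open>n > N\<close> by truncated subtraction, and stationarity makes them all equal. The
    resulting factor is the Fejer weight, which tends to 1 for fixed \<open>n\<close>.\<close>
  have int: "has_bochner_integral lborel (\<lambda>\<theta>. indicator {0..2*pi} \<theta> *\<^sub>R (p N \<theta> * cis (real n * \<theta>)))
      (of_nat (Suc N - n) / of_nat (Suc N) * cinner (x 0) (x n))" for N n
  proof -
    let ?e = "\<lambda>j k. (if int j - int k + int n = 0 then 2 * pi else 0)"
    have "has_bochner_integral lborel
       (\<lambda>\<theta>. \<Sum>j\<le>N. \<Sum>k\<le>N. cinner (x j) (x k) * (indicator {0..2*pi} \<theta> *\<^sub>R cis (of_int (int j - int k + int n) * \<theta>)))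
       (\<Sum>j\<le>N. \<Sum>k\<le>N. cinner (x j) (x k) * complex_of_real (?e j k))"
      by (intro has_bochner_integral_sum has_bochner_integral_mult_right integral_cis_period)
    then have "has_bochner_integral lborel
       (\<lambda>\<theta>. (\<Sum>j\<le>N. \<Sum>k\<le>N. cinner (x j) (x k) * (indicator {0..2*pi} \<theta> *\<^sub>R cis (of_int (int j - int k + int n) * \<theta>)))
           / (2 * pi * of_nat (Suc N)))
       ((\<Sum>j\<le>N. \<Sum>k\<le>N. cinner (x j) (x k) * complex_of_real (?e j k)) / (2 * pi * of_nat (Suc N)))"
      by (rule has_bochner_integral_divide_zero)
    moreover have "(\<Sum>j\<le>N. \<Sum>k\<le>N. cinner (x j) (x k) * (indicator {0..2*pi} \<theta> *\<^sub>R cis (of_int (int j - int k + int n) * \<theta>)))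
           / (2 * pi * of_nat (Suc N)) = indicator {0..2*pi} \<theta> *\<^sub>R (p N \<theta> * cis (real n * \<theta>))" for \<theta>
    proof -
      have "cis (of_int (int j - int k + int n) * \<theta>) = cis (of_int (int j - int k) * \<theta>) * cis (real n * \<theta>)" for j k
        by (simp add: cis_mult algebra_simps)
      then show ?thesis
        unfolding p_def of_real_divide s by (simp add: sum_distrib_left sum_distrib_right sum_divide_distrib indicator_def mult.assoc)
    qed
    moreover have "(\<Sum>j\<le>N. \<Sum>k\<le>N. cinner (x j) (x k) * complex_of_real (?e j k)) / (2 * pi * of_nat (Suc N))
        = of_nat (Suc N - n) / of_nat (Suc N) * cinner (x 0) (x n)"
    proof -
      have "(\<Sum>k\<le>N. cinner (x j) (x k) * complex_of_real (?e j k)) =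
          (if j + n \<le> N then 2 * pi * cinner (x 0) (x n) else 0)" for j
      proof -
        have "(\<Sum>k\<le>N. cinner (x j) (x k) * complex_of_real (?e j k)) =
            (\<Sum>k\<le>N. if k = j + n then 2 * pi * cinner (x j) (x (j + n)) else 0)"
          by (intro sum.cong) auto
        also have "\<dots> = (if j + n \<le> N then 2 * pi * cinner (x j) (x (j + n)) else 0)"
          by simp
        also have "cinner (x j) (x (j + n)) = cinner (x 0) (x n)"
          using stat[of 0 j n] by (simp add: add.commute)
        finally show ?thesis .
      qed
      then have "(\<Sum>j\<le>N. \<Sum>k\<le>N. cinner (x j) (x k) * complex_of_real (?e j k)) =
          (\<Sum>j\<le>N. if j + n \<le> N then 2 * pi * cinner (x 0) (x n) else 0)" by simp
      also have "\<dots> = (\<Sum>j\<in>{j\<in>{..N}. j + n \<le> N}. 2 * pi * cinner (x 0) (x n))"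
        by (rule sum.inter_filter[symmetric]) simp
      also have "\<dots> = of_nat (card {j\<in>{..N}. j + n \<le> N}) * (2 * pi * cinner (x 0) (x n))"
        by simp
      also have "{j\<in>{..N}. j + n \<le> N} = {..<Suc N - n}" by auto
      finally show ?thesis by (simp del: of_nat_Suc)
    qed
    ultimately show ?thesis by simp
  qed
  define M where "M N = density lborel (\<lambda>\<theta>. ennreal (indicator {0..2*pi} \<theta> * p N \<theta>))" for N
  have em1: "(\<integral>\<^sup>+\<theta>. ennreal (indicator {0..2*pi} \<theta> * p N \<theta>) \<partial>lborel) = 1" for N
  proof -
    have "has_bochner_integral lborel (\<lambda>\<theta>. Re (indicator {0..2*pi} \<theta> *\<^sub>R (p N \<theta> * cis (real 0 * \<theta>)))) (Re 1)"
      using int[of N 0] by (intro has_bochner_integral_Re) (simp add: cinner_self nrm del: of_nat_Suc)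
    then have "has_bochner_integral lborel (\<lambda>\<theta>. indicator {0..2*pi} \<theta> * p N \<theta>) 1" by simp
    then show ?thesis
      by (subst nn_integral_eq_integral) (auto simp: has_bochner_integral_iff p0)
  qed
  have M: "real_distribution (M N)" for N
  proof -
    have "emeasure (M N) (space (M N)) = 1"
      unfolding M_def by (subst emeasure_density) (auto simp: em1)
    then show ?thesis
      by (auto simp: real_distribution_def real_distribution_axioms_def M_def intro: prob_spaceI)
  qed
  have char_M: "char (M N) (real n) = of_nat (Suc N - n) / of_nat (Suc N) * cinner (x 0) (x n)" for N n
  proof -
    have "char (M N) (real n) = (LINT \<theta>|lborel. (indicator {0..2*pi} \<theta> * p N \<theta>) *\<^sub>R iexp (real n * \<theta>))"
      unfolding char_def M_def by (rule integral_density) (auto simp: p0)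
    also have "\<dots> = (LINT \<theta>|lborel. indicator {0..2*pi} \<theta> *\<^sub>R (p N \<theta> * cis (real n * \<theta>)))"
      by (intro Bochner_Integration.integral_cong refl) (simp add: cis_conv_exp scaleR_conv_of_real mult.assoc)
    also have "\<dots> = of_nat (Suc N - n) / of_nat (Suc N) * cinner (x 0) (x n)"
      using int[of N n] by (rule has_bochner_integral_integral_eq)
    finally show ?thesis .
  qed
  have "tight M"
    unfolding tight_def
  proof (intro conjI allI impI)
    fix \<epsilon> :: real assume \<epsilon>: "0 < \<epsilon>"
    \<comment> \<open>All these measures live on \<open>{0..2*pi}\<close>; the half-open interval
      used in the definition of tightness has to start below 0 and reach beyond
      \<open>2 * pi\<close>.\<close>
    have "measure (M N) {-1<..7} = 1" for N
    proof -
      have pi: "2 * pi \<le> 7" using pi_less_4 pi_approx by simp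
      have "emeasure (M N) {-1<..7} = (\<integral>\<^sup>+\<theta>. ennreal (indicator {0..2*pi} \<theta> * p N \<theta>) * indicator {-1<..7} \<theta> \<partial>lborel)"
        unfolding M_def by (subst emeasure_density) auto
      also have "\<dots> = (\<integral>\<^sup>+\<theta>. ennreal (indicator {0..2*pi} \<theta> * p N \<theta>) \<partial>lborel)"
        using pi by (intro nn_integral_cong) (auto simp: indicator_def)
      finally show ?thesis by (simp add: em1 measure_def)
    qed
    then show "\<exists>a b. a < b \<and> (\<forall>n. measure (M n) {a<..b} > 1 - \<epsilon>)"
      using \<epsilon> by (intro exI[of _ "-1"] exI[of _ 7]) auto
  qed (rule M)
  then obtain r \<nu> where r: "strict_mono r" and \<nu>: "real_distribution \<nu>" and w: "weak_conv_m (M \<circ> id \<circ> r) \<nu>"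
    using tight_imp_convergent_subsubsequence[of M id] by (auto simp: strict_mono_def)
  have "cinner (x 0) (x n) = char \<nu> (real n)" for n
  proof -
    have "(\<lambda>k. char (M (r k)) (real n)) \<longlonglongrightarrow> char \<nu> (real n)"
      using levy_continuity1[OF _ \<nu> w] M by simp
    moreover have "(\<lambda>k. char (M (r k)) (real n)) \<longlonglongrightarrow> cinner (x 0) (x n)"
    proof -
      have "(\<lambda>N. real (Suc N - n) / real (Suc N)) \<longlonglongrightarrow> 1"
      proof (rule Lim_transform_eventually)
        show "(\<lambda>N. 1 - real n * inverse (real (Suc N))) \<longlonglongrightarrow> 1"
          using tendsto_diff[OF tendsto_const tendsto_mult_right[OF LIMSEQ_inverse_real_of_nat, of "real n"], of 1]
            by (simp add: mult.commute)
        show "\<forall>\<^sub>F N in sequentially. 1 - real n * inverse (real (Suc N)) = real (Suc N - n) / real (Suc N)"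
          using eventually_ge_at_top[of n] by eventually_elim (simp add: of_nat_diff field_simps)
      qed
      then have "(\<lambda>N. complex_of_real (real (Suc N - n) / real (Suc N)) * cinner (x 0) (x n)) \<longlonglongrightarrow> of_real 1 * cinner (x 0) (x n)"
        by (intro tendsto_intros)
      then have "(\<lambda>N. char (M N) (real n)) \<longlonglongrightarrow> cinner (x 0) (x n)"
        by (simp add: char_M)
      then show ?thesis by (rule LIMSEQ_subseq_LIMSEQ[OF _ r, unfolded o_def])
    qed
    ultimately show ?thesis by (rule LIMSEQ_unique[rotated])
  qed
  then show ?thesis using that \<nu> by blast
qed

section \<open>Resolvent and Cayley transform of a self-adjoint relation\<close>

context symmetric_relation
begin

text \<open>Polarization: reality of the form at \<open>u + v\<close> and at
  \<open>u + \<i> v\<close> gives the imaginary and the real part of the identity.\<close>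

lemma hermitian:
  assumes "(u, g) \<in> A" "(v, h) \<in> A"
  shows "cinner u h = cinner g v"
proof -
  have 1: "Im (cinner (u + v) (g + h)) = 0" using A_sym A_add assms by blast
  have 2: "Im (cinner (u + \<i> *\<^sub>C v) (g + \<i> *\<^sub>C h)) = 0" using A_sym A_add A_scaleC assms by blast
  have 3: "Im (cinner u g) = 0" "Im (cinner v h) = 0" using A_sym assms by blast+
  have c: "cinner g v = cnj (cinner v g)" by (rule cinner_commute)
  show ?thesis
    using 1 2 3 unfolding c
    by (intro complex_eqI) (auto simp: cinner_add_left cinner_add_right cinner_scaleC_left cinner_scaleC_right)
qed

end

context selfadjoint_relation
begin

definition R :: "complex \<Rightarrow> 'a \<Rightarrow> 'a" where
  "R z \<phi> = (THE u. \<exists>g. (u, g) \<in> A \<and> g - z *\<^sub>C u = \<phi>)"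

lemma R_eq:
  assumes "Im z \<noteq> 0" "(u, g) \<in> A" "g - z *\<^sub>C u = \<phi>"
  shows "R z \<phi> = u"
  unfolding R_def using assms solution_unique(1)[OF assms(1)] by (intro the_equality) blast+

lemma R_A:
  assumes "Im z \<noteq> 0" "\<phi> \<in> H"
  shows "(R z \<phi>, \<phi> + z *\<^sub>C R z \<phi>) \<in> A"
proof -
  obtain u g where u: "(u, g) \<in> A" "g - z *\<^sub>C u = \<phi>" using surj assms by blast
  moreover have "g = \<phi> + z *\<^sub>C u" using u(2) by (simp add: algebra_simps)
  ultimately show ?thesis using R_eq[OF assms(1) u] by simp
qed

lemma R_H: "Im z \<noteq> 0 \<Longrightarrow> \<phi> \<in> H \<Longrightarrow> R z \<phi> \<in> H"
  using R_A A_H by blast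

lemma norm_R_le: "Im z \<noteq> 0 \<Longrightarrow> \<phi> \<in> H \<Longrightarrow> norm (R z \<phi>) \<le> norm \<phi> / \<bar>Im z\<bar>"
  using resolvent_bound[OF R_A, of z \<phi> z] by (simp add: field_simps)

lemma cinner_R_cnj:
  assumes "Im z \<noteq> 0" "\<phi> \<in> H"
  shows "cinner \<phi> (R (cnj z) \<phi>) = cnj (cinner \<phi> (R z \<phi>))"
proof -
  let ?u = "R z \<phi>" and ?v = "R (cnj z) \<phi>"
  have "(?u, \<phi> + z *\<^sub>C ?u) \<in> A" "(?v, \<phi> + cnj z *\<^sub>C ?v) \<in> A"
    using R_A assms by auto
  from hermitian[OF this] have "cinner ?u \<phi> = cinner \<phi> ?v"
    by (simp add: cinner_add_left cinner_add_right cinner_scaleC_left cinner_scaleC_right)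
  then show ?thesis using cinner_commute[of ?u \<phi>] by simp
qed

text \<open>The transform \<open>(A - \<i>) (A + \<i>)\<^sup>-\<^sup>1\<close>, written through the
  resolvent at \<open>- \<i>\<close> so that it is defined on all of \<open>H\<close>. It sends
  \<open>g + \<i> *\<^sub>C u\<close> to \<open>g - \<i> *\<^sub>C u\<close>.\<close>

definition cayley :: "'a \<Rightarrow> 'a" where
  "cayley \<phi> = \<phi> - (2 * \<i>) *\<^sub>C R (- \<i>) \<phi>"

lemma cayley_eq: "(u, g) \<in> A \<Longrightarrow> cayley (g + \<i> *\<^sub>C u) = g - \<i> *\<^sub>C u"
  unfolding cayley_def by (subst R_eq[of "- \<i>" u g]) (auto simp: scaleC_minus_left scaleC_add_left[of \<i> \<i>, simplified])

lemma cayley_cases: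
  assumes "\<phi> \<in> H"
  obtains u g where "(u, g) \<in> A" "\<phi> = g + \<i> *\<^sub>C u"
  using surj[of "- \<i>" \<phi>] assms by (auto simp: scaleC_minus_left)

lemma cayley_H: "\<phi> \<in> H \<Longrightarrow> cayley \<phi> \<in> H"
  by (auto simp: cayley_def intro!: H_diff H_scaleC R_H)

text \<open>In both products the mixed terms cancel by \<open>hermitian\<close>, which leaves
  \<open>cinner g h + cinner u v\<close> on either side.\<close>

lemma cinner_cayley:
  assumes "\<phi> \<in> H" "\<psi> \<in> H"
  shows "cinner (cayley \<phi>) (cayley \<psi>) = cinner \<phi> \<psi>"
proof -
  obtain u g where u: "(u, g) \<in> A" "\<phi> = g + \<i> *\<^sub>C u" using cayley_cases[OF assms(1)] .
  obtain v h where v: "(v, h) \<in> A" "\<psi> = h + \<i> *\<^sub>C v" using cayley_cases[OF assms(2)] .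
  show ?thesis
    using hermitian[OF u(1) v(1)] unfolding u(2) v(2) cayley_eq[OF u(1)] cayley_eq[OF v(1)]
    by (simp add: cinner_add_left cinner_add_right cinner_scaleC_left cinner_scaleC_right cinner_diff_left cinner_diff_right algebra_simps)
qed

lemma cayley_diff:
  assumes "\<phi> \<in> H" "\<psi> \<in> H"
  shows "cayley (\<phi> - \<psi>) = cayley \<phi> - cayley \<psi>"
proof -
  obtain u g where u: "(u, g) \<in> A" "\<phi> = g + \<i> *\<^sub>C u" using cayley_cases[OF assms(1)] .
  obtain v h where v: "(v, h) \<in> A" "\<psi> = h + \<i> *\<^sub>C v" using cayley_cases[OF assms(2)] .
  have "cayley (\<phi> - \<psi>) = cayley ((g - h) + \<i> *\<^sub>C (u - v))"
    by (simp add: u v scaleC_diff_right algebra_simps)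
  also have "\<dots> = (g - h) - \<i> *\<^sub>C (u - v)" by (rule cayley_eq[OF A_diff[OF u(1) v(1)]])
  finally show ?thesis by (simp add: u(2) v(2) cayley_eq[OF u(1)] cayley_eq[OF v(1)] scaleC_diff_right)
qed

lemma cayley_scaleC:
  assumes "\<phi> \<in> H"
  shows "cayley (c *\<^sub>C \<phi>) = c *\<^sub>C cayley \<phi>"
proof -
  obtain u g where u: "(u, g) \<in> A" "\<phi> = g + \<i> *\<^sub>C u" using cayley_cases[OF assms(1)] .
  have "cayley (c *\<^sub>C \<phi>) = cayley (c *\<^sub>C g + \<i> *\<^sub>C (c *\<^sub>C u))"
    by (simp add: u scaleC_add_right scaleC_scaleC mult.commute)
  also have "\<dots> = c *\<^sub>C g - \<i> *\<^sub>C (c *\<^sub>C u)" by (rule cayley_eq[OF A_scaleC[OF u(1)]])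
  finally show ?thesis by (simp add: u(2) cayley_eq[OF u(1)] scaleC_diff_right scaleC_scaleC mult.commute)
qed

lemma cayley_pow:
  assumes "\<phi> \<in> H" "\<psi> \<in> H"
  shows "(cayley ^^ n) \<phi> \<in> H" "cinner ((cayley ^^ n) \<phi>) ((cayley ^^ n) \<psi>) = cinner \<phi> \<psi>"
    "(cayley ^^ n) (\<phi> - \<psi>) = (cayley ^^ n) \<phi> - (cayley ^^ n) \<psi>"
    "(cayley ^^ n) (c *\<^sub>C \<phi>) = c *\<^sub>C (cayley ^^ n) \<phi>"
proof -
  have H: "(cayley ^^ n) \<phi> \<in> H" if "\<phi> \<in> H" for \<phi> n using that by (induction n) (auto intro: cayley_H)
  then show "(cayley ^^ n) \<phi> \<in> H" using assms by blast
  show "cinner ((cayley ^^ n) \<phi>) ((cayley ^^ n) \<psi>) = cinner \<phi> \<psi>"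
    by (induction n) (auto simp: cinner_cayley H assms)
  show "(cayley ^^ n) (\<phi> - \<psi>) = (cayley ^^ n) \<phi> - (cayley ^^ n) \<psi>"
    by (induction n) (auto simp: cayley_diff H assms)
  show "(cayley ^^ n) (c *\<^sub>C \<phi>) = c *\<^sub>C (cayley ^^ n) \<phi>"
    by (induction n) (auto simp: cayley_scaleC H assms)
qed

text \<open>Formally \<open>A = \<i> (1 + U) (1 - U)\<^sup>-\<^sup>1\<close> for the Cayley
  transform \<open>U\<close>, so the resolvent satisfies
  \<open>(\<i> - z) R + (\<i> + z) U R = 1 - U\<close>. Solved for \<open>R\<close> this is a
  recursion whose factor \<open>- (\<i> + z) / (\<i> - z)\<close> has modulus below 1 in the lower
  half-plane, so that it can be iterated.\<close>

lemma resolvent_cayley: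
  assumes "Im z < 0" "\<phi> \<in> H"
  shows "R z \<phi> = (- (\<i> + z) / (\<i> - z)) *\<^sub>C cayley (R z \<phi>) + (1 / (\<i> - z)) *\<^sub>C (\<phi> - cayley \<phi>)"
proof -
  have z: "\<i> - z \<noteq> 0" using assms(1) by (auto simp: complex_eq_iff)
  define u where "u = R z \<phi>"
  define g where "g = \<phi> + z *\<^sub>C u"
  have A: "(u, g) \<in> A" using R_A[of z \<phi>] assms by (simp add: u_def g_def)
  \<comment> \<open>All vectors involved are combinations of \<open>w\<close>, \<open>U w\<close>
    and \<open>U (U w)\<close>, where \<open>w\<close> is \<open>(A + \<i>) u\<close> and
    \<open>U\<close> the Cayley transform; the claim becomes a comparison of coefficients.\<close>
  define w where "w = g + \<i> *\<^sub>C u"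
  have wH: "w \<in> H" and uH: "u \<in> H" using A_H[OF A] by (auto simp: w_def H_add H_scaleC)
  have Uw: "cayley w = g - \<i> *\<^sub>C u" unfolding w_def by (rule cayley_eq[OF A])
  have u: "(2 * \<i>) *\<^sub>C u = w - cayley w"
    using scaleC_add_left[of \<i> \<i> u] unfolding Uw by (simp add: w_def)
  have Uu: "(2 * \<i>) *\<^sub>C cayley u = cayley w - cayley (cayley w)"
    using cayley_scaleC[OF uH, of "2 * \<i>"] cayley_diff[OF wH cayley_H[OF wH]] by (simp add: u)
  have \<phi>w: "(2 * \<i>) *\<^sub>C \<phi> = (\<i> - z) *\<^sub>C w + (\<i> + z) *\<^sub>C cayley w"
  proof -
    have "(\<i> - z) *\<^sub>C w + (\<i> + z) *\<^sub>C cayley w = \<i> *\<^sub>C (w + cayley w) - z *\<^sub>C (w - cayley w)"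
      by (simp add: scaleC_add_right scaleC_diff_right scaleC_add_left scaleC_diff_left algebra_simps)
    also have "w + cayley w = 2 *\<^sub>C g"
      unfolding Uw unfolding w_def using scaleC_add_left[of 1 1 g] by simp
    also have "w - cayley w = (2 * \<i>) *\<^sub>C u" by (simp add: u)
    also have "\<i> *\<^sub>C 2 *\<^sub>C g - z *\<^sub>C (2 * \<i>) *\<^sub>C u = (2 * \<i>) *\<^sub>C (g - z *\<^sub>C u)"
      by (simp add: scaleC_diff_right scaleC_scaleC mult_ac)
    also have "g - z *\<^sub>C u = \<phi>" by (simp add: g_def)
    finally show ?thesis by simp
  qed
  have U\<phi>: "(2 * \<i>) *\<^sub>C cayley \<phi> = (\<i> - z) *\<^sub>C cayley w + (\<i> + z) *\<^sub>C cayley (cayley w)"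
  proof -
    have "(\<i> - z) *\<^sub>C w + (\<i> + z) *\<^sub>C cayley w = (\<i> - z) *\<^sub>C w - (- (\<i> + z)) *\<^sub>C cayley w"
      by (simp only: scaleC_minus_left diff_minus_eq_add)
    then have "cayley ((\<i> - z) *\<^sub>C w + (\<i> + z) *\<^sub>C cayley w)
        = (\<i> - z) *\<^sub>C cayley w - (- (\<i> + z)) *\<^sub>C cayley (cayley w)"
      using wH cayley_H[OF wH] by (simp only: cayley_diff cayley_scaleC H_scaleC)
    then show ?thesis
      using cayley_scaleC[OF assms(2), of "2 * \<i>"] by (simp only: \<phi>w scaleC_minus_left diff_minus_eq_add)
  qed
  have "(2 * \<i> * (\<i> - z)) *\<^sub>C u = (2 * \<i> * (\<i> - z)) *\<^sub>C ((- (\<i> + z) / (\<i> - z)) *\<^sub>C cayley u + (1 / (\<i> - z)) *\<^sub>C (\<phi> - cayley \<phi>))"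
  proof -
    have "(2 * \<i> * (\<i> - z)) *\<^sub>C ((- (\<i> + z) / (\<i> - z)) *\<^sub>C cayley u + (1 / (\<i> - z)) *\<^sub>C (\<phi> - cayley \<phi>))
       = (- (\<i> + z)) *\<^sub>C (2 * \<i>) *\<^sub>C cayley u + ((2 * \<i>) *\<^sub>C \<phi> - (2 * \<i>) *\<^sub>C cayley \<phi>)"
    proof -
      have 1: "(2 * \<i> * (\<i> - z)) * (- (\<i> + z) / (\<i> - z)) = - (\<i> + z) * (2 * \<i>)"
        and 2: "(2 * \<i> * (\<i> - z)) * (1 / (\<i> - z)) = 2 * \<i>"
        using z by (simp_all add: field_simps)
      show ?thesis unfolding scaleC_add_right scaleC_scaleC 1 2 scaleC_diff_right ..
    qed
    also have "\<dots> = (\<i> - z) *\<^sub>C (w - cayley w)"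
      unfolding Uu \<phi>w U\<phi> scaleC_minus_left scaleC_diff_right by (simp add: algebra_simps)
    also have "\<dots> = (2 * \<i> * (\<i> - z)) *\<^sub>C u"
      unfolding u[symmetric] scaleC_scaleC by (simp add: mult.commute)
    finally show ?thesis by simp
  qed
  then have "(1 / (2 * \<i> * (\<i> - z))) *\<^sub>C (2 * \<i> * (\<i> - z)) *\<^sub>C u =
     (1 / (2 * \<i> * (\<i> - z))) *\<^sub>C (2 * \<i> * (\<i> - z)) *\<^sub>C ((- (\<i> + z) / (\<i> - z)) *\<^sub>C cayley u + (1 / (\<i> - z)) *\<^sub>C (\<phi> - cayley \<phi>))"
    by simp
  then show ?thesis using z by (simp add: scaleC_scaleC u_def)
qed

lemma cayley_pow_add:
  assumes "\<phi> \<in> H" "\<psi> \<in> H"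
  shows "(cayley ^^ n) (\<phi> + \<psi>) = (cayley ^^ n) \<phi> + (cayley ^^ n) \<psi>"
proof -
  have "(cayley ^^ n) (\<phi> - (- 1) *\<^sub>C \<psi>) = (cayley ^^ n) \<phi> - (- 1) *\<^sub>C (cayley ^^ n) \<psi>"
    using assms by (simp only: cayley_pow(3,4) H_scaleC)
  then show ?thesis by (simp add: scaleC_minus_left)
qed

text \<open>The measure on the circle representing the powers of the Cayley transform is pushed forward to
  the line by the inverse Cayley transform \<open>\<omega> \<mapsto> \<i> (1 + \<omega>) / (1 - \<omega>)\<close>. An atom at
  \<open>\<omega> = 1\<close> is simply dropped: the resolvent kernel, as a function of \<open>\<omega>\<close>, vanishes there.\<close>

lemma resolvent_measure:
  assumes \<phi>: "\<phi> \<in> H"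
  obtains \<mu> :: "real measure" where "sets \<mu> = sets borel" "finite_measure \<mu>"
    "\<And>z. Im z \<noteq> 0 \<Longrightarrow> cinner \<phi> (R z \<phi>) = (LINT t|\<mu>. 1 / (complex_of_real t - z))"
proof (cases "\<phi> = 0")
  case True
  have "finite_measure (null_measure (borel :: real measure))" by (rule finite_measureI) simp
  then show ?thesis using that[of "null_measure borel"] True by simp
next
  case False
  \<comment> \<open>The sequence is started at the normalized vector so that \<open>\<nu>\<close> is
    a probability measure; \<open>C\<close> restores the mass.\<close>
  define C where "C = (norm \<phi>)\<^sup>2"
  have C: "0 < C" using False by (simp add: C_def)
  define x where "x n = (cayley ^^ n) (complex_of_real (1 / norm \<phi>) *\<^sub>C \<phi>)" for n
  have x0: "x n = complex_of_real (1 / norm \<phi>) *\<^sub>C (cayley ^^ n) \<phi>" for n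
    unfolding x_def by (rule cayley_pow(4)[OF \<phi> \<phi>])
  have "cinner (x (j + m)) (x (k + m)) = cinner (x j) (x k)" for j k m
    unfolding x_def add.commute[of _ m] funpow_add o_apply
    by (intro cayley_pow(2) cayley_pow(1)[OF _ \<phi>] H_scaleC \<phi>)
  moreover have "norm (x 0) = 1" using False by (simp add: x_def norm_divide)
  ultimately obtain \<nu> where \<nu>: "real_distribution \<nu>" "\<And>n. cinner (x 0) (x n) = char \<nu> (real n)"
    using stationary_sequence_measure by blast
  interpret \<nu>: real_distribution \<nu> by (rule \<nu>(1))
  have [simp]: "sets \<nu> = sets borel" by simp
  have c: "cinner \<phi> ((cayley ^^ n) \<phi>) = C * (LINT \<theta>|\<nu>. cis (real n * \<theta>))" for n
  proof -
    have "cinner (x 0) (x n) = cinner \<phi> ((cayley ^^ n) \<phi>) / C"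
      unfolding x0 by (simp add: cinner_scaleC_left cinner_scaleC_right C_def power2_eq_square)
    then show ?thesis
      using C \<nu>(2)[of n] by (simp add: char_def cis_conv_exp field_simps)
  qed
  \<comment> \<open>The quotient is real by itself except for the division by zero at
    \<open>cis \<theta> = 1\<close>. There \<open>t\<close> takes the value 0, and the weight
    \<open>k\<close> below vanishes.\<close>
  define t where "t \<theta> = Re (\<i> * (1 + cis \<theta>) / (1 - cis \<theta>))" for \<theta>
  have t_eq: "complex_of_real (t \<theta>) = \<i> * (1 + cis \<theta>) / (1 - cis \<theta>)" if "cis \<theta> \<noteq> 1" for \<theta>
  proof -
    have "cnj (cis \<theta>) = 1 / cis \<theta>" by (metis cis_cnj cis_inverse inverse_eq_divide)
    moreover have "cis \<theta> \<noteq> 0" by simp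
    ultimately have "cnj (\<i> * (1 + cis \<theta>) / (1 - cis \<theta>)) = \<i> * (1 + cis \<theta>) / (1 - cis \<theta>)"
      using that by (simp add: divide_simps) (simp add: algebra_simps)
    then show ?thesis unfolding t_def by (metis Reals_cnj_iff of_real_Re)
  qed
  have cis_meas [measurable]: "cis \<in> borel_measurable borel"
    by (intro borel_measurable_continuous_onI continuous_intros)
  have t_meas [measurable]: "t \<in> borel_measurable borel"
    unfolding t_def[abs_def] by measurable
  define k where "k \<theta> = C * indicator {\<theta>. cis \<theta> \<noteq> 1} \<theta>" for \<theta>
  have k0: "0 \<le> k \<theta>" "k \<theta> \<le> C" for \<theta> using C by (auto simp: k_def indicator_def)
  have "open {\<theta>. cis \<theta> \<noteq> 1}" by (intro open_Collect_neq continuous_intros)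
  then have k_meas [measurable]: "k \<in> borel_measurable borel"
    unfolding k_def[abs_def] by (intro borel_measurable_times borel_measurable_indicator borel_measurable_const borel_open)
  define \<mu> where "\<mu> = distr (density \<nu> (\<lambda>\<theta>. ennreal (k \<theta>))) borel t"
  have fin: "finite_measure \<mu>"
  proof
    have "emeasure \<mu> (space \<mu>) = (\<integral>\<^sup>+\<theta>. ennreal (k \<theta>) \<partial>\<nu>)"
      unfolding \<mu>_def by (subst emeasure_distr) (auto simp: emeasure_density space_density)
    also have "\<dots> \<le> (\<integral>\<^sup>+\<theta>. ennreal C \<partial>\<nu>)"
      by (intro nn_integral_mono ennreal_leI k0)
    also have "\<dots> < \<infinity>" by (simp add: \<nu>.emeasure_space_1[simplified])
    finally show "emeasure \<mu> (space \<mu>) \<noteq> \<infinity>" by simp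
  qed
  have lower: "cinner \<phi> (R z \<phi>) = (LINT t|\<mu>. 1 / (complex_of_real t - z))" if z: "Im z < 0" for z
  proof -
    have nz: "\<i> - z \<noteq> 0" using z by (auto simp: complex_eq_iff)
    define \<rho> where "\<rho> = - (\<i> + z) / (\<i> - z)"
    define \<kappa> where "\<kappa> = 1 / (\<i> - z)"
    have "(cmod (\<i> + z))\<^sup>2 < (cmod (\<i> - z))\<^sup>2"
      unfolding cmod_power2 using z by (simp add: power2_eq_square algebra_simps)
    then have "cmod (\<i> + z) < cmod (\<i> - z)" by (rule power_less_imp_less_base) simp
    then have \<rho>: "cmod \<rho> < 1" using nz unfolding \<rho>_def norm_divide norm_minus_cancel by simp
    have den: "1 - \<rho> * cis \<theta> \<noteq> 0" for \<theta>
    proof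
      assume "1 - \<rho> * cis \<theta> = 0"
      then have "cmod (\<rho> * cis \<theta>) = 1" by (simp add: eq_iff_diff_eq_0[symmetric])
      then show False using \<rho> by (simp add: norm_mult)
    qed
    \<comment> \<open>The resolvent kernel as a function on the circle:
      \<open>1 / (t \<theta> - z)\<close> where \<open>cis \<theta> \<noteq> 1\<close>, continued by
      0 to the remaining point.\<close>
    define h where "h \<theta> = \<kappa> * ((1 - cis \<theta>) / (1 - \<rho> * cis \<theta>))" for \<theta>
    have h_rec: "h \<theta> = \<kappa> * (1 - cis \<theta>) + \<rho> * (cis \<theta> * h \<theta>)" for \<theta>
      using den[of \<theta>] by (simp add: h_def divide_simps) (simp add: algebra_simps)
    define K where "K = cmod \<kappa> * (2 / (1 - cmod \<rho>))"
    have h_bound: "cmod (h \<theta>) \<le> K" for \<theta>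
    proof -
      have "cmod (1 - cis \<theta>) \<le> 2" using norm_triangle_ineq4[of 1 "cis \<theta>"] by simp
      moreover have "1 - cmod \<rho> \<le> cmod (1 - \<rho> * cis \<theta>)"
        using norm_triangle_ineq2[of 1 "\<rho> * cis \<theta>"] by (simp add: norm_mult)
      ultimately show ?thesis
        using \<rho> unfolding h_def K_def norm_mult norm_divide by (intro mult_left_mono frac_le) auto
    qed
    have [measurable]: "h \<in> borel_measurable borel" unfolding h_def[abs_def] by measurable
    have int_h: "integrable \<nu> (\<lambda>\<theta>. cis (real n * \<theta>) * h \<theta>)" for n
      by (rule \<nu>.integrable_const_bound[of _ "K"])
         (auto simp: norm_mult h_bound)
    have int_cis: "integrable \<nu> (\<lambda>\<theta>. cis (real n * \<theta>))" for n
      by (rule \<nu>.integrable_const_bound[of _ 1]) auto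
    \<comment> \<open>\<open>\<gamma>\<close> and \<open>\<beta>\<close> are bounded and obey the
      same recursion, with the same inhomogeneity. Their difference satisfies
      \<open>\<delta> 0 = \<rho> ^ n * \<delta> n\<close> for every \<open>n\<close>, hence
      \<open>\<delta> 0 = 0\<close>, because \<open>\<rho>\<close> has modulus below 1.\<close>
    define \<gamma> where "\<gamma> n = cinner \<phi> ((cayley ^^ n) (R z \<phi>))" for n
    define \<beta> where "\<beta> n = C * (LINT \<theta>|\<nu>. cis (real n * \<theta>) * h \<theta>)" for n
    let ?c = "\<lambda>n. cinner \<phi> ((cayley ^^ n) \<phi>)"
    have RH: "R z \<phi> \<in> H" using z by (intro R_H \<phi>) simp
    have \<gamma>: "\<gamma> n = \<rho> * \<gamma> (Suc n) + \<kappa> * (?c n - ?c (Suc n))" for n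
    proof -
      have "(cayley ^^ n) (R z \<phi>) = (cayley ^^ n) (\<rho> *\<^sub>C cayley (R z \<phi>) + \<kappa> *\<^sub>C (\<phi> - cayley \<phi>))"
        using resolvent_cayley[OF z \<phi>] by (simp add: \<rho>_def \<kappa>_def)
      also have "\<dots> = \<rho> *\<^sub>C (cayley ^^ n) (cayley (R z \<phi>)) + \<kappa> *\<^sub>C ((cayley ^^ n) \<phi> - (cayley ^^ n) (cayley \<phi>))"
        using RH \<phi> by (simp add: cayley_pow_add cayley_pow(3,4) H_scaleC H_diff cayley_H)
      finally have e: "(cayley ^^ n) (R z \<phi>) = \<dots>" .
      have sw: "(cayley ^^ Suc n) y = (cayley ^^ n) (cayley y)" for y by (simp add: funpow_swap1)
      show ?thesis
        unfolding \<gamma>_def sw e by (simp only: cinner_add_right cinner_scaleC_right cinner_diff_right)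
    qed
    have \<beta>: "\<beta> n = \<rho> * \<beta> (Suc n) + \<kappa> * (?c n - ?c (Suc n))" for n
    proof -
      have "cis (real n * \<theta>) * h \<theta> = \<rho> * (cis (real (Suc n) * \<theta>) * h \<theta>) + \<kappa> * (cis (real n * \<theta>) - cis (real (Suc n) * \<theta>))" for \<theta>
      proof -
        have "cis (real (Suc n) * \<theta>) = cis (real n * \<theta>) * cis \<theta>" by (simp add: cis_mult algebra_simps)
        then show ?thesis by (subst h_rec) (simp add: algebra_simps)
      qed
      then have "(LINT \<theta>|\<nu>. cis (real n * \<theta>) * h \<theta>) =
         (LINT \<theta>|\<nu>. \<rho> * (cis (real (Suc n) * \<theta>) * h \<theta>) + \<kappa> * (cis (real n * \<theta>) - cis (real (Suc n) * \<theta>)))"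
        by simp
      also have "\<dots> = \<rho> * (LINT \<theta>|\<nu>. cis (real (Suc n) * \<theta>) * h \<theta>) +
          \<kappa> * ((LINT \<theta>|\<nu>. cis (real n * \<theta>)) - (LINT \<theta>|\<nu>. cis (real (Suc n) * \<theta>)))"
        using int_h[of "Suc n"] int_cis[of n] int_cis[of "Suc n"] by (simp del: of_nat_Suc)
      finally have e: "(LINT \<theta>|\<nu>. cis (real n * \<theta>) * h \<theta>) = \<dots>" .
      show ?thesis unfolding \<beta>_def c e by (simp add: distrib_left right_diff_distrib mult_ac del: of_nat_Suc)
    qed
    define \<delta> where "\<delta> n = \<gamma> n - \<beta> n" for n
    have \<delta>: "\<delta> n = \<rho> * \<delta> (Suc n)" for n
      unfolding \<delta>_def by (subst \<gamma>, subst \<beta>) (simp add: algebra_simps)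
    have \<delta>0: "\<delta> 0 = \<rho> ^ n * \<delta> n" for n
      by (induction n) (simp, subst (asm) \<delta>, simp add: mult_ac)
    define B where "B = norm \<phi> * norm (R z \<phi>) + C * (K)"
    have \<delta>B: "cmod (\<delta> n) \<le> B" for n
    proof -
      have "norm ((cayley ^^ n) (R z \<phi>)) = norm (R z \<phi>)"
        using cayley_pow(2)[OF RH RH, of n] by (simp add: norm_eq_sqrt_inner flip: Re_cinner)
      then have "cmod (\<gamma> n) \<le> norm \<phi> * norm (R z \<phi>)"
        unfolding \<gamma>_def using cinner_Cauchy_Schwarz by metis
      moreover have "cmod (\<beta> n) \<le> C * (K)"
      proof -
        have "cmod (LINT \<theta>|\<nu>. cis (real n * \<theta>) * h \<theta>) \<le> (LINT \<theta>|\<nu>. cmod (cis (real n * \<theta>) * h \<theta>))"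
          by (rule integral_norm_bound)
        also have "\<dots> \<le> (LINT \<theta>|\<nu>. K)"
          using h_bound by (intro integral_mono[OF integrable_norm[OF int_h]]) (simp_all add: norm_mult)
        also have "\<dots> = K"
          using \<nu>.prob_space by simp
        finally show ?thesis
          unfolding \<beta>_def norm_mult using C by (simp add: mult_left_mono)
      qed
      ultimately show ?thesis
        unfolding \<delta>_def B_def using norm_triangle_ineq4[of "\<gamma> n" "\<beta> n"] by linarith
    qed
    have lim: "(\<lambda>n. cmod \<rho> ^ n * B) \<longlonglongrightarrow> 0 * B"
      by (intro tendsto_mult tendsto_const LIMSEQ_power_zero) (use \<rho> in simp)
    have "cmod (\<delta> 0) \<le> cmod \<rho> ^ n * B" for n
    proof -
      have "cmod (\<delta> 0) = cmod \<rho> ^ n * cmod (\<delta> n)"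
        by (subst \<delta>0[of n]) (simp add: norm_mult norm_power)
      then show ?thesis using \<delta>B[of n] by (simp add: mult_left_mono)
    qed
    then have "cmod (\<delta> 0) \<le> 0 * B" by (intro LIMSEQ_le_const[OF lim]) blast
    then have "\<gamma> 0 = \<beta> 0" by (simp add: \<delta>_def)
    then have "cinner \<phi> (R z \<phi>) = C * (LINT \<theta>|\<nu>. h \<theta>)" by (simp add: \<gamma>_def \<beta>_def)
    also have "\<dots> = (LINT \<theta>|\<nu>. C * h \<theta>)" by simp
    also have "\<dots> = (LINT \<theta>|\<nu>. k \<theta> *\<^sub>R (1 / (complex_of_real (t \<theta>) - z)))"
    proof (intro Bochner_Integration.integral_cong refl)
      fix \<theta>
      show "C * h \<theta> = k \<theta> *\<^sub>R (1 / (complex_of_real (t \<theta>) - z))"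
      proof (cases "cis \<theta> = 1")
        case True then show ?thesis by (simp add: h_def k_def)
      next
        case False
        have e: "(1 - \<rho> * cis \<theta>) * (\<i> - z) = \<i> * (1 + cis \<theta>) - z * (1 - cis \<theta>)"
          using nz by (simp add: \<rho>_def field_simps)
        have "h \<theta> = (1 - cis \<theta>) / ((1 - \<rho> * cis \<theta>) * (\<i> - z))"
          by (simp add: h_def \<kappa>_def)
        also have "\<dots> = 1 / (complex_of_real (t \<theta>) - z)"
          unfolding e t_eq[OF False] using False by (simp add: divide_simps)
        finally show ?thesis using False by (simp add: k_def scaleR_conv_of_real)
      qed
    qed
    also have "\<dots> = (LINT \<theta>|density \<nu> (\<lambda>\<theta>. ennreal (k \<theta>)). 1 / (complex_of_real (t \<theta>) - z))"
      by (rule integral_density[symmetric]) (auto simp: k0)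
    also have "\<dots> = (LINT t|\<mu>. 1 / (complex_of_real t - z))"
      unfolding \<mu>_def by (rule integral_distr[symmetric]) auto
    finally show ?thesis .
  qed
  have "cinner \<phi> (R z \<phi>) = (LINT t|\<mu>. 1 / (complex_of_real t - z))" if z: "Im z \<noteq> 0" for z
  proof (cases "Im z < 0")
    case False
    then have "cinner \<phi> (R (cnj z) \<phi>) = (LINT t|\<mu>. 1 / (complex_of_real t - cnj z))"
      using z by (intro lower) simp
    also have "\<dots> = (LINT t|\<mu>. cnj (1 / (complex_of_real t - z)))" by simp
    also have "\<dots> = cnj (LINT t|\<mu>. 1 / (complex_of_real t - z))"
      by (rule Bochner_Integration.integral_cnj)
    finally show ?thesis using cinner_R_cnj[OF z \<phi>] by simp
  qed (rule lower)
  then show ?thesis using that[of \<mu>] fin by (simp add: \<mu>_def)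
qed

end

section \<open>Completeness of the plane waves on the box\<close>

lemma sets_box_L [measurable]: "box_L L \<in> sets (borel :: (real^'d) measure)"
proof -
  have "box_L L = (\<Inter>i\<in>UNIV. {x :: real^'d. - L / 2 \<le> x $ i} \<inter> {x. x $ i < L / 2})"
    by (auto simp: box_L_def)
  moreover have "{x :: real^'d. - L / 2 \<le> x $ i} \<in> sets borel" "{x :: real^'d. x $ i < L / 2} \<in> sets borel" for i
    by (auto intro!: borel_closed borel_open closed_Collect_le open_Collect_less continuous_intros)
  ultimately show ?thesis by auto
qed

lemma norm_box_L:
  assumes "x \<in> box_L L"
  shows "norm (x :: real^'d) \<le> CARD('d) * (L / 2)"
proof -
  have "norm x \<le> (\<Sum>i\<in>UNIV. \<bar>x $ i\<bar>)" by (rule norm_le_l1_cart)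
  also have "\<dots> \<le> (\<Sum>i\<in>(UNIV :: 'd set). L / 2)"
  proof (rule sum_mono)
    fix i have "- L / 2 \<le> x $ i \<and> x $ i < L / 2" using assms by (simp add: box_L_def)
    then show "\<bar>x $ i\<bar> \<le> L / 2" by linarith
  qed
  finally show ?thesis by simp
qed

definition vol :: "real \<Rightarrow> 'd::finite itself \<Rightarrow> real" where
  "vol L _ = measure lborel (box_L L :: (real^'d) set)"

lemma emeasure_box_L: "emeasure lborel (box_L L :: (real^'d) set) < \<infinity>"
proof -
  have "box_L L \<subseteq> cball (0 :: real^'d) (CARD('d) * (L / 2))" using norm_box_L by auto
  then have "emeasure lborel (box_L L :: (real^'d) set) \<le> emeasure lborel (cball (0 :: real^'d) (CARD('d) * (L / 2)))"
    by (intro emeasure_mono) auto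
  also have "\<dots> < \<infinity>" by (rule emeasure_bounded_finite) simp
  finally show ?thesis .
qed

lemma vol_pos:
  assumes "0 < L"
  shows "0 < vol L TYPE('d::finite)"
proof -
  have sub: "ball (0 :: real^'d) (L / 2) \<subseteq> box_L L"
  proof
    fix x :: "real^'d" assume "x \<in> ball 0 (L / 2)"
    then have "norm x < L / 2" by simp
    then have "- L / 2 \<le> x $ i \<and> x $ i < L / 2" for i
      using component_le_norm_cart[of x i] by linarith
    then show "x \<in> box_L L" by (simp add: box_L_def)
  qed
  have "0 < measure lborel (ball (0 :: real^'d) (L / 2))" using assms by (simp add: content_ball_pos)
  also have "\<dots> \<le> vol L TYPE('d)"
    unfolding vol_def using sub emeasure_box_L by (intro measure_mono_fmeasurable) (auto simp: fmeasurable_def)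
  finally show ?thesis .
qed

lemma integrable_bounded_box:
  assumes [measurable]: "F \<in> borel_measurable borel" and "\<And>x. cmod (F x) \<le> B"
  shows "integrable lborel (\<lambda>x :: real^'d. indicator (box_L L) x * F x)"
proof (rule Bochner_Integration.integrable_bound)
  show "integrable lborel (\<lambda>x :: real^'d. B * indicator (box_L L) x)"
    using emeasure_box_L by (intro integrable_mult_right integrable_real_indicator) auto
  show "AE x in lborel. cmod (indicator (box_L L) x * F x) \<le> norm (B * indicator (box_L L) x)"
    using assms(2) by (intro AE_I2) (auto simp: norm_mult indicator_def intro: order_trans[OF _ abs_ge_self])
qed measurable

lemma integral_translate:
  fixes f :: "'a::euclidean_space \<Rightarrow> 'b::{banach, second_countable_topology}"
  assumes [measurable]: "f \<in> borel_measurable borel"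
  shows "(LINT x|lborel. f (x + a)) = (LINT x|lborel. f x)"
proof -
  have "(LINT x|lborel. f x) = (LINT x|distr lborel borel ((+) a). f x)" by (simp add: lborel_distr_plus)
  also have "\<dots> = (LINT x|lborel. f (a + x))" by (rule integral_distr) auto
  finally show ?thesis by (simp add: add.commute)
qed

definition wave :: "real^'d \<Rightarrow> real^'d \<Rightarrow> complex" where
  "wave p x = cis (2 * pi * (p \<bullet> x))"

lemma wave_meas [measurable]: "wave p \<in> borel_measurable borel"
  unfolding wave_def by (intro borel_measurable_continuous_onI continuous_intros)

lemma cmod_wave [simp]: "cmod (wave p x) = 1"
  by (simp add: wave_def)

lemma wave_mult: "wave p x * wave q x = wave (p + q) x"
  by (simp add: wave_def cis_mult inner_add_left distrib_left)

lemma wave_cnj: "cnj (wave p x) = wave (- p) x"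
  by (simp add: wave_def cis_cnj)

lemma wave_zero [simp]: "wave 0 x = 1"
  by (simp add: wave_def)

lemma wave_translate: "wave k (x + a *\<^sub>R axis j 1) = cis (2 * pi * k $ j * a) * wave k x"
  by (simp add: wave_def inner_add_right cis_mult inner_axis algebra_simps)

lemma dual_lattice_0: "0 \<in> dual_lattice L"
  and dual_lattice_add: "p \<in> dual_lattice L \<Longrightarrow> q \<in> dual_lattice L \<Longrightarrow> p + q \<in> dual_lattice L"
  and dual_lattice_diff: "p \<in> dual_lattice L \<Longrightarrow> q \<in> dual_lattice L \<Longrightarrow> p - q \<in> dual_lattice L"
  and dual_lattice_minus: "p \<in> dual_lattice L \<Longrightarrow> - p \<in> dual_lattice L"
  by (auto simp: dual_lattice_def distrib_left right_diff_distrib)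

lemma dual_lattice_axis: "L \<noteq> 0 \<Longrightarrow> (1 / L) *\<^sub>R axis j 1 \<in> dual_lattice L"
  by (auto simp: dual_lattice_def axis_def)

text \<open>The integral of a periodic function over the box does not change under translation.
  Translating by half a wavelength along an axis with \<open>k $ j \<noteq> 0\<close> reverses the
  sign of the wave, so the integral equals its own negative.\<close>

lemma wave_integral_zero:
  assumes k: "k \<in> dual_lattice L" "k \<noteq> 0" and L: "0 < L"
  shows "(LINT x|lborel. indicator (box_L L) x * wave k (x :: real^'d)) = 0"
proof -
  obtain j where j: "k $ j \<noteq> 0" using k(2) by (auto simp: vec_eq_iff)
  obtain m :: int where m: "L * k $ j = of_int m" using k(1) by (auto simp: dual_lattice_def elim: Ints_cases)
  have m0: "m \<noteq> 0" using j L m by auto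
  have kj: "k $ j = of_int m / L" using m L by (simp add: field_simps)
  \<comment> \<open>Half the wavelength in direction \<open>j\<close>. As \<open>m\<close> is a
    nonzero integer, \<open>a\<close> is at most \<open>L\<close>, so the translated box sticks out
    on one side only.\<close>
  define a where "a = L / (2 * \<bar>of_int m\<bar>)"
  have am: "1 \<le> \<bar>real_of_int m\<bar>" using m0 by linarith
  have a: "0 \<le> a" "a \<le> L" using L am by (auto simp: a_def divide_simps)
  let ?e = "axis j 1 :: real^'d"
  define S where "S = {x \<in> box_L L. x $ j < - L / 2 + a}"
  define B where "B = {x \<in> box_L L. - L / 2 + a \<le> (x :: real^'d) $ j}"
  have [measurable]: "S \<in> sets borel" "B \<in> sets borel"
  proof -
    have "S = box_L L \<inter> {x. x $ j < - L / 2 + a}" "B = box_L L \<inter> {x. - L / 2 + a \<le> x $ j}"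
      by (auto simp: S_def B_def)
    then show "S \<in> sets borel" "B \<in> sets borel"
      by (auto intro!: sets.Int borel_open borel_closed open_Collect_less closed_Collect_le continuous_intros)
  qed
  have intS: "integrable lborel (\<lambda>x. indicator S x * wave k x)"
    and intB: "integrable lborel (\<lambda>x. indicator B x * wave k x)"
  proof -
    have "integrable lborel (\<lambda>x. indicator (box_L L) x * (indicator S x * wave k x))"
      "integrable lborel (\<lambda>x. indicator (box_L L) x * (indicator B x * wave k x))"
      by (intro integrable_bounded_box[where B = 1]; simp add: norm_mult indicator_def)+
    moreover have "indicator (box_L L) x * (indicator S x * wave k x) = indicator S x * wave k x"
      "indicator (box_L L) x * (indicator B x * wave k x) = indicator B x * wave k x" for x
      by (auto simp: S_def B_def indicator_def)
    ultimately show "integrable lborel (\<lambda>x. indicator S x * wave k x)"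
      "integrable lborel (\<lambda>x. indicator B x * wave k x)" by simp_all
  qed
  let ?f = "\<lambda>x. indicator (box_L L) x * wave k x"
  \<comment> \<open>The translated box consists of the part \<open>B\<close> that stays inside and
    the slab \<open>S\<close> carried over by a full period.\<close>
  have shift: "indicator (box_L L) (x - a *\<^sub>R ?e) = (indicator B x + indicator S (x - L *\<^sub>R ?e) :: complex)" for x
  proof -
    have coord: "(x - c *\<^sub>R ?e) $ i = (if i = j then x $ j - c else x $ i)" for c i
      by (simp add: axis_def)
    have 1: "x - a *\<^sub>R ?e \<in> box_L L \<longleftrightarrow> (\<forall>i. i \<noteq> j \<longrightarrow> - L / 2 \<le> x $ i \<and> x $ i < L / 2) \<and> - L / 2 + a \<le> x $ j \<and> x $ j < L / 2 + a"
      unfolding box_L_def mem_Collect_eq coord by (auto split: if_splits)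
    have 2: "x \<in> B \<longleftrightarrow> (\<forall>i. i \<noteq> j \<longrightarrow> - L / 2 \<le> x $ i \<and> x $ i < L / 2) \<and> - L / 2 + a \<le> x $ j \<and> x $ j < L / 2"
      unfolding box_L_def B_def mem_Collect_eq using a by (auto split: if_splits) (smt (verit))+
    have 3: "x - L *\<^sub>R ?e \<in> S \<longleftrightarrow> (\<forall>i. i \<noteq> j \<longrightarrow> - L / 2 \<le> x $ i \<and> x $ i < L / 2) \<and> L / 2 \<le> x $ j \<and> x $ j < L / 2 + a"
      unfolding box_L_def S_def mem_Collect_eq coord using a by (auto split: if_splits)
    show ?thesis using 1 2 3 a by (auto simp: indicator_def)
  qed
  have eS: "indicator S (x - L *\<^sub>R ?e) * wave k x = (\<lambda>y. indicator S y * wave k y) (x + (- L) *\<^sub>R ?e)" for x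
  proof -
    have "2 * pi * k $ j * (- L) = 2 * pi * of_int (- m)" using m by (simp add: mult_ac)
    then have "cis (2 * pi * k $ j * (- L)) = 1" by (metis Ints_of_int cis_multiple_2pi)
    then have "wave k (x + (- L) *\<^sub>R ?e) = wave k x" unfolding wave_translate by simp
    then show ?thesis by simp
  qed
  have intS': "integrable lborel (\<lambda>x. indicator S (x - L *\<^sub>R ?e) * wave k x)"
  proof -
    have "integrable (distr lborel borel ((+) ((- L) *\<^sub>R ?e))) (\<lambda>x. indicator S x * wave k x)"
      using intS by (simp add: lborel_distr_plus)
    then have "integrable lborel (\<lambda>x. (\<lambda>y. indicator S y * wave k y) ((- L) *\<^sub>R ?e + x))"
      by (subst (asm) integrable_distr_eq) auto
    then show ?thesis unfolding eS by (simp add: add.commute)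
  qed
  have "cis (2 * pi * k $ j * a) * (LINT x|lborel. ?f x) = (LINT x|lborel. indicator (box_L L) x * wave k (x + a *\<^sub>R ?e))"
    unfolding wave_translate by (subst integral_mult_right_zero[symmetric]) (simp add: mult_ac)
  also have "\<dots> = (LINT x|lborel. (\<lambda>y. indicator (box_L L) (y - a *\<^sub>R ?e) * wave k y) (x + a *\<^sub>R ?e))"
    by simp
  also have "\<dots> = (LINT x|lborel. indicator (box_L L) (x - a *\<^sub>R ?e) * wave k x)"
    by (rule integral_translate) measurable
  also have "\<dots> = (LINT x|lborel. indicator B x * wave k x) + (LINT x|lborel. indicator S (x - L *\<^sub>R ?e) * wave k x)"
    unfolding shift distrib_right by (rule Bochner_Integration.integral_add[OF intB intS'])
  also have "(LINT x|lborel. indicator S (x - L *\<^sub>R ?e) * wave k x) = (LINT x|lborel. indicator S x * wave k x)"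
    unfolding eS by (rule integral_translate) measurable
  also have "(LINT x|lborel. indicator B x * wave k x) + (LINT x|lborel. indicator S x * wave k x) = (LINT x|lborel. ?f x)"
    unfolding Bochner_Integration.integral_add[OF intB intS, symmetric]
    by (intro Bochner_Integration.integral_cong) (auto simp: S_def B_def indicator_def)
  finally have *: "cis (2 * pi * k $ j * a) * (LINT x|lborel. ?f x) = (LINT x|lborel. ?f x)" .
  have "cis (2 * pi * k $ j * a) = -1"
  proof -
    have "2 * pi * k $ j * a = (if m > 0 then pi else - pi)"
      using L m0 by (simp add: kj a_def abs_if field_simps)
    then show ?thesis by (simp add: complex_eq_iff)
  qed
  then show ?thesis using * by simp
qed

text \<open>If all Fourier coefficients of \<open>g\<close> vanish, the set of bounded \<open>F\<close> such that all coefficients of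
  \<open>F g\<close> vanish contains \<open>1\<close> and is closed under multiplication by \<open>cos (2 \<pi> x\<^sub>j / L)\<close> and
  \<open>sin (2 \<pi> x\<^sub>j / L)\<close> and under bounded pointwise limits; hence it contains the indicators of all
  Borel sets.\<close>

locale vanishing_coeffs =
  fixes L :: real and g :: "real^'d \<Rightarrow> complex"
  assumes L: "0 < L" and g: "integrable lborel g"
    and supp: "\<And>x. x \<notin> box_L L \<Longrightarrow> g x = 0"
    and coeffs: "\<And>p. p \<in> dual_lattice L \<Longrightarrow> (LINT x|lborel. wave p x * g x) = 0"
begin

definition ann :: "(real^'d \<Rightarrow> real) set" where
  "ann = {F. F \<in> borel_measurable borel \<and> (\<exists>B. \<forall>x. \<bar>F x\<bar> \<le> B) \<and>
     (\<forall>p\<in>dual_lattice L. (LINT x|lborel. F x * (wave p x * g x)) = 0)}"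

lemma annI:
  "F \<in> borel_measurable borel \<Longrightarrow> (\<And>x. \<bar>F x\<bar> \<le> B) \<Longrightarrow>
   (\<And>p. p \<in> dual_lattice L \<Longrightarrow> (LINT x|lborel. F x * (wave p x * g x)) = 0) \<Longrightarrow> F \<in> ann"
  by (auto simp: ann_def)

lemma g_meas [measurable]: "g \<in> borel_measurable borel"
  using g by (auto dest: borel_measurable_integrable)

lemma ann_meas: "F \<in> ann \<Longrightarrow> F \<in> borel_measurable borel"
  by (simp add: ann_def)

lemma integrable_bounded_mult_g:
  assumes [measurable]: "F \<in> borel_measurable borel" and "\<And>x. cmod (F x) \<le> B"
  shows "integrable lborel (\<lambda>x. F x * (wave p x * g x))"
proof (rule Bochner_Integration.integrable_bound)
  show "integrable lborel (\<lambda>x. B * cmod (g x))" using g by auto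
  show "AE x in lborel. cmod (F x * (wave p x * g x)) \<le> norm (B * cmod (g x))"
    using assms(2) by (intro AE_I2) (auto simp: norm_mult abs_mult intro!: mult_right_mono intro: order_trans[OF _ abs_ge_self])
qed measurable

lemma integrable_ann: "F \<in> ann \<Longrightarrow> integrable lborel (\<lambda>x. complex_of_real (F x) * (wave p x * g x))"
  unfolding ann_def by (auto intro!: integrable_bounded_mult_g)

lemma ann_one: "(\<lambda>x. 1) \<in> ann"
  by (rule annI[where B = 1]) (auto simp: coeffs)

lemma ann_add:
  assumes "F \<in> ann" "G \<in> ann" shows "(\<lambda>x. F x + G x) \<in> ann"
proof -
  obtain B C where "\<And>x. \<bar>F x\<bar> \<le> B" "\<And>x. \<bar>G x\<bar> \<le> C" using assms by (auto simp: ann_def)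
  then have "\<bar>F x + G x\<bar> \<le> B + C" for x by (meson abs_triangle_ineq add_mono order_trans)
  then show ?thesis
    using assms ann_meas[OF assms(1)] ann_meas[OF assms(2)] integrable_ann[OF assms(1)] integrable_ann[OF assms(2)]
    by (intro annI[where B = "B + C"]) (auto simp: distrib_right ann_def)
qed

lemma ann_cmult:
  assumes "F \<in> ann" shows "(\<lambda>x. c * F x) \<in> ann"
proof -
  obtain B where "\<And>x. \<bar>F x\<bar> \<le> B" using assms by (auto simp: ann_def)
  then have "\<bar>c * F x\<bar> \<le> \<bar>c\<bar> * B" for x by (simp add: abs_mult mult_left_mono)
  then show ?thesis
    using assms ann_meas[OF assms(1)]
    by (intro annI[where B = "\<bar>c\<bar> * B"]) (auto simp: mult.assoc ann_def)
qed

text \<open>Dominated convergence with a multiple of \<open>cmod (g x)\<close> as majorant.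
  Convergence is asked for on the box alone because \<open>g\<close> vanishes elsewhere;
  \<open>sig_cong\<close> exploits this.\<close>

lemma ann_limit:
  assumes F: "\<And>n. F n \<in> ann" and B: "\<And>n x. \<bar>F n x\<bar> \<le> B" and lim: "\<And>x. x \<in> box_L L \<Longrightarrow> (\<lambda>n. F n x) \<longlonglongrightarrow> G x"
    and G[measurable]: "G \<in> borel_measurable borel" and GB: "\<And>x. \<bar>G x\<bar> \<le> C"
  shows "G \<in> ann"
proof (rule annI[OF G GB])
  fix p :: "real^'d" assume p: "p \<in> dual_lattice L"
  note [measurable] = ann_meas[OF F]
  have "(\<lambda>n. LINT x|lborel. complex_of_real (F n x) * (wave p x * g x)) \<longlonglongrightarrow> (LINT x|lborel. complex_of_real (G x) * (wave p x * g x))"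
  proof (rule integral_dominated_convergence[where w = "\<lambda>x. B * cmod (g x)"])
    show "integrable lborel (\<lambda>x. B * cmod (g x))" using g by auto
    show "AE x in lborel. (\<lambda>n. complex_of_real (F n x) * (wave p x * g x)) \<longlonglongrightarrow> complex_of_real (G x) * (wave p x * g x)"
    proof (rule AE_I2)
      fix x show "(\<lambda>n. complex_of_real (F n x) * (wave p x * g x)) \<longlonglongrightarrow> complex_of_real (G x) * (wave p x * g x)"
      proof (cases "x \<in> box_L L")
        case True then show ?thesis by (intro tendsto_intros lim)
      qed (simp add: supp)
    qed
    show "AE x in lborel. cmod (complex_of_real (F n x) * (wave p x * g x)) \<le> B * cmod (g x)" for n
      using B by (intro AE_I2) (simp add: norm_mult mult_right_mono)
  qed measurable
  moreover have "(LINT x|lborel. complex_of_real (F n x) * (wave p x * g x)) = 0" for n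
    using F p by (simp add: ann_def)
  ultimately show "(LINT x|lborel. complex_of_real (G x) * (wave p x * g x)) = 0"
    by (simp add: LIMSEQ_const_iff)
qed

text \<open>Both functions are combinations of the waves of frequency
  \<open>(1 / L) *\<^sub>R axis j 1\<close> and its negative. Multiplication by these shifts
  \<open>p\<close> within the dual lattice, over which \<open>ann\<close> quantifies.\<close>

lemma ann_trig:
  assumes F: "F \<in> ann"
  shows "(\<lambda>x. F x * cos (2 * pi * x $ j / L)) \<in> ann" "(\<lambda>x. F x * sin (2 * pi * x $ j / L)) \<in> ann"
proof -
  obtain B where B: "\<And>x. \<bar>F x\<bar> \<le> B" using F by (auto simp: ann_def)
  note [measurable] = ann_meas[OF F]
  have [measurable]: "(\<lambda>x :: real^'d. cos (2 * pi * x $ j / L)) \<in> borel_measurable borel"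
    "(\<lambda>x :: real^'d. sin (2 * pi * x $ j / L)) \<in> borel_measurable borel"
    by (intro borel_measurable_continuous_onI continuous_intros; use L in simp)+
  let ?e = "(1 / L) *\<^sub>R axis j 1 :: real^'d"
  have w: "wave ?e x = cis (2 * pi * x $ j / L)" "wave (- ?e) x = cis (- (2 * pi * x $ j / L))" for x
    by (simp_all add: wave_def inner_axis inner_commute)
  have le: "\<bar>F x * r\<bar> \<le> B" if "\<bar>r\<bar> \<le> 1" for x r
    using mult_mono[OF B that] B[of x] by (simp add: abs_mult)
  have cos: "complex_of_real (F x * cos (2 * pi * x $ j / L)) * (wave p x * g x) =
      (1 / 2) * (complex_of_real (F x) * (wave (p + ?e) x * g x) + complex_of_real (F x) * (wave (p + - ?e) x * g x))" for x p
  proof -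
    have c: "complex_of_real (cos t) = (1 / 2) * (cis t + cis (- t))" for t by (simp add: complex_eq_iff)
    show ?thesis unfolding wave_mult[symmetric] w of_real_mult c by (simp add: algebra_simps)
  qed
  have sin: "complex_of_real (F x * sin (2 * pi * x $ j / L)) * (wave p x * g x) =
      (- \<i> / 2) * (complex_of_real (F x) * (wave (p + ?e) x * g x) - complex_of_real (F x) * (wave (p + - ?e) x * g x))" for x p
  proof -
    have c: "complex_of_real (sin t) = (- \<i> / 2) * (cis t - cis (- t))" for t by (simp add: complex_eq_iff)
    show ?thesis unfolding wave_mult[symmetric] w of_real_mult c by (simp add: algebra_simps)
  qed
  have z: "(LINT x|lborel. complex_of_real (F x) * (wave (p + ?e) x * g x)) = 0"
     "(LINT x|lborel. complex_of_real (F x) * (wave (p + - ?e) x * g x)) = 0" if "p \<in> dual_lattice L" for p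
  proof -
    have "?e \<in> dual_lattice L" using L by (intro dual_lattice_axis) simp
    then have "p + ?e \<in> dual_lattice L" "p + - ?e \<in> dual_lattice L"
      using that by (blast intro: dual_lattice_add dual_lattice_minus)+
    then show "(LINT x|lborel. complex_of_real (F x) * (wave (p + ?e) x * g x)) = 0"
      "(LINT x|lborel. complex_of_real (F x) * (wave (p + - ?e) x * g x)) = 0"
      using F unfolding ann_def by blast+
  qed
  show "(\<lambda>x. F x * cos (2 * pi * x $ j / L)) \<in> ann"
    by (rule annI[where B = B])
       (measurable, simp add: le, simp only: cos integral_mult_right_zero Bochner_Integration.integral_add[OF integrable_ann[OF F] integrable_ann[OF F]] z, simp)
  show "(\<lambda>x. F x * sin (2 * pi * x $ j / L)) \<in> ann"
    by (rule annI[where B = B])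
       (measurable, simp add: le, simp only: sin integral_mult_right_zero Bochner_Integration.integral_diff[OF integrable_ann[OF F] integrable_ann[OF F]] z, simp)
qed

text \<open>The indicator has to map \<open>ann\<close> into itself, which is stronger than
  belonging to \<open>ann\<close>. This makes \<open>sig\<close> closed under intersections, so it
  is a sigma-algebra directly and no pi-lambda argument is called for.\<close>

definition sig :: "(real^'d) set set" where
  "sig = {A \<in> sets borel. \<forall>F\<in>ann. (\<lambda>x. F x * indicator A x) \<in> ann}"

text \<open>A constant sequence in \<open>ann_limit\<close>: on the box
  \<open>F x * indicator A x\<close> already equals its limit
  \<open>F x * indicator B x\<close>.\<close>

lemma sig_cong: "A \<in> sig \<Longrightarrow> B \<in> sets borel \<Longrightarrow> A \<inter> box_L L = B \<inter> box_L L \<Longrightarrow> B \<in> sig"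
proof -
  assume A: "A \<in> sig" and B: "B \<in> sets borel" and eq: "A \<inter> box_L L = B \<inter> box_L L"
  have "(\<lambda>x. F x * indicator B x) \<in> ann" if F: "F \<in> ann" for F
  proof -
    obtain C where C: "\<And>x. \<bar>F x\<bar> \<le> C" using F by (auto simp: ann_def)
    have FA: "(\<lambda>x. F x * indicator A x) \<in> ann" using A F by (simp add: sig_def)
    have C0: "0 \<le> C" using order_trans[OF abs_ge_zero C] by blast
    note [measurable] = ann_meas[OF F] B
    show ?thesis
    proof (rule ann_limit)
      show "(\<lambda>x. F x * indicator A x) \<in> ann" by (rule FA)
      show "\<bar>F x * indicator A x\<bar> \<le> C" "\<bar>F x * indicator B x\<bar> \<le> C" for x
        using C[of x] C0 by (auto simp: indicator_def)
      show "(\<lambda>n. F x * indicator A x) \<longlonglongrightarrow> F x * indicator B x" if "x \<in> box_L L" for x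
        using eq that by (auto simp: indicator_def)
    qed measurable
  qed
  then show ?thesis using B by (simp add: sig_def)
qed

lemma sig_Compl:
  assumes "A \<in> sig" shows "- A \<in> sig"
proof -
  have "(\<lambda>x. F x * indicator (- A) x) \<in> ann" if "F \<in> ann" for F
  proof -
    have "(\<lambda>x. F x + (-1) * (F x * indicator A x)) \<in> ann"
      using assms that by (intro ann_add ann_cmult) (auto simp: sig_def)
    moreover have "F x + (-1) * (F x * indicator A x) = F x * indicator (- A) x" for x
      by (simp add: indicator_def)
    ultimately show ?thesis by simp
  qed
  moreover have "- A \<in> sets borel" using assms by (auto simp: sig_def Compl_eq_Diff_UNIV)
  ultimately show ?thesis by (simp add: sig_def)
qed

lemma sig_Int:
  assumes "A \<in> sig" "B \<in> sig" shows "A \<inter> B \<in> sig"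
proof -
  have "(\<lambda>x. F x * indicator (A \<inter> B) x) \<in> ann" if "F \<in> ann" for F
  proof -
    have "(\<lambda>x. (F x * indicator A x) * indicator B x) \<in> ann" using assms that by (simp add: sig_def)
    then show ?thesis by (simp add: indicator_inter_arith mult.assoc)
  qed
  then show ?thesis using assms by (auto simp: sig_def)
qed

lemma sig_Inter:
  assumes "\<And>n :: nat. A n \<in> sig" shows "(\<Inter>n. A n) \<in> sig"
proof -
  define D where "D n = (\<Inter>k\<le>n. A k)" for n
  have D: "D n \<in> sig" for n
    unfolding D_def by (induction n) (auto simp: assms atMost_Suc intro: sig_Int)
  have "(\<lambda>x. F x * indicator (\<Inter>n. A n) x) \<in> ann" if F: "F \<in> ann" for F
  proof -
    obtain C where C: "\<And>x. \<bar>F x\<bar> \<le> C" using F by (auto simp: ann_def)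
    have C0: "0 \<le> C" using order_trans[OF abs_ge_zero C] by blast
    have lim: "(\<lambda>n. F x * indicator (D n) x) \<longlonglongrightarrow> F x * indicator (\<Inter>n. A n) x" for x
    proof (cases "x \<in> (\<Inter>n. A n)")
      case True then show ?thesis by (auto simp: D_def indicator_def)
    next
      case False
      then obtain m where m: "x \<notin> A m" by auto
      have "\<forall>\<^sub>F n in sequentially. F x * indicator (D n) x = F x * indicator (\<Inter>n. A n) x"
        using eventually_ge_at_top[of m] by eventually_elim (use m in \<open>auto simp: D_def indicator_def\<close>)
      then show ?thesis by (rule tendsto_eventually)
    qed
    have [measurable]: "(\<Inter>n. A n) \<in> sets borel" using assms by (auto simp: sig_def)
    note [measurable] = ann_meas[OF F]
    show ?thesis
    proof (rule ann_limit)
      show "(\<lambda>x. F x * indicator (D n) x) \<in> ann" for n using D[of n] F by (simp add: sig_def)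
      show "\<bar>F x * indicator (D n) x\<bar> \<le> C" "\<bar>F x * indicator (\<Inter>n. A n) x\<bar> \<le> C" for n x
        using C[of x] C0 by (auto simp: indicator_def)
    qed (rule lim, measurable)
  qed
  moreover have "(\<Inter>n. A n) \<in> sets borel" using assms by (auto simp: sig_def)
  ultimately show ?thesis by (simp add: sig_def)
qed

lemma sig_empty: "{} \<in> sig"
  using ann_cmult[of _ 0] by (simp add: sig_def)

lemma sig_sigma_algebra: "sigma_algebra UNIV sig"
  unfolding sigma_algebra_iff2
proof (intro conjI allI impI ballI)
  show "{} \<in> sig" by (rule sig_empty)
  show "UNIV - A \<in> sig" if "A \<in> sig" for A using sig_Compl[OF that] by (simp add: Compl_eq_Diff_UNIV)
  show "(\<Union>n. A n) \<in> sig" if "range A \<subseteq> sig" for A :: "nat \<Rightarrow> _"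
  proof -
    have "- (\<Inter>n. - A n) \<in> sig" using that by (intro sig_Compl sig_Inter) auto
    then show ?thesis by simp
  qed
qed auto

text \<open>Closure under multiplication by \<open>u\<close> gives all polynomials in
  \<open>u\<close>; Weierstrass on \<open>{-1..1}\<close>, where \<open>u\<close> takes its values,
  gives bounded continuous functions of \<open>u\<close>; and the indicator is a pointwise limit of
  such functions.\<close>

lemma sig_less:
  assumes u: "\<And>F. F \<in> ann \<Longrightarrow> (\<lambda>x. F x * u x) \<in> ann" and [measurable]: "u \<in> borel_measurable borel"
    and u1: "\<And>x. \<bar>u x\<bar> \<le> 1"
  shows "{x. u x < c} \<in> sig"
proof -
  have poly: "(\<lambda>x. F x * q (u x)) \<in> ann" if "real_polynomial_function q" "F \<in> ann" for q :: "real \<Rightarrow> real" and F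
    using that
  proof (induction q arbitrary: F rule: real_polynomial_function.induct)
    case (linear f)
    interpret bounded_linear f by fact
    have "(\<lambda>x. F x * f (u x)) = (\<lambda>x. f 1 * (F x * u x))"
      using scaleR[of "u _" 1] by (simp add: fun_eq_iff mult_ac)
    then show ?case using ann_cmult[OF u[OF linear.prems], of "f 1"] by (simp only:)
  next
    case (const c)
    then show ?case using ann_cmult[of F c] by (simp add: mult.commute)
  next
    case (add f g)
    then show ?case by (simp add: distrib_left ann_add)
  next
    case (mult f g)
    then have "(\<lambda>x. (F x * f (u x)) * g (u x)) \<in> ann" by blast
    then show ?case by (simp add: mult.assoc)
  qed
  have cont: "(\<lambda>x. F x * h (u x)) \<in> ann"
    if h: "continuous_on UNIV h" and hb: "\<And>r. \<bar>h r\<bar> \<le> 1" and F: "F \<in> ann" for h :: "real \<Rightarrow> real" and F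
  proof -
    obtain C where C: "\<And>x. \<bar>F x\<bar> \<le> C" using F by (auto simp: ann_def)
    have C0: "0 \<le> C" using order_trans[OF abs_ge_zero C] by blast
    have "\<exists>q. real_polynomial_function q \<and> (\<forall>r\<in>{-1..1}. \<bar>h r - q r\<bar> < inverse (real (Suc n)))" for n
    proof -
      have "0 < inverse (real (Suc n))" by simp
      from Stone_Weierstrass_real_polynomial_function[OF compact_Icc continuous_on_subset[OF h subset_UNIV] this]
      obtain q where "real_polynomial_function q" "\<And>x. x \<in> {-1..1} \<Longrightarrow> \<bar>h x - q x\<bar> < inverse (real (Suc n))"
        by blast
      then show ?thesis by blast
    qed
    then obtain q where q: "\<And>n. real_polynomial_function (q n)"
      "\<And>n r. r \<in> {-1..1} \<Longrightarrow> \<bar>h r - q n r\<bar> < inverse (real (Suc n))" by metis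
    have ui: "u x \<in> {-1..1}" for x using u1[of x] by (auto simp: abs_le_iff)
    have [measurable]: "h \<in> borel_measurable borel" using h by (rule borel_measurable_continuous_onI)
    note [measurable] = ann_meas[OF F]
    show ?thesis
    proof (rule ann_limit[where F = "\<lambda>n x. F x * q n (u x)" and B = "C * 2" and C = "C * 1"])
      show "(\<lambda>x. F x * q n (u x)) \<in> ann" for n by (rule poly[OF q(1) F])
      have "\<bar>q n (u x)\<bar> \<le> 2" for n x
      proof -
        have "inverse (real (Suc n)) \<le> 1" by (simp add: inverse_le_1_iff)
        then show ?thesis using q(2)[OF ui[of x], of n] hb[of "u x"] by linarith
      qed
      then show "\<bar>F x * q n (u x)\<bar> \<le> C * 2" for n x
        unfolding abs_mult by (intro mult_mono C C0) auto
      show "\<bar>F x * h (u x)\<bar> \<le> C * 1" for x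
        unfolding abs_mult by (intro mult_mono C C0 hb) auto
      have "(\<lambda>n. q n (u x) - h (u x)) \<longlonglongrightarrow> 0" for x
      proof (rule Lim_null_comparison[OF always_eventually LIMSEQ_inverse_real_of_nat], rule allI)
        show "norm (q n (u x) - h (u x)) \<le> inverse (real (Suc n))" for n
          using q(2)[OF ui[of x], of n] by (simp add: abs_minus_commute)
      qed
      then show "(\<lambda>n. F x * q n (u x)) \<longlonglongrightarrow> F x * h (u x)" for x
        by (rule tendsto_mult[OF tendsto_const LIM_zero_cancel])
    qed measurable
  qed
  have [measurable]: "{x. u x < c} \<in> sets borel"
    using measurable_sets[OF assms(2), of "{..<c}"] by (simp add: vimage_def)
  have "(\<lambda>x. F x * indicator {x. u x < c} x) \<in> ann" if F: "F \<in> ann" for F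
  proof -
    obtain C where C: "\<And>x. \<bar>F x\<bar> \<le> C" using F by (auto simp: ann_def)
    have C0: "0 \<le> C" using order_trans[OF abs_ge_zero C] by blast
    note [measurable] = ann_meas[OF F]
    \<comment> \<open>Continuous ramps that vanish for \<open>r \<ge> c\<close> and reach 1 as soon
      as \<open>c - r \<ge> 1 / n\<close>; they increase to the indicator of the open
      half-line.\<close>
    let ?h = "\<lambda>n r. max 0 (min 1 (real n * (c - r)))"
    have h_lim: "(\<lambda>n. ?h n r) \<longlonglongrightarrow> indicator {r. r < c} r" for r
    proof (cases "r < c")
      case True
      obtain N :: nat where N: "1 / (c - r) \<le> real N" using real_arch_simple by blast
      have "\<forall>\<^sub>F n in sequentially. ?h n r = indicator {r. r < c} r"
        using eventually_ge_at_top[of N]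
      proof eventually_elim
        fix n assume "N \<le> n"
        then have "1 / (c - r) \<le> real n" using N by linarith
        then have "1 \<le> real n * (c - r)" using True by (simp add: field_simps)
        then show "?h n r = indicator {r. r < c} r" using True by simp
      qed
      then show ?thesis by (rule tendsto_eventually)
    next
      case False
      then have "real n * (c - r) \<le> 0" for n by (simp add: mult_nonneg_nonpos)
      then have "?h n r = 0" for n by (intro max_absorb1 min.coboundedI2)
      then show ?thesis using False by simp
    qed
    have le: "\<bar>F x * r\<bar> \<le> C" if "\<bar>r\<bar> \<le> 1" for x r
      using mult_mono[OF C that C0 abs_ge_zero, of x] by (simp add: abs_mult)
    show ?thesis
    proof (rule ann_limit)
      show "(\<lambda>x. F x * ?h n (u x)) \<in> ann" for n
      proof (rule cont[where h = "?h n", OF _ _ F])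
        show "continuous_on UNIV (?h n)" by (intro continuous_intros)
        show "\<bar>?h n r\<bar> \<le> 1" for r by simp
      qed
      show "\<bar>F x * ?h n (u x)\<bar> \<le> C" for n x by (rule le) simp
      show "\<bar>F x * indicator {x. u x < c} x\<bar> \<le> C" for x by (rule le) (simp add: indicator_def)
      have "indicator {r. r < c} (u x) = (indicator {x. u x < c} x :: real)" for x by (simp add: indicator_def)
      then show "(\<lambda>n. F x * ?h n (u x)) \<longlonglongrightarrow> F x * indicator {x. u x < c} x" for x
        using tendsto_mult[OF tendsto_const h_lim[of "u x"], of "F x"] by simp
      show "(\<lambda>x. F x * indicator {x. u x < c} x) \<in> borel_measurable borel" by measurable
    qed
  qed
  then show ?thesis by (simp add: sig_def)
qed

text \<open>On the box the angle \<open>\<theta>\<close> runs through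
  \<open>[-\<pi>, \<pi>)\<close>, so that \<open>c \<le> \<theta>\<close> can be decided from the
  signs of sine and the size of cosine, cosine being monotone on each half of the range.
  \<open>sig_cong\<close> discards everything outside the box.\<close>

lemma sig_halfspace: "{x. a \<le> x $ j} \<in> sig"
proof -
  define \<theta> where "\<theta> x = 2 * pi * x $ j / L" for x :: "real^'d"
  define c where "c = 2 * pi * a / L"
  have [measurable]: "(\<lambda>x :: real^'d. cos (\<theta> x)) \<in> borel_measurable borel"
    "(\<lambda>x :: real^'d. sin (\<theta> x)) \<in> borel_measurable borel"
    unfolding \<theta>_def by (intro borel_measurable_continuous_onI continuous_intros; use L in simp)+
  have meas: "{x :: real^'d. a \<le> x $ j} \<in> sets borel"
    by (intro borel_closed closed_Collect_le continuous_intros)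
  have cos_less: "{x. cos (\<theta> x) < r} \<in> sig" and sin_less: "{x. sin (\<theta> x) < r} \<in> sig"
    and neg_cos_less: "{x. - cos (\<theta> x) < r} \<in> sig" and neg_sin_less: "{x. - sin (\<theta> x) < r} \<in> sig" for r
    using ann_trig[of _ j] ann_cmult[of _ "-1"] by (auto intro!: sig_less simp: \<theta>_def[symmetric])
  have UNIV: "UNIV \<in> sig" using sig_Compl[OF sig_empty] by simp
  have iff: "a \<le> x $ j \<longleftrightarrow> c \<le> \<theta> x" for x :: "real^'d"
    using L by (simp add: c_def \<theta>_def divide_simps)
  have range: "- pi \<le> \<theta> x" "\<theta> x < pi" if "x \<in> box_L L" for x
  proof -
    have "- (L / 2) \<le> x $ j" "x $ j < L / 2" using that by (auto simp: box_L_def)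
    then have "2 * pi * - (L / 2) \<le> 2 * pi * x $ j" "2 * pi * x $ j < 2 * pi * (L / 2)"
      by (intro mult_left_mono mult_strict_left_mono; simp)+
    then show "- pi \<le> \<theta> x" "\<theta> x < pi" using L by (auto simp: \<theta>_def field_simps)
  qed
  consider "c \<le> - pi" | "- pi < c" "c \<le> 0" | "0 < c" "c < pi" | "pi \<le> c" by linarith
  then show ?thesis
  proof cases
    case 1
    then show ?thesis by (intro sig_cong[OF UNIV meas]) (use range iff in \<open>force\<close>)
  next
    case 4
    then show ?thesis by (intro sig_cong[OF sig_empty meas]) (use range iff in \<open>force\<close>)
  next
    case 3
    have eq: "c \<le> \<theta> x \<longleftrightarrow> - sin (\<theta> x) < 0 \<and> \<not> - cos (\<theta> x) < - cos c" if x: "x \<in> box_L L" for x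
    proof (cases "0 < \<theta> x")
      case True
      then have "0 < sin (\<theta> x)" using range[OF x] by (simp add: sin_gt_zero)
      moreover have "cos (\<theta> x) \<le> cos c \<longleftrightarrow> c \<le> \<theta> x" using 3 True range[OF x] by (intro cos_mono_le_eq) auto
      ultimately show ?thesis by auto
    next
      case False
      then have "sin (\<theta> x) \<le> 0" using range[OF x] sin_ge_zero[of "- \<theta> x"] by simp
      then show ?thesis using False 3 by auto
    qed
    have "{x. - sin (\<theta> x) < 0} \<inter> - {x. - cos (\<theta> x) < - cos c} \<in> sig"
      by (intro sig_Int sig_Compl neg_cos_less neg_sin_less)
    then show ?thesis by (rule sig_cong[OF _ meas]) (use eq iff in auto)
  next
    case 2
    \<comment> \<open>For \<open>c \<le> 0\<close> the complement consists of the negative angles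
      below \<open>c\<close>. The endpoint \<open>- pi\<close> belongs to the box but has sine 0, so
      the sign of the sine misses it; the condition \<open>- cos (\<theta> x) < 1\<close> removes
      this point.\<close>
    have eq: "c \<le> \<theta> x \<longleftrightarrow> \<not> (sin (\<theta> x) < 0 \<and> cos (\<theta> x) < cos c) \<and> - cos (\<theta> x) < 1" if x: "x \<in> box_L L" for x
    proof (cases "\<theta> x < 0 \<and> \<theta> x \<noteq> - pi")
      case True
      then have "0 < sin (- \<theta> x)" using range[OF x] by (intro sin_gt_zero) auto
      moreover have "cos (- \<theta> x) < cos (- c) \<longleftrightarrow> - c < - \<theta> x" using 2 True range[OF x] by (intro cos_mono_less_eq) auto
      moreover have "cos pi < cos (- \<theta> x)" using True range[OF x] by (subst cos_mono_less_eq) auto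
      ultimately show ?thesis by auto
    next
      case False
      show ?thesis
      proof (cases "\<theta> x = - pi")
        case True then show ?thesis using 2 by simp
      next
        case False
        then have t: "0 \<le> \<theta> x" "\<theta> x < pi" using \<open>\<not> (\<theta> x < 0 \<and> \<theta> x \<noteq> - pi)\<close> range[OF x] by auto
        then have "0 \<le> sin (\<theta> x)" by (intro sin_ge_zero) auto
        moreover have "cos pi < cos (\<theta> x)" using t by (subst cos_mono_less_eq) auto
        ultimately show ?thesis using t 2 by auto
      qed
    qed
    have "- ({x. sin (\<theta> x) < 0} \<inter> {x. cos (\<theta> x) < cos c}) \<inter> {x. - cos (\<theta> x) < 1} \<in> sig"
      by (intro sig_Int sig_Compl cos_less sin_less neg_cos_less)
    then show ?thesis by (rule sig_cong[OF _ meas]) (use eq iff in auto)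
  qed
qed

text \<open>Half-spaces generate the Borel sets, so every Borel indicator multiplies the constant 1
  into \<open>ann\<close>. At \<open>p = 0\<close> this says that \<open>g\<close> integrates to
  zero over every Borel set.\<close>

lemma AE_zero: "AE x in lborel. g x = 0"
proof -
  interpret S: sigma_algebra UNIV sig by (rule sig_sigma_algebra)
  have "sets (borel :: (real^'d) measure) = sigma_sets UNIV ((\<lambda>(a, i). {x. a \<le> x \<bullet> i}) ` (UNIV \<times> Basis))"
    by (subst borel_eq_halfspace_ge) (simp add: sets_measure_of)
  also have "\<dots> \<subseteq> sig"
    by (rule S.sigma_sets_subset) (auto simp: Basis_vec_def inner_axis sig_halfspace)
  finally have "A \<in> sig" if "A \<in> sets borel" for A using that by blast
  then have "indicator A \<in> ann" if "A \<in> sets borel" for A :: "(real^'d) set"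
    using ann_one that by (fastforce simp: sig_def)
  then have "(LINT x|lborel. indicator A x * (wave 0 x * g x)) = 0" if "A \<in> sets borel" for A :: "(real^'d) set"
    using that dual_lattice_0 by (fastforce simp: ann_def of_real_indicator)
  then show ?thesis
    by (intro sigma_finite_measure.density_zero[OF sigma_finite_lborel g]) (simp add: set_lebesgue_integral_def scaleR_conv_of_real of_real_indicator)
qed

end

section \<open>The Hamiltonian on the box\<close>

lemma bdd_meas_indicator: "A \<in> sets borel \<Longrightarrow> bdd_meas (indicator A)"
  by (auto simp: bdd_meas_def indicator_def intro!: exI[of _ 1])

lemma bdd_meas_mult:
  assumes "bdd_meas m" "bdd_meas n"
  shows "bdd_meas (\<lambda>x. m x * n x)"
proof -
  obtain B C where "\<And>x. cmod (m x) \<le> B" "\<And>x. cmod (n x) \<le> C" using assms by (auto simp: bdd_meas_def)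
  then have "cmod (m x * n x) \<le> B * C" for x
    unfolding norm_mult by (meson mult_mono norm_ge_zero order_trans)
  then show ?thesis using assms by (auto simp: bdd_meas_def)
qed

lemma bdd_meas_add:
  assumes "bdd_meas m" "bdd_meas n"
  shows "bdd_meas (\<lambda>x. m x + n x)"
proof -
  obtain B C where "\<And>x. cmod (m x) \<le> B" "\<And>x. cmod (n x) \<le> C" using assms by (auto simp: bdd_meas_def)
  then have "cmod (m x + n x) \<le> B + C" for x
    by (meson add_mono norm_triangle_ineq order_trans)
  then show ?thesis using assms by (auto simp: bdd_meas_def)
qed

lemma bdd_meas_const: "bdd_meas (\<lambda>x. c)"
  by (auto simp: bdd_meas_def)

lemma bdd_meas_cnj: "bdd_meas m \<Longrightarrow> bdd_meas (\<lambda>x. cnj (m x))"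
  by (auto simp: bdd_meas_def)

lemma mult_L2_mult_L2: "bdd_meas m \<Longrightarrow> bdd_meas n \<Longrightarrow> mult_L2 m (mult_L2 n f) = mult_L2 (\<lambda>x. m x * n x) f"
  by (cases f rule: abs_L2_cases) (simp add: mult_abs_L2 l2_fun_bdd_meas bdd_meas_mult mult.assoc)

lemma mult_L2_commute: "bdd_meas m \<Longrightarrow> bdd_meas n \<Longrightarrow> mult_L2 m (mult_L2 n f) = mult_L2 n (mult_L2 m f)"
  by (simp add: mult_L2_mult_L2 mult.commute)

lemma mult_L2_plus_fun: "bdd_meas m \<Longrightarrow> bdd_meas n \<Longrightarrow> mult_L2 (\<lambda>x. m x + n x) f = mult_L2 m f + mult_L2 n f"
  by (cases f rule: abs_L2_cases) (simp add: mult_abs_L2 l2_fun_bdd_meas bdd_meas_add abs_L2_add distrib_right)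

lemma mult_L2_const: "mult_L2 (\<lambda>x. c) f = c *\<^sub>C f"
  by (cases f rule: abs_L2_cases) (simp add: mult_abs_L2 bdd_meas_const abs_L2_scaleC)

lemma mult_L2_minus: "bdd_meas m \<Longrightarrow> mult_L2 m (- f) = - mult_L2 m f"
  using mult_L2_scaleC[of m "-1" f] by (simp add: scaleC_minus_one)

lemma mult_L2_diff: "bdd_meas m \<Longrightarrow> mult_L2 m (f - g) = mult_L2 m f - mult_L2 m g"
  using mult_L2_add[of m f "- g"] by (simp add: mult_L2_minus)

lemma bounded_linear_mult_L2:
  assumes "bdd_meas m" shows "bounded_linear (mult_L2 m)"
proof -
  obtain B where "\<And>x. cmod (m x) \<le> B" using assms by (auto simp: bdd_meas_def)
  then have "norm (mult_L2 m f) \<le> norm f * B" for f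
    using norm_mult_L2_le[OF assms, of B f] by (simp add: mult.commute)
  then show ?thesis
    by (intro bounded_linear_intro[of _ B]) (auto simp: mult_L2_add assms mult_L2_scaleC scaleC_of_real[symmetric])
qed

lemma cinner_mult_L2:
  assumes "bdd_meas m"
  shows "cinner x (mult_L2 m y) = cinner (mult_L2 (\<lambda>t. cnj (m t)) x) y"
  by (cases x rule: abs_L2_cases; cases y rule: abs_L2_cases)
     (simp add: mult_abs_L2 assms bdd_meas_cnj cinner_abs_L2 l2_fun_bdd_meas, simp add: mult_ac)

text \<open>Functions on the box appear as functions on the whole space that vanish outside it. All
  periods thus share one Hilbert space, and vectors belonging to different boxes can be subtracted
  from one another.\<close>

definition H_box :: "real \<Rightarrow> (real^'d) L2 set" where
  "H_box L = {f. mult_L2 (indicator (box_L L)) f = f}"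

definition E_box :: "real \<Rightarrow> real^'d \<Rightarrow> (real^'d) L2" where
  "E_box L p = abs_L2 (\<lambda>x. indicator (box_L L) x * (complex_of_real (1 / sqrt (vol L TYPE('d))) * wave p x))"

definition res :: "real \<Rightarrow> (real^'d \<Rightarrow> complex) \<Rightarrow> (real^'d) L2" where
  "res L f = abs_L2 (\<lambda>x. indicator (box_L L) x * f x)"

definition T_box :: "real \<Rightarrow> ((real^'d) L2 \<times> (real^'d) L2) set" where
  "T_box L = {(u, g). u \<in> H_box L \<and> g \<in> H_box L \<and>
     (\<forall>p\<in>dual_lattice L. cinner (E_box L p) g = of_real ((2 * pi * norm p)\<^sup>2) * cinner (E_box L p) u)}"

lemma bdd_meas_box [simp]: "bdd_meas (indicator (box_L L))"
  by (rule bdd_meas_indicator) measurable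

lemma L2_on_l2_fun:
  assumes "L2_on L f" shows "l2_fun (\<lambda>x. indicator (box_L L) x * f x)"
proof -
  have [measurable]: "f \<in> borel_measurable borel" using assms by (simp add: L2_on_def)
  have "(cmod (indicator (box_L L) x * f x))\<^sup>2 = indicator (box_L L) x *\<^sub>R (cmod (f x))\<^sup>2" for x
    by (simp add: indicator_def)
  then show ?thesis
    using assms by (simp add: l2_fun_def L2_on_def set_integrable_def)
qed

lemma l2_fun_L2_on:
  assumes "l2_fun f" shows "L2_on L f"
  unfolding L2_on_def set_integrable_def
proof
  show "f \<in> borel_measurable lborel" using assms by (rule l2_fun_meas)
  show "integrable lborel (\<lambda>x. indicat_real (box_L L) x *\<^sub>R (cmod (f x))\<^sup>2)"
    by (rule integrable_mult_indicator[OF _ l2_fun_int[OF assms]]) simp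
qed

lemma mult_box_res: "L2_on L f \<Longrightarrow> mult_L2 (indicator (box_L L)) (res L f) = res L f"
  unfolding res_def mult_abs_L2[OF bdd_meas_box L2_on_l2_fun] mult.assoc[symmetric] indicator_inter_arith[symmetric] by simp

lemma res_H: "L2_on L f \<Longrightarrow> res L f \<in> H_box L"
  by (simp add: H_box_def mult_box_res)

lemma res_l2_fun: "l2_fun f \<Longrightarrow> res L f = mult_L2 (indicator (box_L L)) (abs_L2 f)"
  by (simp add: res_def mult_abs_L2)

lemma res_rep: "U \<in> H_box L \<Longrightarrow> res L (rep_L2 U) = U"
  by (simp add: res_l2_fun H_box_def)

lemma cinner_H_res:
  assumes "L2_on L f" "L2_on L g"
  shows "cinner (res L f) (res L g) = inner_L L f g"
  unfolding res_def inner_L_def set_lebesgue_integral_def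
  unfolding cinner_abs_L2[OF L2_on_l2_fun[OF assms(1)] L2_on_l2_fun[OF assms(2)]]
  by (intro Bochner_Integration.integral_cong refl) (simp add: indicator_def)

lemma L2_on_wave: "L2_on L (\<lambda>x. c * wave p x)"
proof -
  have "integrable lborel (\<lambda>x. indicator (box_L L) x *\<^sub>R (cmod c)\<^sup>2)"
    using emeasure_box_L by (intro integrable_scaleR_left integrable_real_indicator) auto
  then have "set_integrable lborel (box_L L) (\<lambda>x. (cmod (c * wave p x))\<^sup>2)"
    unfolding set_integrable_def norm_mult cmod_wave by simp
  moreover have "(\<lambda>x. c * wave p x) \<in> borel_measurable borel" by measurable
  ultimately show ?thesis by (simp add: L2_on_def)
qed

lemma E_box_res: "E_box L p = res L (\<lambda>x. complex_of_real (1 / sqrt (vol L TYPE('d))) * wave (p :: real^'d) x)"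
  by (simp add: E_box_def res_def)

lemma cinner_E_res:
  assumes "L2_on L f"
  shows "cinner (E_box L p) (res L f) = complex_of_real (1 / sqrt (vol L TYPE('d))) * fourier_coeff L f (p :: real^'d)"
proof -
  have e: "exp (- 2 * pi * \<i> * complex_of_real (p \<bullet> x)) = wave (- p) x" for x
    by (simp add: wave_def cis_conv_exp mult_ac)
  show ?thesis
    unfolding E_box_res cinner_H_res[OF L2_on_wave assms] inner_L_def fourier_coeff_def set_lebesgue_integral_def e
    by (simp add: wave_cnj mult_ac flip: integral_mult_right_zero)
qed

text \<open>Orthogonality is \<open>wave_integral_zero\<close> for the frequency
  \<open>q - p\<close>. Totality is \<open>vanishing_coeffs.AE_zero\<close> for a representative;
  the conjugation in the inner product replaces \<open>p\<close> by \<open>- p\<close>, under which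
  the lattice is symmetric.\<close>

lemma onb_box:
  assumes L: "0 < L"
  shows "onb (E_box L) (dual_lattice L :: (real^'d) set) (H_box L)"
proof
  let ?c = "complex_of_real (1 / sqrt (vol L TYPE('d)))"
  have cc: "?c * ?c * of_real (vol L TYPE('d)) = 1"
    using vol_pos[OF L, where 'd = 'd] by (simp add: of_real_mult[symmetric] del: of_real_mult)
  show "cinner (E_box L p) (E_box L q) = (if p = q then 1 else 0)" if "p \<in> dual_lattice L" "q \<in> dual_lattice L" for p q :: "real^'d"
  proof -
    have "cinner (E_box L p) (E_box L q) = (LINT x|lborel. (?c * ?c) * (indicator (box_L L) x * wave (q - p) x))"
      unfolding E_box_res cinner_H_res[OF L2_on_wave L2_on_wave] inner_L_def set_lebesgue_integral_def
      using wave_mult[of "- p" _ q]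
      by (intro Bochner_Integration.integral_cong refl) (simp add: wave_cnj indicator_def mult_ac)
    also have "\<dots> = ?c * ?c * (LINT x|lborel. (indicator (box_L L) x * wave (q - p) x))"
      by (rule integral_mult_right_zero)
    also have "(LINT x|lborel. (indicator (box_L L) x * wave (q - p) x)) = (if p = q then of_real (vol L TYPE('d)) else 0)"
    proof (cases "p = q")
      case True
      have "(LINT x|lborel. complex_of_real (indicator (box_L L :: (real^'d) set) x)) = of_real (vol L TYPE('d))"
        unfolding integral_complex_of_real vol_def by simp
      then show ?thesis using True by (simp add: of_real_indicator)
    next
      case False
      then show ?thesis using wave_integral_zero[of "q - p" L] that L by (auto simp: dual_lattice_diff)
    qed
    finally show ?thesis using cc by (simp add: mult_ac)
  qed
  show "closed (H_box L :: (real^'d) L2 set)"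
    unfolding H_box_def
    by (intro closed_Collect_eq linear_continuous_on[OF bounded_linear_mult_L2] continuous_on_id) simp
  show "0 \<in> (H_box L :: (real^'d) L2 set)"
    using mult_L2_scaleC[of "indicator (box_L L)" 0 0] by (simp add: H_box_def)
  show "x + y \<in> H_box L" if "x \<in> H_box L" "y \<in> H_box L" for x y :: "(real^'d) L2"
    using that by (simp add: H_box_def mult_L2_add)
  show "c *\<^sub>C x \<in> H_box L" if "x \<in> H_box L" for x :: "(real^'d) L2" and c
    using that by (simp add: H_box_def mult_L2_scaleC)
  show "E_box L p \<in> H_box L" for p :: "real^'d"
    unfolding E_box_res by (rule res_H[OF L2_on_wave])
  show "x = 0" if x: "x \<in> H_box L" and z: "\<And>p. p \<in> dual_lattice L \<Longrightarrow> cinner (E_box L p) x = 0" for x :: "(real^'d) L2"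
  proof -
    let ?f = "rep_L2 x"
    have on: "L2_on L ?f" by (rule l2_fun_L2_on) simp
    let ?g = "\<lambda>t. indicator (box_L L) t * ?f t"
    have l2: "l2_fun ?g" by (rule L2_on_l2_fun[OF on])
    interpret vanishing_coeffs L ?g
    proof
      have "l2_fun (\<lambda>t :: real^'d. indicator (box_L L) t * (1 * wave 0 t))"
        by (rule L2_on_l2_fun[OF L2_on_wave])
      from l2_fun_prod_integrable[OF this l2] show "integrable lborel ?g"
        by (rule Bochner_Integration.integrable_cong[THEN iffD1, OF refl, rotated]) (auto simp: indicator_def)
      show "(LINT t|lborel. wave p t * ?g t) = 0" if "p \<in> dual_lattice L" for p
      proof -
        have "cinner (E_box L (- p)) x = ?c * fourier_coeff L ?f (- p)"
          using cinner_E_res[OF on, of "- p"] by (simp add: res_rep x)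
        then have "fourier_coeff L ?f (- p) = 0"
          using z[OF dual_lattice_minus[OF that]] vol_pos[OF L, where 'd = 'd] by simp
        moreover have "exp (- 2 * pi * \<i> * complex_of_real (- p \<bullet> t)) = wave p t" for t
          by (simp add: wave_def cis_conv_exp mult_ac)
        ultimately show ?thesis
          by (simp only: fourier_coeff_def set_lebesgue_integral_def)
             (simp add: scaleR_conv_of_real of_real_indicator mult_ac)
      qed
    qed (use L in auto)
    have "AE t in lborel. ?g t = 0" by (rule AE_zero)
    then have "abs_L2 ?g = abs_L2 (\<lambda>t. 0)" using l2 by (subst abs_L2_eq_iff) auto
    moreover have "x = abs_L2 ?g" using res_rep[OF x] by (simp add: res_def)
    ultimately show ?thesis by (simp add: zero_L2.abs_eq)
  qed
qed

lemma T_box_selfadjoint: "0 < L \<Longrightarrow> selfadjoint_relation (T_box L :: ((real^'d) L2 \<times> _) set) (H_box L)"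
  unfolding T_box_def by (rule onb.multiplier_selfadjoint[OF onb_box])

text \<open>The representative of \<open>x\<close> modulo the period lattice that lies in the box;
  adding \<open>1 / 2\<close> before taking the floor matches the half-open box centred at 0. Since
  \<open>laplace_L\<close> asks for functions periodic at every point, composition with
  \<open>wrap\<close> turns a vector of \<open>H_box\<close> into an admissible function.\<close>

definition wrap :: "real \<Rightarrow> real^'d \<Rightarrow> real^'d" where
  "wrap L x = (\<chi> i. x $ i - L * of_int \<lfloor>x $ i / L + 1 / 2\<rfloor>)"

lemma wrap_box: "0 < L \<Longrightarrow> x \<in> box_L L \<Longrightarrow> wrap L x = x"
proof -
  assume L: "0 < L" and x: "x \<in> box_L L"
  have "\<lfloor>x $ i / L + 1 / 2\<rfloor> = 0" for i
  proof -
    have "- L / 2 \<le> x $ i \<and> x $ i < L / 2" using x by (simp add: box_L_def)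
    then show ?thesis using L by (intro floor_unique) (auto simp: field_simps)
  qed
  then show ?thesis by (simp add: wrap_def vec_eq_iff)
qed

lemma periodic_wrap: "0 < L \<Longrightarrow> periodic_L L (\<lambda>x :: real^'d. f (wrap L x))"
  unfolding periodic_L_def
proof (intro allI)
  fix x :: "real^'d" and j assume L: "0 < L"
  have "(r + L) / L + 1 / 2 = (r / L + 1 / 2) + of_int 1" for r using L by (simp add: field_simps)
  then have "\<lfloor>(r + L) / L + 1 / 2\<rfloor> = \<lfloor>r / L + 1 / 2\<rfloor> + 1" for r by (simp only: floor_add_int)
  then have "wrap L (x + L *\<^sub>R axis j 1) = wrap L x"
    by (simp add: wrap_def vec_eq_iff axis_def distrib_left)
  then show "f (wrap L (x + L *\<^sub>R axis j 1)) = f (wrap L x)" by simp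
qed

lemma wrap_meas [measurable]: "wrap L \<in> borel_measurable (borel :: (real^'d) measure)"
proof (subst borel_measurable_euclidean_space, rule ballI)
  fix b :: "real^'d" assume "b \<in> Basis"
  then obtain i where b: "b = axis i 1" by (auto simp: Basis_vec_def)
  have [measurable]: "(\<lambda>x :: real^'d. x $ i) \<in> borel_measurable borel"
    by (intro borel_measurable_continuous_onI continuous_intros)
  show "(\<lambda>x. wrap L x \<bullet> b) \<in> borel_measurable borel"
    unfolding b by (simp add: wrap_def inner_axis)
qed

lemma L2_on_wrap:
  assumes L: "0 < L" and f: "l2_fun f"
  shows "L2_on L (\<lambda>x. f (wrap L x))" "res L (\<lambda>x. f (wrap L x)) = res L f"
proof -
  have [measurable]: "f \<in> borel_measurable borel" using l2_fun_meas[OF f] by simp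
  have "(\<lambda>x. indicat_real (box_L L) x *\<^sub>R (cmod (f (wrap L x)))\<^sup>2) = (\<lambda>x. indicat_real (box_L L) x *\<^sub>R (cmod (f x))\<^sup>2)"
  proof
    fix x show "indicat_real (box_L L) x *\<^sub>R (cmod (f (wrap L x)))\<^sup>2 = indicat_real (box_L L) x *\<^sub>R (cmod (f x))\<^sup>2"
      by (cases "x \<in> box_L L") (simp_all add: wrap_box L)
  qed
  then show "L2_on L (\<lambda>x. f (wrap L x))"
    using l2_fun_L2_on[OF f, of L] by (simp add: L2_on_def set_integrable_def)
  have "(\<lambda>x. indicator (box_L L) x * f (wrap L x)) = (\<lambda>x. indicator (box_L L) x * f x)"
  proof
    fix x show "indicator (box_L L) x * f (wrap L x) = indicator (box_L L) x * f x"
      by (cases "x \<in> box_L L") (simp_all add: wrap_box L)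
  qed
  then show "res L (\<lambda>x. f (wrap L x)) = res L f" by (simp add: res_def)
qed

lemma laplace_res:
  assumes "laplace_L L u g" shows "(res L u, res L g) \<in> T_box L"
  using assms by (auto simp: laplace_L_def T_box_def res_H cinner_E_res)

text \<open>Converse of \<open>laplace_res\<close>: representatives composed with
  \<open>wrap\<close> are periodic, restrict to the given vectors and keep their Fourier
  coefficients.\<close>

lemma T_box_laplace:
  assumes L: "0 < L" and T: "(U, G) \<in> (T_box L :: ((real^'d) L2 \<times> _) set)"
  obtains u g where "laplace_L L u g" "res L u = U" "res L g = G"
proof
  let ?u = "\<lambda>x. rep_L2 U (wrap L x)" and ?g = "\<lambda>x. rep_L2 G (wrap L x)"
  have on: "L2_on L ?u" "L2_on L ?g" by (auto intro!: L2_on_wrap L)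
  have UG: "U \<in> H_box L" "G \<in> H_box L" using T by (auto simp: T_box_def)
  show r: "res L ?u = U" "res L ?g = G" using UG by (simp_all add: L2_on_wrap L res_rep)
  have v: "complex_of_real (1 / sqrt (vol L TYPE('d))) \<noteq> 0"
    using vol_pos[OF L, where 'd = 'd] by simp
  have "fourier_coeff L ?g p = complex_of_real ((2 * pi * norm p)\<^sup>2) * fourier_coeff L ?u p" if "p \<in> dual_lattice L" for p
  proof -
    have "cinner (E_box L p) (res L ?g) = complex_of_real ((2 * pi * norm p)\<^sup>2) * cinner (E_box L p) (res L ?u)"
      unfolding r using T that by (simp add: T_box_def)
    then show ?thesis
      unfolding cinner_E_res[OF on(1)] cinner_E_res[OF on(2)] using v by simp
  qed
  then show "laplace_L L ?u ?g"
    using on by (simp add: laplace_L_def periodic_wrap L)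
qed

section \<open>The Hamiltonian with a bounded potential and its resolvent form\<close>

definition pot :: "real \<Rightarrow> (real^'d \<Rightarrow> real) \<Rightarrow> real^'d \<Rightarrow> complex" where
  "pot L V x = complex_of_real (indicator (box_L L) x * V x)"

definition A_box :: "real \<Rightarrow> (real^'d \<Rightarrow> real) \<Rightarrow> ((real^'d) L2 \<times> (real^'d) L2) set" where
  "A_box L V = {(u, g + mult_L2 (pot L V) u) |u g. (u, g) \<in> T_box L}"

locale box_potential =
  fixes L :: real and V :: "real^'d \<Rightarrow> real" and M :: real
  assumes L: "0 < L" and V_meas: "V \<in> borel_measurable lborel"
    and V_le: "\<And>x. x \<in> box_L L \<Longrightarrow> \<bar>V x\<bar> \<le> M"
begin

lemma M_nonneg: "0 \<le> M"
proof -
  have "0 \<in> box_L L" using L by (simp add: box_L_def)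
  from V_le[OF this] show ?thesis by simp
qed

lemma pot_le: "cmod (pot L V x) \<le> M"
  using V_le[of x] M_nonneg by (auto simp: pot_def indicator_def norm_mult)

lemma pot_bdd_meas [simp]: "bdd_meas (pot L V)"
proof -
  have [measurable]: "V \<in> borel_measurable borel" using V_meas by simp
  have "pot L V \<in> borel_measurable lborel" unfolding pot_def[abs_def] by measurable
  then show ?thesis using pot_le by (auto simp: bdd_meas_def)
qed

sublocale selfadjoint_relation "A_box L V" "H_box L"
  unfolding A_box_def
proof (rule selfadjoint_relation.bounded_perturbation[OF T_box_selfadjoint[OF L]])
  fix x :: "(real^'d) L2"
  show "mult_L2 (pot L V) x \<in> H_box L" if "x \<in> H_box L"
    using that mult_L2_commute[of "indicator (box_L L)" "pot L V" x] by (simp add: H_box_def)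
  show "Im (cinner x (mult_L2 (pot L V) x)) = 0"
  proof -
    have "(\<lambda>t. cnj (pot L V t)) = pot L V" by (simp add: pot_def fun_eq_iff)
    then have "cinner x (mult_L2 (pot L V) x) = cnj (cinner x (mult_L2 (pot L V) x))"
      using cinner_mult_L2[OF pot_bdd_meas, of x x] cinner_commute[of "mult_L2 (pot L V) x" x] by simp
    then show ?thesis by (metis Im_complex_of_real Reals_cnj_iff of_real_Re)
  qed
  show "norm (mult_L2 (pot L V) x) \<le> M * norm x"
    by (rule norm_mult_L2_le) (simp_all add: pot_le)
qed (simp_all add: mult_L2_add mult_L2_scaleC)

lemma resolvent_equation_iff:
  assumes "L2_on L u" "L2_on L g" "l2_fun phi"
  shows "res L g + mult_L2 (pot L V) (res L u) - z *\<^sub>C res L u = res L phi \<longleftrightarrow>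
     (AE x in lborel. x \<in> box_L L \<longrightarrow> g x + complex_of_real (V x) * u x - z * u x = phi x)"
proof -
  let ?i = "\<lambda>f x. indicator (box_L L) x * f x"
  note l2 = L2_on_l2_fun[OF assms(1)] L2_on_l2_fun[OF assms(2)] L2_on_l2_fun[OF l2_fun_L2_on[OF assms(3)]]
  have lhs: "res L g + mult_L2 (pot L V) (res L u) - z *\<^sub>C res L u =
      abs_L2 (\<lambda>x. ?i g x + pot L V x * ?i u x - z * ?i u x)"
    unfolding res_def
    by (simp add: l2 mult_abs_L2 abs_L2_add abs_L2_scaleC abs_L2_diff l2_fun_add l2_fun_cmult l2_fun_bdd_meas)
  have "?i g x + pot L V x * ?i u x - z * ?i u x = ?i phi x \<longleftrightarrow>
      (x \<in> box_L L \<longrightarrow> g x + complex_of_real (V x) * u x - z * u x = phi x)" for x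
    by (cases "x \<in> box_L L") (simp_all add: pot_def)
  moreover have "abs_L2 (\<lambda>x. ?i g x + pot L V x * ?i u x - z * ?i u x) = res L phi \<longleftrightarrow>
      (AE x in lborel. ?i g x + pot L V x * ?i u x - z * ?i u x = ?i phi x)"
    unfolding res_def
    by (rule abs_L2_eq_iff) (simp_all add: l2 l2_fun_diff l2_fun_add l2_fun_cmult l2_fun_bdd_meas)
  ultimately show ?thesis unfolding lhs by simp
qed

text \<open>Resolves the definite description: \<open>T_box_laplace\<close> turns the abstract
  solution into a periodic function, and \<open>R_eq\<close> forces every solution in the sense of
  \<open>resolvent_sol\<close> to have the same restriction to the box.\<close>

lemma resolvent_form_eq:
  assumes z: "Im z \<noteq> 0" and phi: "l2_fun phi"
  shows "resolvent_form L V z phi = cinner (res L phi) (R z (res L phi))"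
  unfolding resolvent_form_def
proof (rule the_equality)
  have on: "L2_on L phi" by (rule l2_fun_L2_on[OF phi])
  have "(R z (res L phi), res L phi + z *\<^sub>C R z (res L phi)) \<in> A_box L V"
    by (rule R_A[OF z res_H[OF on]])
  then obtain G where T: "(R z (res L phi), G) \<in> T_box L"
    and G: "res L phi + z *\<^sub>C R z (res L phi) = G + mult_L2 (pot L V) (R z (res L phi))"
    by (auto simp: A_box_def)
  obtain u g where ug: "laplace_L L u g" "res L u = R z (res L phi)" "res L g = G"
    by (rule T_box_laplace[OF L T])
  have ugo: "L2_on L u" "L2_on L g" using ug(1) by (auto simp: laplace_L_def)
  have "res L g + mult_L2 (pot L V) (res L u) - z *\<^sub>C res L u = res L phi"
    unfolding ug(2,3) using G by (simp add: algebra_simps)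
  then have "resolvent_sol L V z phi u"
    unfolding resolvent_sol_def using ug(1) resolvent_equation_iff[OF ugo phi] by blast
  moreover have "cinner (res L phi) (R z (res L phi)) = inner_L L phi u"
    using cinner_H_res[OF on ugo(1)] ug(2) by simp
  ultimately show "\<exists>u. resolvent_sol L V z phi u \<and> cinner (res L phi) (R z (res L phi)) = inner_L L phi u"
    by blast
next
  fix c assume "\<exists>u. resolvent_sol L V z phi u \<and> c = inner_L L phi u"
  then obtain u g where u: "c = inner_L L phi u" "laplace_L L u g"
    and AE: "AE x in lborel. x \<in> box_L L \<longrightarrow> g x + complex_of_real (V x) * u x - z * u x = phi x"
    by (auto simp: resolvent_sol_def)
  have ugo: "L2_on L u" "L2_on L g" using u(2) by (auto simp: laplace_L_def)
  have "res L g + mult_L2 (pot L V) (res L u) - z *\<^sub>C res L u = res L phi"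
    using AE resolvent_equation_iff[OF ugo phi] by blast
  moreover have "(res L u, res L g + mult_L2 (pot L V) (res L u)) \<in> A_box L V"
    using laplace_res[OF u(2)] by (auto simp: A_box_def)
  ultimately have "R z (res L phi) = res L u" using R_eq[OF z] by blast
  then show "c = cinner (res L phi) (R z (res L phi))"
    using cinner_H_res[OF l2_fun_L2_on[OF phi] ugo(1)] u(1) by simp
qed

lemma spectral_measure_exists:
  assumes phi: "l2_fun phi"
  shows "\<exists>\<mu>. spectral_measure L V phi \<mu>"
proof -
  obtain \<mu> :: "real measure" where "sets \<mu> = sets borel" "finite_measure \<mu>"
    "\<And>z. Im z \<noteq> 0 \<Longrightarrow> cinner (res L phi) (R z (res L phi)) = (LINT t|\<mu>. 1 / (complex_of_real t - z))"
    using resolvent_measure[OF res_H[OF l2_fun_L2_on[OF phi]]] by blast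
  then show ?thesis
    unfolding spectral_measure_def by (auto simp: resolvent_form_eq phi)
qed

lemma norm_resolvent_form_le:
  assumes z: "Im z \<noteq> 0" and phi: "l2_fun phi"
  shows "cmod (resolvent_form L V z phi) \<le> (norm (abs_L2 phi))\<^sup>2 / \<bar>Im z\<bar>"
proof -
  have r: "norm (res L phi) \<le> norm (abs_L2 phi)"
    unfolding res_l2_fun[OF phi] using norm_mult_L2_le[OF bdd_meas_box, of L 1 "abs_L2 phi"] by (simp add: indicator_def)
  have "cmod (resolvent_form L V z phi) \<le> norm (res L phi) * (norm (res L phi) / \<bar>Im z\<bar>)"
    unfolding resolvent_form_eq[OF assms]
    by (intro order_trans[OF cinner_Cauchy_Schwarz] mult_left_mono norm_R_le z res_H l2_fun_L2_on phi) auto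
  also have "\<dots> \<le> norm (abs_L2 phi) * (norm (abs_L2 phi) / \<bar>Im z\<bar>)"
    using r by (intro mult_mono divide_right_mono) auto
  finally show ?thesis by (simp add: power2_eq_square)
qed

end

section \<open>Stieltjes inversion\<close>

text \<open>The criterion compares only \<open>L \<le> L'\<close>, as the later estimate does. The
  limit is found along the integers and then extended to all real parameters.\<close>

lemma cauchy_at_top:
  fixes f :: "real \<Rightarrow> 'a::complete_space"
  assumes "\<And>e. 0 < e \<Longrightarrow> \<exists>K. \<forall>L L'. K \<le> L \<longrightarrow> L \<le> L' \<longrightarrow> dist (f L) (f L') < e"
  shows "\<exists>l. (f \<longlongrightarrow> l) at_top"
proof -
  have "Cauchy (\<lambda>n. f (real n))"
  proof (rule metric_CauchyI)
    fix e :: real assume "0 < e"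
    then obtain K where K: "\<And>L L'. K \<le> L \<Longrightarrow> L \<le> L' \<Longrightarrow> dist (f L) (f L') < e" using assms by metis
    obtain N :: nat where N: "K \<le> real N" using real_arch_simple by blast
    have "dist (f (real m)) (f (real n)) < e" if "N \<le> m" "N \<le> n" for m n
    proof (cases "m \<le> n")
      case True then show ?thesis using that N by (intro K) auto
    next
      case False
      then have "dist (f (real n)) (f (real m)) < e" using that N by (intro K) auto
      then show ?thesis by (simp add: dist_commute)
    qed
    then show "\<exists>M. \<forall>m\<ge>M. \<forall>n\<ge>M. dist (f (real m)) (f (real n)) < e" by blast
  qed
  then obtain l where l: "(\<lambda>n. f (real n)) \<longlonglongrightarrow> l" using Cauchy_convergent convergent_def by blast
  have "(f \<longlongrightarrow> l) at_top"
    unfolding tendsto_iff eventually_at_top_linorder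
  proof (intro allI impI)
    fix e :: real assume e: "0 < e"
    then obtain K where K: "\<And>L L'. K \<le> L \<Longrightarrow> L \<le> L' \<Longrightarrow> dist (f L) (f L') < e / 2"
      using assms[of "e / 2"] by (metis half_gt_zero)
    have "dist (f L) l < e" if "K \<le> L" for L
    proof -
      have "\<forall>\<^sub>F n in sequentially. dist (f (real n)) l < e / 2"
        by (rule tendstoD[OF l]) (use e in simp)
      then obtain N where N: "\<And>n. N \<le> n \<Longrightarrow> dist (f (real n)) l < e / 2" by (auto simp: eventually_sequentially)
      obtain m :: nat where m: "L \<le> real m" using real_arch_simple by blast
      have "dist (f L) (f (real (max m N))) < e / 2" using that m by (intro K) auto
      moreover have "dist (f (real (max m N))) l < e / 2" by (rule N) simp
      ultimately show ?thesis using dist_triangle[of "f L" l "f (real (max m N))"] by linarith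
    qed
    then show "\<exists>K. \<forall>L\<ge>K. dist (f L) l < e" by blast
  qed
  then show ?thesis by blast
qed

definition cauchy_kernel :: "real \<Rightarrow> real" where
  "cauchy_kernel x = inverse (1 + x\<^sup>2) / pi"

lemma cauchy_kernel_nonneg: "0 \<le> cauchy_kernel x"
  by (simp add: cauchy_kernel_def)

lemma cauchy_kernel_meas [measurable]: "cauchy_kernel \<in> borel_measurable borel"
  unfolding cauchy_kernel_def[abs_def] by measurable

lemma integrable_cauchy_kernel: "integrable lborel cauchy_kernel"
  and integral_cauchy_kernel: "(LINT x|lborel. cauchy_kernel x) = 1"
proof -
  have i: "integrable lborel (\<lambda>x :: real. inverse (1 + x\<^sup>2))"
    using integrable_inverse_1_plus_square by (simp add: set_integrable_def)
  have "(LBINT x. inverse (1 + x\<^sup>2 :: real)) = pi"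
    using LBINT_inverse_1_plus_square by (simp add: interval_lebesgue_integral_def set_lebesgue_integral_def)
  then show "(LINT x|lborel. cauchy_kernel x) = 1"
    by (simp add: cauchy_kernel_def)
  show "integrable lborel cauchy_kernel"
    unfolding cauchy_kernel_def[abs_def] using i by simp
qed

lemma cauchy_kernel_tail: "(\<lambda>n. LINT x|lborel. indicator {x. real n \<le> \<bar>x\<bar>} x * cauchy_kernel x) \<longlonglongrightarrow> 0"
proof -
  have [measurable]: "{x. real n \<le> \<bar>x\<bar>} \<in> sets borel" for n
    by (intro borel_closed closed_Collect_le continuous_intros)
  have "(\<lambda>n. LINT x|lborel. indicator {x. real n \<le> \<bar>x\<bar>} x * cauchy_kernel x) \<longlonglongrightarrow> (LINT x :: real|lborel. 0 :: real)"
  proof (rule integral_dominated_convergence[where w = cauchy_kernel])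
    show "integrable lborel cauchy_kernel" by (rule integrable_cauchy_kernel)
    show "AE x in lborel. (\<lambda>n. indicator {x. real n \<le> \<bar>x\<bar>} x * cauchy_kernel x) \<longlonglongrightarrow> 0"
    proof (rule AE_I2)
      fix x :: real
      obtain N :: nat where N: "\<bar>x\<bar> < real N" using reals_Archimedean2 by blast
      have "\<forall>\<^sub>F n in sequentially. indicator {x. real n \<le> \<bar>x\<bar>} x * cauchy_kernel x = 0"
        using eventually_ge_at_top[of N] by eventually_elim (use N in \<open>auto simp: indicator_def\<close>)
      then show "(\<lambda>n. indicator {x. real n \<le> \<bar>x\<bar>} x * cauchy_kernel x) \<longlonglongrightarrow> 0" by (rule tendsto_eventually)
    qed
    show "AE x in lborel. norm (indicator {x. real n \<le> \<bar>x\<bar>} x * cauchy_kernel x) \<le> cauchy_kernel x" for n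
      by (rule AE_I2) (simp add: indicator_def cauchy_kernel_nonneg)
  qed measurable
  then show ?thesis by simp
qed

text \<open>The imaginary part of \<open>1 / (t - (s + \<i> \<epsilon>))\<close>, that is
  \<open>pi\<close> times the Poisson kernel of the upper half-plane; in the variable
  \<open>(s - t) / \<epsilon>\<close> it is a multiple of \<open>cauchy_kernel\<close>.\<close>

definition poisson :: "real \<Rightarrow> real \<Rightarrow> real \<Rightarrow> real" where
  "poisson \<epsilon> s t = \<epsilon> / ((s - t)\<^sup>2 + \<epsilon>\<^sup>2)"

lemma poisson_convolution:
  fixes f :: "real \<Rightarrow> complex"
  assumes "0 < \<epsilon>"
  shows "(LINT x|lborel. cauchy_kernel x *\<^sub>R f (t + \<epsilon> * x)) = (LINT s|lborel. poisson \<epsilon> s t *\<^sub>R (f s / pi))"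
proof -
  have "(LINT s|lborel. poisson \<epsilon> s t *\<^sub>R (f s / pi)) =
      \<bar>\<epsilon>\<bar> *\<^sub>R (LINT x|lborel. poisson \<epsilon> (t + \<epsilon> * x) t *\<^sub>R (f (t + \<epsilon> * x) / pi))"
    using assms by (intro lborel_integral_real_affine) simp
  also have "\<dots> = (LINT x|lborel. \<epsilon> *\<^sub>R (poisson \<epsilon> (t + \<epsilon> * x) t *\<^sub>R (f (t + \<epsilon> * x) / pi)))"
    by (simp only: abs_of_pos[OF assms] integral_scaleR_right)
  also have "\<dots> = (LINT x|lborel. cauchy_kernel x *\<^sub>R f (t + \<epsilon> * x))"
  proof (intro Bochner_Integration.integral_cong refl)
    fix x
    have "(t + \<epsilon> * x - t)\<^sup>2 + \<epsilon>\<^sup>2 = \<epsilon> * \<epsilon> * (1 + x\<^sup>2)" by (simp add: power2_eq_square algebra_simps)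
    then have "\<epsilon> * poisson \<epsilon> (t + \<epsilon> * x) t = inverse (1 + x\<^sup>2)"
      using assms by (simp add: poisson_def divide_simps)
    then show "\<epsilon> *\<^sub>R (poisson \<epsilon> (t + \<epsilon> * x) t *\<^sub>R (f (t + \<epsilon> * x) / pi)) = cauchy_kernel x *\<^sub>R f (t + \<epsilon> * x)"
      unfolding scaleR_scaleR by (simp add: cauchy_kernel_def scaleR_conv_of_real)
  qed
  finally show ?thesis by simp
qed

text \<open>After rescaling, the kernel is a fixed probability density. Its tail beyond
  \<open>n\<close> costs at most \<open>2 * B\<close> times a small mass, and on the rest uniform
  continuity controls \<open>f t - f (t + \<epsilon> * x)\<close> simultaneously for all
  \<open>t\<close>.\<close>

lemma poisson_approx_uniform:
  fixes f :: "real \<Rightarrow> complex"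
  assumes uc: "uniformly_continuous_on UNIV f" and B: "\<And>t. cmod (f t) \<le> B" and \<eta>: "0 < \<eta>"
  obtains \<epsilon> where "0 < \<epsilon>" "\<And>t. cmod (f t - (LINT s|lborel. poisson \<epsilon> s t *\<^sub>R (f s / pi))) \<le> \<eta>"
proof -
  have [measurable]: "f \<in> borel_measurable borel"
    by (intro borel_measurable_continuous_onI uniformly_continuous_imp_continuous uc)
  have B0: "0 \<le> B" using order_trans[OF norm_ge_zero B] by blast
  obtain \<delta> where \<delta>: "0 < \<delta>" "\<And>s t. dist s t < \<delta> \<Longrightarrow> dist (f s) (f t) < \<eta> / 2"
    using uc \<eta> unfolding uniformly_continuous_on_def by (metis UNIV_I half_gt_zero)
  let ?I = "\<lambda>n. LINT x|lborel. indicator {x. real n \<le> \<bar>x\<bar>} x * cauchy_kernel x"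
  have "(\<lambda>n. 2 * B * ?I n) \<longlonglongrightarrow> 2 * B * 0" by (intro tendsto_intros cauchy_kernel_tail)
  then have "\<forall>\<^sub>F n in sequentially. 2 * B * ?I n < \<eta> / 2"
    by (rule order_tendstoD) (use \<eta> in simp)
  then obtain n where n: "2 * B * ?I n < \<eta> / 2" by (auto simp: eventually_sequentially)
  \<comment> \<open>\<open>n\<close> has been fixed by the tail; now
    \<open>\<epsilon> * real n < \<delta>\<close>, so arguments with
    \<open>\<bar>x\<bar> < n\<close> move by less than \<open>\<delta>\<close>.\<close>
  define \<epsilon> where "\<epsilon> = \<delta> / (real n + 1)"
  have \<epsilon>: "0 < \<epsilon>" using \<delta> by (simp add: \<epsilon>_def)
  have [measurable]: "{x. real n \<le> \<bar>x\<bar>} \<in> sets borel"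
    by (intro borel_closed closed_Collect_le continuous_intros)
  have intI: "integrable lborel (\<lambda>x. indicator {x. real n \<le> \<bar>x\<bar>} x * cauchy_kernel x)"
    by (rule integrable_real_mult_indicator[OF _ integrable_cauchy_kernel, unfolded mult.commute[of "cauchy_kernel _"]]) measurable
  have "cmod (f t - (LINT s|lborel. poisson \<epsilon> s t *\<^sub>R (f s / pi))) \<le> \<eta>" for t
  proof -
    have bound: "cmod (f t - f (t + \<epsilon> * x)) \<le> \<eta> / 2 + 2 * B * indicator {x. real n \<le> \<bar>x\<bar>} x" for x
    proof (cases "real n \<le> \<bar>x\<bar>")
      case True
      then show ?thesis using norm_triangle_ineq4[of "f t" "f (t + \<epsilon> * x)"] B[of t] B[of "t + \<epsilon> * x"] \<eta> by simp
    next
      case False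
      have "dist t (t + \<epsilon> * x) = \<epsilon> * \<bar>x\<bar>" using \<epsilon> by (simp add: dist_real_def abs_mult)
      also have "\<dots> \<le> \<epsilon> * real n" using False \<epsilon> by (intro mult_left_mono) auto
      also have "\<dots> < \<delta>" using \<delta>(1) by (simp add: \<epsilon>_def field_simps)
      finally show ?thesis using \<delta>(2)[of t "t + \<epsilon> * x"] False by (simp add: dist_norm)
    qed
    have int1: "integrable lborel (\<lambda>x. cauchy_kernel x *\<^sub>R f (t + \<epsilon> * x))"
    proof (rule Bochner_Integration.integrable_bound[OF integrable_mult_right[OF integrable_cauchy_kernel, of B]])
      have "norm (cauchy_kernel x *\<^sub>R f (t + \<epsilon> * x)) \<le> norm (B * cauchy_kernel x)" for x
        using mult_right_mono[OF B cauchy_kernel_nonneg, of "t + \<epsilon> * x" x] cauchy_kernel_nonneg[of x] B0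
        by (simp add: abs_mult mult.commute)
      then show "AE x in lborel. norm (cauchy_kernel x *\<^sub>R f (t + \<epsilon> * x)) \<le> norm (B * cauchy_kernel x)"
        by (intro AE_I2)
    qed measurable
    have "f t = (LINT x|lborel. cauchy_kernel x *\<^sub>R f t)"
      using integral_cauchy_kernel integrable_cauchy_kernel by simp
    then have "f t - (LINT s|lborel. poisson \<epsilon> s t *\<^sub>R (f s / pi)) =
        (LINT x|lborel. cauchy_kernel x *\<^sub>R f t) - (LINT x|lborel. cauchy_kernel x *\<^sub>R f (t + \<epsilon> * x))"
      unfolding poisson_convolution[OF \<epsilon>] by simp
    also have "\<dots> = (LINT x|lborel. cauchy_kernel x *\<^sub>R f t - cauchy_kernel x *\<^sub>R f (t + \<epsilon> * x))"
      by (rule Bochner_Integration.integral_diff[symmetric]) (auto intro: int1 integrable_cauchy_kernel)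
    finally have "cmod (f t - (LINT s|lborel. poisson \<epsilon> s t *\<^sub>R (f s / pi))) \<le>
        (LINT x|lborel. (\<eta> / 2) * cauchy_kernel x + 2 * B * (indicator {x. real n \<le> \<bar>x\<bar>} x * cauchy_kernel x))"
    proof (simp only:, intro Bochner_Integration.integral_norm_bound_integral)
      show "integrable lborel (\<lambda>x. cauchy_kernel x *\<^sub>R f t - cauchy_kernel x *\<^sub>R f (t + \<epsilon> * x))"
        by (intro Bochner_Integration.integrable_diff int1 integrable_scaleR_left integrable_cauchy_kernel)
      show "integrable lborel (\<lambda>x. (\<eta> / 2) * cauchy_kernel x + 2 * B * (indicator {x. real n \<le> \<bar>x\<bar>} x * cauchy_kernel x))"
        by (intro Bochner_Integration.integrable_add integrable_mult_right integrable_cauchy_kernel intI)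
      show "norm (cauchy_kernel x *\<^sub>R f t - cauchy_kernel x *\<^sub>R f (t + \<epsilon> * x)) \<le>
         (\<eta> / 2) * cauchy_kernel x + 2 * B * (indicator {x. real n \<le> \<bar>x\<bar>} x * cauchy_kernel x)" for x
      proof -
        have "norm (cauchy_kernel x *\<^sub>R f t - cauchy_kernel x *\<^sub>R f (t + \<epsilon> * x)) = cauchy_kernel x * cmod (f t - f (t + \<epsilon> * x))"
          unfolding scaleR_diff_right[symmetric] norm_scaleR using cauchy_kernel_nonneg[of x] by simp
        also have "\<dots> \<le> cauchy_kernel x * (\<eta> / 2 + 2 * B * indicator {x. real n \<le> \<bar>x\<bar>} x)"
          by (rule mult_left_mono[OF bound cauchy_kernel_nonneg])
        also have "\<dots> = (\<eta> / 2) * cauchy_kernel x + 2 * B * (indicator {x. real n \<le> \<bar>x\<bar>} x * cauchy_kernel x)"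
          by (simp only: distrib_left mult.commute mult.left_commute mult.assoc)
        finally show ?thesis .
      qed
    qed
    also have "\<dots> = (\<eta> / 2) * 1 + 2 * B * ?I n"
      unfolding integral_cauchy_kernel[symmetric]
      unfolding Bochner_Integration.integral_add[OF integrable_mult_right[OF integrable_cauchy_kernel] integrable_mult_right[OF intI]]
      by (simp only: integral_mult_right_zero)
    also have "\<dots> \<le> \<eta>" using n by simp
    finally show ?thesis .
  qed
  then show ?thesis using that \<epsilon> by blast
qed

lemma C_infty_small:
  assumes "C_infty f" "0 < \<eta>"
  obtains a where "0 < a" "\<And>t. a \<le> \<bar>t\<bar> \<Longrightarrow> cmod (f t) < \<eta>"
proof -
  have "\<forall>\<^sub>F t in at_top. cmod (f t) < \<eta>" "\<forall>\<^sub>F t in at_bot. cmod (f t) < \<eta>"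
    using assms by (auto simp: C_infty_def tendsto_iff)
  then obtain b c where "\<And>t. b \<le> t \<Longrightarrow> cmod (f t) < \<eta>" "\<And>t. t \<le> c \<Longrightarrow> cmod (f t) < \<eta>"
    by (auto simp: eventually_at_top_linorder eventually_at_bot_linorder)
  then show ?thesis
    by (intro that[of "max 1 (max b (- c))"]) (auto simp: abs_if split: if_splits)
qed

text \<open>Cutting off where \<open>f\<close> is already below \<open>\<eta>\<close> makes the
  approximant integrable over the line. This integrability is what Fubini and the dominated
  convergence in \<open>L\<close> rely on.\<close>

lemma C_infty_compact_approx:
  assumes f: "C_infty f" and \<eta>: "0 < \<eta>"
  obtains g :: "real \<Rightarrow> complex" where "uniformly_continuous_on UNIV g" "bounded (range g)" "integrable lborel g"
    "\<And>t. cmod (f t - g t) \<le> \<eta>"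
proof -
  obtain a where a: "0 < a" "\<And>t. a \<le> \<bar>t\<bar> \<Longrightarrow> cmod (f t) < \<eta>" using C_infty_small[OF f \<eta>] by blast
  define h :: "real \<Rightarrow> real" where "h t = max 0 (min 1 (a + 1 - \<bar>t\<bar>))" for t
  define g where "g t = h t *\<^sub>R f t" for t
  have cf: "continuous_on UNIV f" using f by (simp add: C_infty_def)
  have cg: "continuous_on UNIV g" unfolding g_def h_def by (intro continuous_intros cf)
  have zero: "g t = 0" if "a + 1 \<le> \<bar>t\<bar>" for t using that by (simp add: g_def h_def)
  \<comment> \<open>The window is one unit wider than the set outside of which \<open>g\<close>
    vanishes: if one of two points at distance below 1 leaves it, then \<open>g\<close> is zero at
    both.\<close>
  have cpt: "compact {- (a + 2)..a + 2}" by simp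
  have ucK: "uniformly_continuous_on {- (a + 2)..a + 2} g"
    by (intro compact_uniformly_continuous continuous_on_subset[OF cg]) auto
  have uc: "uniformly_continuous_on UNIV g"
    unfolding uniformly_continuous_on_def
  proof (intro allI impI)
    fix e :: real assume e: "0 < e"
    then obtain d where d: "0 < d" "\<And>s t. s \<in> {- (a + 2)..a + 2} \<Longrightarrow> t \<in> {- (a + 2)..a + 2} \<Longrightarrow> dist t s < d \<Longrightarrow> dist (g t) (g s) < e"
      using ucK unfolding uniformly_continuous_on_def by metis
    have "dist (g t) (g s) < e" if st: "dist t s < min d 1" for s t
    proof (cases "s \<in> {- (a + 2)..a + 2} \<and> t \<in> {- (a + 2)..a + 2}")
      case True then show ?thesis using d(2) st by simp
    next
      case False
      then have "a + 2 < \<bar>s\<bar> \<or> a + 2 < \<bar>t\<bar>" by auto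
      moreover have "\<bar>t - s\<bar> < 1" using st by (simp add: dist_real_def)
      ultimately have "a + 1 \<le> \<bar>s\<bar>" "a + 1 \<le> \<bar>t\<bar>" by linarith+
      then show ?thesis using zero e by simp
    qed
    then show "\<exists>d>0. \<forall>x\<in>UNIV. \<forall>x'\<in>UNIV. dist x' x < d \<longrightarrow> dist (g x') (g x) < e"
      using d(1) by (intro exI[of _ "min d 1"]) auto
  qed
  have "bounded (g ` {- (a + 2)..a + 2})"
    by (intro compact_imp_bounded compact_continuous_image continuous_on_subset[OF cg]) auto
  then have "bounded (insert 0 (g ` {- (a + 2)..a + 2}))" by simp
  then have bdd: "bounded (range g)"
    by (rule bounded_subset) (use zero in force)
  have "integrable lborel (\<lambda>t. indicator {- (a + 2)..a + 2} t *\<^sub>R g t)"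
    by (intro borel_integrable_compact cpt continuous_on_subset[OF cg]) auto
  moreover have "(\<lambda>t. indicator {- (a + 2)..a + 2} t *\<^sub>R g t) = g"
    using zero by (auto simp: indicator_def fun_eq_iff)
  ultimately have int: "integrable lborel g" by simp
  have "cmod (f t - g t) \<le> \<eta>" for t
  proof -
    have "f t - g t = (1 - h t) *\<^sub>R f t" by (simp add: g_def scaleR_diff_left)
    then have e: "cmod (f t - g t) = (1 - h t) * cmod (f t)" by (simp add: h_def)
    show ?thesis
    proof (cases "a \<le> \<bar>t\<bar>")
      case True
      have "(1 - h t) * cmod (f t) \<le> 1 * cmod (f t)" by (intro mult_right_mono) (auto simp: h_def)
      then show ?thesis using e a(2)[OF True] by simp
    next
      case False
      then have "h t = 1" by (simp add: h_def)
      then show ?thesis using e \<eta> by simp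
    qed
  qed
  then show ?thesis using that uc bdd int by blast
qed

section \<open>Recovering integrals from the Stieltjes transform\<close>

definition stieltjes :: "real measure \<Rightarrow> complex \<Rightarrow> complex" where
  "stieltjes \<mu> z = (LINT t|\<mu>. 1 / (complex_of_real t - z))"

context finite_borel_measure
begin

lemma sets_M_borel [simp, measurable_cong]: "sets M = sets borel"
  by (rule M_is_borel)

lemma space_M_UNIV [simp]: "space M = UNIV"
  using sets_eq_imp_space_eq[OF M_is_borel] by simp

lemma integrable_bounded_M:
  fixes f :: "real \<Rightarrow> 'b::{banach, second_countable_topology}"
  assumes "f \<in> borel_measurable borel" "\<And>t. norm (f t) \<le> B"
  shows "integrable M f"
  using assms by (intro integrable_const_bound[of _ B]) (auto simp: measurable_cong_sets[OF M_is_borel refl])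

lemma Im_stieltjes:
  assumes "0 < \<epsilon>"
  shows "Im (stieltjes M (Complex s \<epsilon>)) = (LINT t|M. poisson \<epsilon> s t)"
proof -
  have nz: "complex_of_real t - Complex s \<epsilon> \<noteq> 0" for t using assms by (simp add: complex_eq_iff)
  have "cmod (1 / (complex_of_real t - Complex s \<epsilon>)) \<le> 1 / \<epsilon>" for t
    using abs_Im_le_cmod[of "complex_of_real t - Complex s \<epsilon>"] assms nz[of t]
    by (simp add: norm_divide divide_simps)
  then have "integrable M (\<lambda>t. 1 / (complex_of_real t - Complex s \<epsilon>))"
    by (intro integrable_bounded_M[where B = "1 / \<epsilon>"]) auto
  then have "Im (stieltjes M (Complex s \<epsilon>)) = (LINT t|M. Im (1 / (complex_of_real t - Complex s \<epsilon>)))"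
    unfolding stieltjes_def by (rule integral_Im[symmetric])
  also have "\<dots> = (LINT t|M. poisson \<epsilon> s t)"
    by (simp add: poisson_def Im_divide power2_commute[of s])
  finally show ?thesis .
qed

text \<open>Exchanges smoothing for data on the resolvent: the integral of a smoothed function
  becomes an average of the Stieltjes transform along the line at height \<open>\<epsilon>\<close>.
  Fubini applies because the kernel is at most \<open>1 / \<epsilon>\<close>, the measure is finite
  and \<open>g\<close> is integrable.\<close>

lemma poisson_fubini:
  fixes g :: "real \<Rightarrow> complex"
  assumes g: "integrable lborel g" and \<epsilon>: "0 < \<epsilon>"
  shows "(LINT t|M. (LINT s|lborel. poisson \<epsilon> s t *\<^sub>R g s)) = (LINT s|lborel. Im (stieltjes M (Complex s \<epsilon>)) *\<^sub>R g s)"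
proof -
  interpret P: pair_sigma_finite lborel M
    by (intro pair_sigma_finite.intro sigma_finite_lborel sigma_finite_measure_axioms)
  have [measurable]: "g \<in> borel_measurable borel" using g by (auto dest: borel_measurable_integrable)
  have p0: "0 \<le> poisson \<epsilon> s t" "poisson \<epsilon> s t \<le> 1 / \<epsilon>" for s t
  proof -
    show "0 \<le> poisson \<epsilon> s t" using \<epsilon> by (simp add: poisson_def)
    have "poisson \<epsilon> s t \<le> \<epsilon> / \<epsilon>\<^sup>2"
      unfolding poisson_def using \<epsilon> by (intro divide_left_mono mult_pos_pos) (auto simp: add_nonneg_pos)
    then show "poisson \<epsilon> s t \<le> 1 / \<epsilon>" using \<epsilon> by (simp add: power2_eq_square)
  qed
  have pm [measurable]: "(\<lambda>t. poisson \<epsilon> s t) \<in> borel_measurable borel" for s unfolding poisson_def by measurable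
  have ip: "integrable M (\<lambda>t. poisson \<epsilon> s t)" for s
    by (rule integrable_bounded_M[where B = "1 / \<epsilon>"]) (use p0 in auto)
  have ib: "(LINT t|M. poisson \<epsilon> s t) \<le> measure M UNIV / \<epsilon>" for s
    using integral_mono[OF ip[of s] integrable_bounded_M[of "\<lambda>_. 1 / \<epsilon>" "1 / \<epsilon>"]] p0 \<epsilon> by simp
  have i0: "0 \<le> (LINT t|M. poisson \<epsilon> s t)" for s
    by (intro Bochner_Integration.integral_nonneg p0)
  have "integrable (lborel \<Otimes>\<^sub>M M) (\<lambda>(s, t). poisson \<epsilon> s t *\<^sub>R g s)"
  proof (rule P.Fubini_integrable)
    show "(\<lambda>(s, t). poisson \<epsilon> s t *\<^sub>R g s) \<in> borel_measurable (lborel \<Otimes>\<^sub>M M)"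
      unfolding poisson_def by measurable
    have e: "(LINT t|M. norm (case (s, t) of (s, t) \<Rightarrow> poisson \<epsilon> s t *\<^sub>R g s)) = (LINT t|M. poisson \<epsilon> s t) * cmod (g s)" for s
      using p0 by simp
    have [measurable]: "(\<lambda>s. LINT t|M. poisson \<epsilon> s t) \<in> borel_measurable borel"
      unfolding poisson_def by measurable
    show "integrable lborel (\<lambda>s. LINT t|M. norm (case (s, t) of (s, t) \<Rightarrow> poisson \<epsilon> s t *\<^sub>R g s))"
      unfolding e
    proof (rule Bochner_Integration.integrable_bound)
      show "integrable lborel (\<lambda>s. measure M UNIV / \<epsilon> * cmod (g s))" using g by simp
      show "AE s in lborel. norm ((LINT t|M. poisson \<epsilon> s t) * cmod (g s)) \<le> norm (measure M UNIV / \<epsilon> * cmod (g s))"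
      proof (rule AE_I2)
        fix s
        have "(LINT t|M. poisson \<epsilon> s t) * cmod (g s) \<le> measure M UNIV / \<epsilon> * cmod (g s)"
          by (rule mult_right_mono[OF ib]) simp
        then show "norm ((LINT t|M. poisson \<epsilon> s t) * cmod (g s)) \<le> norm (measure M UNIV / \<epsilon> * cmod (g s))"
          using i0[of s] \<epsilon> by (simp add: abs_mult)
      qed
    qed measurable
    show "AE s in lborel. integrable M (\<lambda>t. case (s, t) of (s, t) \<Rightarrow> poisson \<epsilon> s t *\<^sub>R g s)"
      using ip by simp
  qed
  from P.Fubini_integral[OF this]
  have "(LINT t|M. (LINT s|lborel. poisson \<epsilon> s t *\<^sub>R g s)) = (LINT s|lborel. (LINT t|M. poisson \<epsilon> s t *\<^sub>R g s))" .
  also have "\<dots> = (LINT s|lborel. Im (stieltjes M (Complex s \<epsilon>)) *\<^sub>R g s)"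
    unfolding Im_stieltjes[OF \<epsilon>] using ip by simp
  finally show ?thesis .
qed

lemma stieltjes_meas [measurable]: "(\<lambda>s. stieltjes M (Complex s \<epsilon>)) \<in> borel_measurable borel"
proof -
  have "(\<lambda>s. LINT t|M. 1 / (complex_of_real t - (complex_of_real s + \<i> * complex_of_real \<epsilon>))) \<in> borel_measurable borel"
    by measurable
  then show ?thesis by (simp add: stieltjes_def complex_eq[symmetric] Complex_eq)
qed

text \<open>The function \<open>y * poisson y 0 t\<close> lies between 0 and 1 and tends to 1 as
  \<open>y\<close> grows, so \<open>y * Im (stieltjes M (Complex 0 y))\<close> tends to the total
  mass while remaining bounded by \<open>C\<close>.\<close>

lemma total_mass_le:
  assumes "\<And>y. 0 < y \<Longrightarrow> cmod (stieltjes M (Complex 0 y)) \<le> C / y"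
  shows "measure M UNIV \<le> C"
proof -
  have "(\<lambda>n. LINT t|M. real (Suc n) * poisson (real (Suc n)) 0 t) \<longlonglongrightarrow> (LINT t|M. 1)"
  proof (rule integral_dominated_convergence[where w = "\<lambda>_. 1"])
    have le1: "0 \<le> real (Suc n) * poisson (real (Suc n)) 0 t" "real (Suc n) * poisson (real (Suc n)) 0 t \<le> 1" for n t
      by (simp_all add: poisson_def power2_eq_square divide_simps add_nonneg_pos del: of_nat_Suc)
    show "AE t in M. norm (real (Suc n) * poisson (real (Suc n)) 0 t) \<le> 1" for n
      using le1[of n] by (intro AE_I2) (simp add: abs_le_iff)
    show "AE t in M. (\<lambda>n. real (Suc n) * poisson (real (Suc n)) 0 t) \<longlonglongrightarrow> 1"
    proof (rule AE_I2)
      fix t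
      have "real (Suc n) * poisson (real (Suc n)) 0 t = 1 / ((t * inverse (real (Suc n)))\<^sup>2 + 1)" for n
        by (simp add: poisson_def power2_eq_square divide_simps del: of_nat_Suc)
      moreover have "(\<lambda>n. 1 / ((t * inverse (real (Suc n)))\<^sup>2 + 1)) \<longlonglongrightarrow> 1 / ((t * 0)\<^sup>2 + 1)"
        by (intro tendsto_intros LIMSEQ_inverse_real_of_nat) simp
      ultimately show "(\<lambda>n. real (Suc n) * poisson (real (Suc n)) 0 t) \<longlonglongrightarrow> 1" by simp
    qed
    show "(\<lambda>t. real (Suc n) * poisson (real (Suc n)) 0 t) \<in> borel_measurable M" for n
      unfolding poisson_def by measurable
  qed auto
  moreover have "(LINT t|M. real (Suc n) * poisson (real (Suc n)) 0 t) \<le> C" for n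
  proof -
    have "(LINT t|M. real (Suc n) * poisson (real (Suc n)) 0 t) = real (Suc n) * Im (stieltjes M (Complex 0 (real (Suc n))))"
      by (subst Im_stieltjes) auto
    also have "\<dots> \<le> real (Suc n) * (C / real (Suc n))"
      using assms[of "real (Suc n)"] abs_Im_le_cmod[of "stieltjes M (Complex 0 (real (Suc n)))"]
      by (intro mult_left_mono) auto
    also have "\<dots> = C" by (simp del: of_nat_Suc)
    finally show ?thesis .
  qed
  ultimately have "(LINT t|M. 1) \<le> C" by (intro LIMSEQ_le_const2) auto
  then show ?thesis by simp
qed

end

text \<open>\<open>\<epsilon>\<close> and \<open>h\<close> depend on \<open>f\<close> and
  \<open>\<eta>\<close> but not on the measure, and the error is proportional to the mass. One
  approximation thus serves a whole family of spectral measures.\<close>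

lemma poisson_approx:
  assumes f: "C_infty f" and \<eta>: "0 < \<eta>"
  obtains \<epsilon> and h :: "real \<Rightarrow> complex" where "0 < \<epsilon>" "integrable lborel h"
    "\<And>\<mu>. finite_borel_measure \<mu> \<Longrightarrow>
       cmod ((LINT t|\<mu>. f t) - (LINT s|lborel. Im (stieltjes \<mu> (Complex s \<epsilon>)) *\<^sub>R h s)) \<le> \<eta> * measure \<mu> UNIV"
proof -
  obtain g :: "real \<Rightarrow> complex" where g: "uniformly_continuous_on UNIV g" "bounded (range g)" "integrable lborel g"
    "\<And>t. cmod (f t - g t) \<le> \<eta> / 2"
    using C_infty_compact_approx[OF f, of "\<eta> / 2"] \<eta> by (metis half_gt_zero)
  obtain B where B: "\<And>t. cmod (g t) \<le> B" using g(2) by (auto simp: bounded_iff)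
  obtain \<epsilon> where \<epsilon>: "0 < \<epsilon>" "\<And>t. cmod (g t - (LINT s|lborel. poisson \<epsilon> s t *\<^sub>R (g s / pi))) \<le> \<eta> / 2"
    using poisson_approx_uniform[OF g(1) B, of "\<eta> / 2"] \<eta> by (metis half_gt_zero)
  have gi: "integrable lborel (\<lambda>s. g s / pi)" using g(3) by simp
  have [measurable]: "f \<in> borel_measurable borel" "g \<in> borel_measurable borel"
    using f g(1) by (auto simp: C_infty_def intro: borel_measurable_continuous_onI uniformly_continuous_imp_continuous)
  let ?P = "\<lambda>t. LINT s|lborel. poisson \<epsilon> s t *\<^sub>R (g s / pi)"
  have Pm: "?P \<in> borel_measurable borel" unfolding poisson_def by measurable
  have fP: "cmod (f t - ?P t) \<le> \<eta>" for t
    using norm_triangle_ineq[of "f t - g t" "g t - ?P t"] g(4)[of t] \<epsilon>(2)[of t] by simp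
  have PB: "cmod (?P t) \<le> B + \<eta> / 2" for t
    using norm_triangle_ineq4[of "g t" "g t - ?P t"] B[of t] \<epsilon>(2)[of t] by simp
  have fB: "cmod (f t) \<le> B + \<eta> / 2" for t
    using norm_triangle_ineq[of "f t - g t" "g t"] B[of t] g(4)[of t] by simp
  have "cmod ((LINT t|\<mu>. f t) - (LINT s|lborel. Im (stieltjes \<mu> (Complex s \<epsilon>)) *\<^sub>R (g s / pi))) \<le> \<eta> * measure \<mu> UNIV"
    if "finite_borel_measure \<mu>" for \<mu>
  proof -
    interpret finite_borel_measure \<mu> by fact
    have i: "integrable \<mu> f" "integrable \<mu> ?P"
      by (rule integrable_bounded_M[OF _ fB], measurable) (rule integrable_bounded_M[OF Pm PB])
    have "(LINT t|\<mu>. f t) - (LINT s|lborel. Im (stieltjes \<mu> (Complex s \<epsilon>)) *\<^sub>R (g s / pi)) = (LINT t|\<mu>. f t - ?P t)"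
      unfolding poisson_fubini[OF gi \<epsilon>(1), symmetric] by (rule Bochner_Integration.integral_diff[OF i, symmetric])
    also have "cmod \<dots> \<le> (LINT t|\<mu>. \<eta>)"
      by (rule Bochner_Integration.integral_norm_bound_integral[OF Bochner_Integration.integrable_diff[OF i]]) (use fP in auto)
    finally show ?thesis by (simp add: mult.commute)
  qed
  then show ?thesis using that[OF \<epsilon>(1) gi] by blast
qed

text \<open>Both integrals are close to one and the same average of the common transform. This is
  what makes the description in \<open>fcalc_form\<close> definite.\<close>

lemma stieltjes_unique:
  assumes "finite_borel_measure \<mu>" "finite_borel_measure \<nu>"
    and eq: "\<And>z. Im z \<noteq> 0 \<Longrightarrow> stieltjes \<mu> z = stieltjes \<nu> z" and f: "C_infty f"
  shows "(LINT t|\<mu>. f t) = (LINT t|\<nu>. f t)"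
proof -
  define C where "C = measure \<mu> UNIV + measure \<nu> UNIV + 1"
  have C: "0 < C" by (simp add: C_def add_nonneg_pos)
  have "cmod ((LINT t|\<mu>. f t) - (LINT t|\<nu>. f t)) \<le> e" if e: "0 < e" for e
  proof -
    obtain \<epsilon> and h :: "real \<Rightarrow> complex" where \<epsilon>: "0 < \<epsilon>" and
      h: "\<And>\<mu>. finite_borel_measure \<mu> \<Longrightarrow>
       cmod ((LINT t|\<mu>. f t) - (LINT s|lborel. Im (stieltjes \<mu> (Complex s \<epsilon>)) *\<^sub>R h s)) \<le> e / C * measure \<mu> UNIV"
      using poisson_approx[OF f, of "e / C"] e C by (metis divide_pos_pos)
    have "stieltjes \<mu> (Complex s \<epsilon>) = stieltjes \<nu> (Complex s \<epsilon>)" for s using \<epsilon> by (intro eq) simp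
    then have "cmod ((LINT t|\<mu>. f t) - (LINT t|\<nu>. f t)) \<le> e / C * measure \<mu> UNIV + e / C * measure \<nu> UNIV"
      using h[OF assms(1)] h[OF assms(2)]
        norm_triangle_ineq4[of "(LINT t|\<mu>. f t) - (LINT s|lborel. Im (stieltjes \<mu> (Complex s \<epsilon>)) *\<^sub>R h s)"
          "(LINT t|\<nu>. f t) - (LINT s|lborel. Im (stieltjes \<mu> (Complex s \<epsilon>)) *\<^sub>R h s)"]
      by simp
    also have "\<dots> \<le> e / C * C" unfolding distrib_left[symmetric] using e C by (intro mult_left_mono) (auto simp: C_def)
    finally show ?thesis using C by simp
  qed
  then have "cmod ((LINT t|\<mu>. f t) - (LINT t|\<nu>. f t)) \<le> 0" by (rule field_le_epsilon) simp
  then show ?thesis by simp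
qed

lemma fcalc_form_eq:
  assumes \<mu>: "spectral_measure L V phi \<mu>" and f: "C_infty f"
  shows "fcalc_form L V f phi = (LINT t|\<mu>. f t)"
  unfolding fcalc_form_def
proof (rule the_equality)
  fix c assume "\<exists>\<mu>. spectral_measure L V phi \<mu> \<and> c = (LINT t|\<mu>. f t)"
  then obtain \<nu> where \<nu>: "spectral_measure L V phi \<nu>" "c = (LINT t|\<nu>. f t)" by blast
  have "stieltjes \<nu> z = stieltjes \<mu> z" if "Im z \<noteq> 0" for z
    using \<mu> \<nu>(1) that by (simp add: spectral_measure_def stieltjes_def)
  then show "c = (LINT t|\<mu>. f t)"
    unfolding \<nu>(2) using \<mu> \<nu>(1)
    by (intro stieltjes_unique f)
       (auto simp: spectral_measure_def finite_borel_measure_def finite_borel_measure_axioms_def)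
qed (use \<mu> in blast)

text \<open>The averages of the transforms converge by dominated convergence, with
  \<open>C / \<epsilon>\<close> times \<open>cmod (h s)\<close> as majorant, and they approximate
  the integrals of \<open>f\<close> uniformly in \<open>L\<close>. Mass escaping to infinity is
  invisible to a function that vanishes there.\<close>

lemma stieltjes_limit:
  assumes \<mu>: "\<And>L. finite_borel_measure (\<mu> L)"
    and bound: "\<And>L z. Im z \<noteq> 0 \<Longrightarrow> cmod (stieltjes (\<mu> L) z) \<le> C / \<bar>Im z\<bar>"
    and lim: "\<And>z. Im z \<noteq> 0 \<Longrightarrow> \<exists>l. ((\<lambda>L. stieltjes (\<mu> L) z) \<longlongrightarrow> l) at_top"
    and f: "C_infty f"
  shows "\<exists>l. ((\<lambda>L :: real. LINT t|\<mu> L. f t) \<longlongrightarrow> l) at_top"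
proof (rule cauchy_at_top)
  fix e :: real assume e: "0 < e"
  have mass: "measure (\<mu> L) UNIV \<le> C" for L
  proof -
    interpret finite_borel_measure "\<mu> L" by (rule \<mu>)
    have "cmod (stieltjes (\<mu> L) (Complex 0 y)) \<le> C / y" if "0 < y" for y
      using bound[of "Complex 0 y" L] that by simp
    then show ?thesis by (rule total_mass_le)
  qed
  have C: "0 \<le> C" using order_trans[OF measure_nonneg mass] .
  \<comment> \<open>\<open>C + 1\<close> replaces \<open>C\<close>, which may be 0. With the factor
    4, smoothing and convergence cost at most \<open>e / 4\<close> each, so every integral beyond
    \<open>K\<close> is within \<open>e / 2\<close> of the limit of the averages.\<close>
  have pos: "0 < e / (4 * (C + 1))" using e C by simp
  obtain \<epsilon> and h :: "real \<Rightarrow> complex" where \<epsilon>: "0 < \<epsilon>" and hi: "integrable lborel h" and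
      h: "\<And>\<mu>. finite_borel_measure \<mu> \<Longrightarrow>
       cmod ((LINT t|\<mu>. f t) - (LINT s|lborel. Im (stieltjes \<mu> (Complex s \<epsilon>)) *\<^sub>R h s)) \<le> e / (4 * (C + 1)) * measure \<mu> UNIV"
    by (rule poisson_approx[OF f pos]) blast
  let ?G = "\<lambda>L. LINT s|lborel. Im (stieltjes (\<mu> L) (Complex s \<epsilon>)) *\<^sub>R h s"
  have [measurable]: "h \<in> borel_measurable borel" using hi by (auto dest: borel_measurable_integrable)
  have [measurable]: "(\<lambda>s. stieltjes (\<mu> L) (Complex s \<epsilon>)) \<in> borel_measurable borel" for L
    by (rule finite_borel_measure.stieltjes_meas[OF \<mu>])
  have "\<exists>l. ((\<lambda>L. stieltjes (\<mu> L) (Complex s \<epsilon>)) \<longlongrightarrow> l) at_top" for s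
    by (rule lim) (use \<epsilon> in simp)
  then obtain l where l: "\<And>s. ((\<lambda>L. stieltjes (\<mu> L) (Complex s \<epsilon>)) \<longlongrightarrow> l s) at_top"
    by metis
  have [measurable]: "l \<in> borel_measurable borel"
    by (rule borel_measurable_LIMSEQ_metric[of "\<lambda>n s. stieltjes (\<mu> (real n)) (Complex s \<epsilon>)"])
       (measurable, rule filterlim_compose[OF l filterlim_real_sequentially])
  have "(?G \<longlongrightarrow> (LINT s|lborel. Im (l s) *\<^sub>R h s)) at_top"
  proof (rule integral_dominated_convergence_at_top[where w = "\<lambda>s. C / \<epsilon> * cmod (h s)"])
    show "integrable lborel (\<lambda>s. C / \<epsilon> * cmod (h s))" using hi by simp
    show "AE s in lborel. ((\<lambda>L. Im (stieltjes (\<mu> L) (Complex s \<epsilon>)) *\<^sub>R h s) \<longlongrightarrow> Im (l s) *\<^sub>R h s) at_top"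
      by (intro AE_I2 tendsto_intros l)
    show "\<forall>\<^sub>F L in at_top. AE s in lborel. norm (Im (stieltjes (\<mu> L) (Complex s \<epsilon>)) *\<^sub>R h s) \<le> C / \<epsilon> * cmod (h s)"
    proof (intro always_eventually allI AE_I2)
      fix L s
      have "\<bar>Im (stieltjes (\<mu> L) (Complex s \<epsilon>))\<bar> \<le> C / \<epsilon>"
        using order_trans[OF abs_Im_le_cmod bound[of "Complex s \<epsilon>" L]] \<epsilon> by simp
      then show "norm (Im (stieltjes (\<mu> L) (Complex s \<epsilon>)) *\<^sub>R h s) \<le> C / \<epsilon> * cmod (h s)"
        unfolding norm_scaleR real_norm_def by (rule mult_right_mono) simp
    qed
  qed measurable
  then have "\<forall>\<^sub>F L in at_top. dist (?G L) (LINT s|lborel. Im (l s) *\<^sub>R h s) < e / 4"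
    by (rule tendstoD) (use e in simp)
  then obtain K where K: "\<And>L. K \<le> L \<Longrightarrow> dist (?G L) (LINT s|lborel. Im (l s) *\<^sub>R h s) < e / 4"
    by (auto simp: eventually_at_top_linorder)
  have close: "dist (LINT t|\<mu> L. f t) (LINT s|lborel. Im (l s) *\<^sub>R h s) < e / 2" if "K \<le> L" for L
  proof -
    have "dist (LINT t|\<mu> L. f t) (?G L) \<le> e / (4 * (C + 1)) * (C + 1)"
      unfolding dist_norm using mass[of L] e C by (intro order_trans[OF h[OF \<mu>]] mult_left_mono) auto
    also have "\<dots> = e / 4" using C by (simp add: divide_simps)
    finally show ?thesis using K[OF that] dist_triangle[of "LINT t|\<mu> L. f t" "LINT s|lborel. Im (l s) *\<^sub>R h s" "?G L"] by linarith
  qed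
  show "\<exists>K. \<forall>L L'. K \<le> L \<longrightarrow> L \<le> L' \<longrightarrow> dist (LINT t|\<mu> L. f t) (LINT t|\<mu> L'. f t) < e"
  proof (intro exI[of _ K] allI impI)
    fix L L' assume "K \<le> L" "L \<le> L'"
    then show "dist (LINT t|\<mu> L. f t) (LINT t|\<mu> L'. f t) < e"
      by (intro dist_triangle_half_l[OF close close]) auto
  qed
qed

section \<open>Smooth cutoffs\<close>

text \<open>Difference quotients integrate to zero by translation invariance. The mean value
  inequality bounds them by \<open>B\<close>, so dominated convergence passes to the derivative; no
  iterated integrals are involved.\<close>

lemma integral_directional_derivative_zero:
  fixes G G' :: "'a::euclidean_space \<Rightarrow> complex"
  assumes [measurable]: "G \<in> borel_measurable borel" "G' \<in> borel_measurable borel"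
    and deriv: "\<And>x. ((\<lambda>t. G (x + t *\<^sub>R e)) has_vector_derivative G' x) (at 0)"
    and supp: "\<And>x. \<rho> \<le> norm x \<Longrightarrow> G x = 0" and e: "norm e = 1"
    and GB: "\<And>x. cmod (G x) \<le> C" and G'B: "\<And>x. cmod (G' x) \<le> B"
  shows "(LINT x|lborel. G' x) = 0"
proof -
  have C0: "0 \<le> C" using order_trans[OF norm_ge_zero GB] by blast
  have B0: "0 \<le> B" using order_trans[OF norm_ge_zero G'B] by blast
  have deriv': "((\<lambda>t. G (x + t *\<^sub>R e)) has_vector_derivative G' (x + s *\<^sub>R e)) (at s)" for x s
  proof -
    have "((\<lambda>t. G ((x + s *\<^sub>R e) + t *\<^sub>R e)) has_vector_derivative G' (x + s *\<^sub>R e)) (at (s - s))"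
      using deriv[of "x + s *\<^sub>R e"] by simp
    moreover have "((\<lambda>t. t - s) has_vector_derivative 1) (at s)"
      by (auto intro!: derivative_eq_intros simp: has_vector_derivative_def)
    ultimately have "((\<lambda>t. G ((x + s *\<^sub>R e) + t *\<^sub>R e)) \<circ> (\<lambda>t. t - s) has_vector_derivative 1 *\<^sub>R G' (x + s *\<^sub>R e)) (at s)"
      by (intro vector_diff_chain_at)
    moreover have "(\<lambda>t. G ((x + s *\<^sub>R e) + t *\<^sub>R e)) \<circ> (\<lambda>t. t - s) = (\<lambda>t. G (x + t *\<^sub>R e))"
      by (auto simp: fun_eq_iff algebra_simps)
    ultimately show ?thesis by simp
  qed
  have lip: "cmod (G (x + h *\<^sub>R e) - G x) \<le> B * \<bar>h\<bar>" for x h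
  proof -
    have "norm (G (x + h *\<^sub>R e) - G (x + 0 *\<^sub>R e)) \<le> B * norm (h - 0)"
    proof (rule differentiable_bound[where S = UNIV and f' = "\<lambda>s t. t *\<^sub>R G' (x + s *\<^sub>R e)"])
      show "((\<lambda>t. G (x + t *\<^sub>R e)) has_derivative (\<lambda>t. t *\<^sub>R G' (x + s *\<^sub>R e))) (at s within UNIV)" for s
        using deriv'[of x s] by (simp add: has_vector_derivative_def)
      show "onorm (\<lambda>t. t *\<^sub>R G' (x + s *\<^sub>R e)) \<le> B" for s
        using mult_left_mono[OF G'B abs_ge_zero] by (intro onorm_le) (simp add: mult.commute)
    qed auto
    then show ?thesis by simp
  qed
  define h where "h n = inverse (real (Suc n))" for n
  have h: "0 < h n" "h n \<le> 1" for n by (auto simp: h_def inverse_le_1_iff)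
  have hlim: "h \<longlonglongrightarrow> 0" unfolding h_def by (rule LIMSEQ_inverse_real_of_nat)
  define D where "D n x = (1 / h n) *\<^sub>R (G (x + h n *\<^sub>R e) - G x)" for n x
  have [measurable]: "D n \<in> borel_measurable borel" for n unfolding D_def by measurable
  have intG: "integrable lborel G"
  proof (rule Bochner_Integration.integrable_bound)
    show "integrable lborel (\<lambda>x :: 'a. C * indicator (cball 0 \<rho>) x)"
      by (intro integrable_mult_right integrable_real_indicator emeasure_bounded_finite) auto
    show "AE x in lborel. norm (G x) \<le> norm (C * indicator (cball 0 \<rho>) x)"
      using GB supp C0 by (intro AE_I2) (auto simp: indicator_def)
  qed measurable
  have "(LINT x|lborel. D n x) = 0" for n
  proof -
    have i: "integrable lborel (\<lambda>x. G (x + h n *\<^sub>R e))"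
    proof -
      have "integrable (distr lborel borel ((+) (h n *\<^sub>R e))) G" using intG by (simp add: lborel_distr_plus)
      then show ?thesis by (subst (asm) integrable_distr_eq) (auto simp: add.commute)
    qed
    have "(LINT x|lborel. D n x) = (1 / h n) *\<^sub>R ((LINT x|lborel. G (x + h n *\<^sub>R e)) - (LINT x|lborel. G x))"
      unfolding D_def by (simp only: integral_scaleR_right Bochner_Integration.integral_diff[OF i intG])
    also have "(LINT x|lborel. G (x + h n *\<^sub>R e)) = (LINT x|lborel. G x)" by (rule integral_translate) measurable
    finally show ?thesis by simp
  qed
  moreover have "(\<lambda>n. LINT x|lborel. D n x) \<longlonglongrightarrow> (LINT x|lborel. G' x)"
  \<comment> \<open>The steps \<open>h n\<close> are at most 1, so all difference quotients are
    supported within radius \<open>\<rho> + 1\<close>.\<close>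
  proof (rule integral_dominated_convergence[where w = "\<lambda>x. B * indicator (cball 0 (\<rho> + 1)) x"])
    show "integrable lborel (\<lambda>x :: 'a. B * indicator (cball 0 (\<rho> + 1)) x)"
      by (intro integrable_mult_right integrable_real_indicator emeasure_bounded_finite) auto
    show "AE x in lborel. norm (D n x) \<le> B * indicator (cball 0 (\<rho> + 1)) x" for n
    proof (rule AE_I2)
      fix x :: 'a
      show "norm (D n x) \<le> B * indicator (cball 0 (\<rho> + 1)) x"
      proof (cases "norm x \<le> \<rho> + 1")
        case True
        have "norm (D n x) = cmod (G (x + h n *\<^sub>R e) - G x) / h n" using h[of n] by (simp add: D_def)
        also have "\<dots> \<le> B" using lip[of x "h n"] h[of n] by (simp add: divide_simps)
        finally show ?thesis using True by (simp add: indicator_def)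
      next
        case False
        have "norm x \<le> norm (x + h n *\<^sub>R e) + norm (h n *\<^sub>R e)"
          using norm_triangle_ineq4[of "x + h n *\<^sub>R e" "h n *\<^sub>R e"] by simp
        then have "\<rho> \<le> norm (x + h n *\<^sub>R e)" using False h[of n] e by simp
        then show ?thesis using supp False by (simp add: D_def)
      qed
    qed
    show "AE x in lborel. (\<lambda>n. D n x) \<longlonglongrightarrow> G' x"
    proof (rule AE_I2)
      fix x
      have "((\<lambda>t. (1 / t) *\<^sub>R (G (x + t *\<^sub>R e) - G x)) \<longlongrightarrow> G' x) (at 0)"
      proof (rule LIM_zero_cancel, rule tendsto_norm_zero_cancel)
        have "((\<lambda>t. norm (G (x + t *\<^sub>R e) - G x - t *\<^sub>R G' x) / norm t) \<longlongrightarrow> 0) (at 0)"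
          using deriv[of x] unfolding has_vector_derivative_def has_derivative_iff_norm by simp
        moreover have "norm (G (x + t *\<^sub>R e) - G x - t *\<^sub>R G' x) / norm t = norm ((1 / t) *\<^sub>R (G (x + t *\<^sub>R e) - G x) - G' x)"
          if "t \<noteq> 0" for t :: real
        proof -
          have "(1 / t) *\<^sub>R (G (x + t *\<^sub>R e) - G x) - G' x = (1 / t) *\<^sub>R (G (x + t *\<^sub>R e) - G x - t *\<^sub>R G' x)"
            using that by (simp add: scaleR_diff_right)
          then show ?thesis by (simp add: divide_inverse mult.commute)
        qed
        then have "\<forall>\<^sub>F t in at 0. norm (G (x + t *\<^sub>R e) - G x - t *\<^sub>R G' x) / norm t = norm ((1 / t) *\<^sub>R (G (x + t *\<^sub>R e) - G x) - G' x)"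
          by (simp add: eventually_at_filter)
        ultimately show "((\<lambda>t. norm ((1 / t) *\<^sub>R (G (x + t *\<^sub>R e) - G x) - G' x)) \<longlongrightarrow> 0) (at 0)"
          by (rule Lim_transform_eventually)
      qed
      then have "((\<lambda>n. (1 / h n) *\<^sub>R (G (x + h n *\<^sub>R e) - G x)) \<longlonglongrightarrow> G' x)"
        by (rule filterlim_compose) (use h hlim in \<open>auto simp: filterlim_at less_imp_neq[symmetric]\<close>)
      then show "(\<lambda>n. D n x) \<longlonglongrightarrow> G' x" by (simp add: D_def)
    qed
  qed measurable
  ultimately show ?thesis by (simp add: LIMSEQ_const_iff)
qed

text \<open>Away from 0 the function is locally a monomial or zero. At 0 the difference quotient is
  at most \<open>\<bar>h\<bar> ^ Suc m\<close>, which tends to 0 because the exponent of the power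
  is at least 2.\<close>

lemma DERIV_max0_power: "((\<lambda>r. (max 0 r) ^ Suc (Suc m)) has_real_derivative real (Suc (Suc m)) * (max 0 r) ^ Suc m) (at r)"
proof (cases r "0 :: real" rule: linorder_cases)
  case less
  have "((\<lambda>r. 0) has_real_derivative 0) (at r)" by simp
  then have "((\<lambda>r. (max 0 r) ^ Suc (Suc m)) has_real_derivative 0) (at r)"
    by (rule has_field_derivative_transform_within_open[of _ _ _ "{..<0}"]) (use less in auto)
  then show ?thesis using less by simp
next
  case greater
  have "((\<lambda>r. r ^ Suc (Suc m)) has_real_derivative real (Suc (Suc m)) * r ^ Suc m) (at r)"
    using DERIV_pow[of "Suc (Suc m)" r] by simp
  then have "((\<lambda>r. (max 0 r) ^ Suc (Suc m)) has_real_derivative real (Suc (Suc m)) * r ^ Suc m) (at r)"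
    by (rule has_field_derivative_transform_within_open[of _ _ _ "{0<..}"]) (use greater in auto)
  then show ?thesis using greater by simp
next
  case equal
  have "((\<lambda>h :: real. ((max 0 (0 + h)) ^ Suc (Suc m) - (max 0 0) ^ Suc (Suc m)) / h) \<longlongrightarrow> 0) (at 0)"
  proof (rule Lim_null_comparison)
    show "((\<lambda>h :: real. \<bar>h\<bar> ^ Suc m) \<longlongrightarrow> 0) (at 0)" by (auto intro!: tendsto_eq_intros)
    have "norm (((max 0 (0 + h)) ^ Suc (Suc m) - (max 0 0) ^ Suc (Suc m)) / h) \<le> \<bar>h\<bar> ^ Suc m" for h :: real
    proof (cases "h > 0")
      case False
      then have "max 0 (0 + h) = 0" by simp
      then show ?thesis by (simp del: power_Suc add: power_0_Suc)
    qed simp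
    then show "\<forall>\<^sub>F h :: real in at 0. norm (((max 0 (0 + h)) ^ Suc (Suc m) - (max 0 0) ^ Suc (Suc m)) / h) \<le> \<bar>h\<bar> ^ Suc m"
      by (rule always_eventually[OF allI])
  qed
  then show ?thesis using equal by (simp add: DERIV_def)
qed

text \<open>The third power makes the cutoff twice continuously differentiable.\<close>

definition bump :: "real \<Rightarrow> real^'d \<Rightarrow> real" where
  "bump R x = (max 0 (1 - (x \<bullet> x) / R\<^sup>2)) ^ 3"

text \<open>\<open>bump1\<close> and \<open>bump2\<close> are the first and the second pure partial
  derivative of \<open>bump\<close> in direction \<open>j\<close>, written out by the chain and
  product rules.\<close>

definition bump1 :: "real \<Rightarrow> 'd \<Rightarrow> real^'d \<Rightarrow> real" where
  "bump1 R j x = 3 * (max 0 (1 - (x \<bullet> x) / R\<^sup>2))\<^sup>2 * (- (2 * x $ j / R\<^sup>2))"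

definition bump2 :: "real \<Rightarrow> 'd \<Rightarrow> real^'d \<Rightarrow> real" where
  "bump2 R j x = 6 * max 0 (1 - (x \<bullet> x) / R\<^sup>2) * (2 * x $ j / R\<^sup>2)\<^sup>2 - 6 * (max 0 (1 - (x \<bullet> x) / R\<^sup>2))\<^sup>2 / R\<^sup>2"

lemma DERIV_inner_line:
  "((\<lambda>t. 1 - ((x + t *\<^sub>R axis j 1) \<bullet> (x + t *\<^sub>R axis j 1)) / R\<^sup>2) has_real_derivative - (2 * (x :: real^'d) $ j / R\<^sup>2)) (at 0)"
proof -
  have "(x + t *\<^sub>R axis j 1) \<bullet> (x + t *\<^sub>R axis j 1) = x \<bullet> x + 2 * t * x $ j + t\<^sup>2" for t
    by (simp add: inner_add_left inner_add_right inner_axis inner_commute[of "axis j 1"] power2_eq_square algebra_simps)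
  then have "1 - ((x + t *\<^sub>R axis j 1) \<bullet> (x + t *\<^sub>R axis j 1)) / R\<^sup>2 =
      (1 - (x \<bullet> x) / R\<^sup>2) + t * (- (2 * x $ j / R\<^sup>2)) + t\<^sup>2 * (- (1 / R\<^sup>2))" for t
    by (simp add: add_divide_distrib)
  moreover have "((\<lambda>t. A + t * c + t\<^sup>2 * d) has_real_derivative c) (at 0)" for A c d :: real
    by (auto intro!: derivative_eq_intros)
  ultimately show ?thesis by (simp only:)
qed

lemma DERIV_bump: "((\<lambda>t. bump R (x + t *\<^sub>R axis j 1)) has_real_derivative bump1 R j x) (at 0)"
proof -
  have "((\<lambda>r. (max 0 r) ^ 3) has_real_derivative 3 * (max 0 r)\<^sup>2) (at r)" for r :: real
    using DERIV_max0_power[of 1 r] by (simp add: numeral_eq_Suc)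
  from DERIV_chain2[OF this DERIV_inner_line] show ?thesis by (simp add: bump_def bump1_def)
qed

lemma DERIV_bump1: "((\<lambda>t. bump1 R j (x + t *\<^sub>R axis j 1)) has_real_derivative bump2 R j x) (at 0)"
proof -
  have "((\<lambda>r. (max 0 r) ^ 2) has_real_derivative 2 * (max 0 r)) (at r)" for r :: real
    using DERIV_max0_power[of 0 r] by (simp add: numeral_eq_Suc)
  from DERIV_chain2[OF this DERIV_inner_line]
  have "((\<lambda>t. (max 0 (1 - ((x + t *\<^sub>R axis j 1) \<bullet> (x + t *\<^sub>R axis j 1)) / R\<^sup>2))\<^sup>2) has_real_derivative
      2 * max 0 (1 - (x \<bullet> x) / R\<^sup>2) * (- (2 * x $ j / R\<^sup>2))) (at 0)" by simp
  moreover have "((\<lambda>t. - (2 * (x + t *\<^sub>R axis j 1) $ j / R\<^sup>2)) has_real_derivative - (2 / R\<^sup>2)) (at 0)"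
  proof -
    have "- (2 * (x + t *\<^sub>R axis j 1) $ j / R\<^sup>2) = - (2 * x $ j / R\<^sup>2) + t * (- (2 / R\<^sup>2))" for t
      by (simp add: axis_def add_divide_distrib distrib_left)
    moreover have "((\<lambda>t. A + t * c) has_real_derivative c) (at 0)" for A c :: real
      by (auto intro!: derivative_eq_intros)
    ultimately show ?thesis by (simp only:)
  qed
  ultimately have "((\<lambda>t. (max 0 (1 - ((x + t *\<^sub>R axis j 1) \<bullet> (x + t *\<^sub>R axis j 1)) / R\<^sup>2))\<^sup>2 * (- (2 * (x + t *\<^sub>R axis j 1) $ j / R\<^sup>2)))
      has_real_derivative
      (2 * max 0 (1 - (x \<bullet> x) / R\<^sup>2) * (- (2 * x $ j / R\<^sup>2))) * (- (2 * x $ j / R\<^sup>2))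
      + (- (2 / R\<^sup>2)) * (max 0 (1 - (x \<bullet> x) / R\<^sup>2))\<^sup>2) (at 0)"
    using DERIV_mult by fastforce
  from DERIV_cmult[OF this, of 3] show ?thesis
    unfolding bump1_def bump2_def mult.assoc[of 3] by (rule DERIV_cong) (simp add: power2_eq_square algebra_simps)
qed

lemma bump_meas [measurable]:
  "bump R \<in> borel_measurable borel" "bump1 R j \<in> borel_measurable borel" "bump2 R j \<in> borel_measurable borel"
  unfolding bump_def bump1_def bump2_def divide_inverse
  by (intro borel_measurable_continuous_onI continuous_intros)+

lemma bump_cut:
  assumes R: "0 < R"
  shows "0 \<le> max 0 (1 - (x \<bullet> x) / R\<^sup>2)" "max 0 (1 - (x \<bullet> x) / R\<^sup>2) \<le> 1"
    "R \<le> norm x \<Longrightarrow> max 0 (1 - (x \<bullet> x) / R\<^sup>2) = 0"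
proof -
  show "R \<le> norm x \<Longrightarrow> max 0 (1 - (x \<bullet> x) / R\<^sup>2) = 0"
    using R power_mono[of R "norm x" 2] by (simp add: power2_norm_eq_inner divide_simps)
qed (simp_all add: R)

lemma bump_support:
  assumes "0 < R" "R \<le> norm x"
  shows "bump R x = 0" "bump1 R j x = 0" "bump2 R j x = 0"
  unfolding bump_def bump1_def bump2_def bump_cut(3)[OF assms] by simp_all

lemma bump_bound: "0 < R \<Longrightarrow> 0 \<le> bump R x" "0 < R \<Longrightarrow> bump R x \<le> 1"
  unfolding bump_def using bump_cut(1,2)[of R x] by (auto intro: power_le_one)

lemma bump1_bound:
  assumes R: "0 < R" shows "\<bar>bump1 R j x\<bar> \<le> 6 / R"
proof (cases "R \<le> norm x")
  case True then show ?thesis using bump_support[OF R True] R by simp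
next
  case False
  let ?m = "max 0 (1 - (x \<bullet> x) / R\<^sup>2)"
  have "\<bar>x $ j\<bar> \<le> R" using component_le_norm_cart[of x j] False by linarith
  then have 1: "\<bar>2 * x $ j / R\<^sup>2\<bar> \<le> 2 / R"
    using R by (simp add: abs_mult power2_eq_square divide_simps mult_right_mono)
  have 2: "?m\<^sup>2 \<le> 1" using bump_cut[OF R, of x] by (intro power_le_one)
  have "\<bar>bump1 R j x\<bar> = 3 * (?m\<^sup>2 * \<bar>2 * x $ j / R\<^sup>2\<bar>)"
    unfolding bump1_def by (simp only: abs_mult abs_minus_cancel power_abs[symmetric] abs_of_nonneg[OF bump_cut(1)[OF R]]) simp
  also have "\<dots> \<le> 3 * (1 * (2 / R))"
    using 1 2 by (intro mult_left_mono mult_mono) auto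
  finally show ?thesis by simp
qed

text \<open>On the support \<open>\<bar>x $ j\<bar> \<le> R\<close>, so the first term is at most
  \<open>6 * 4 / R\<^sup>2\<close> and the second at most \<open>6 / R\<^sup>2\<close>.\<close>

lemma bump2_bound:
  assumes R: "0 < R" shows "\<bar>bump2 R j x\<bar> \<le> 30 / R\<^sup>2"
proof (cases "R \<le> norm x")
  case True then show ?thesis using bump_support[OF R True] R by simp
next
  case False
  let ?m = "max 0 (1 - (x \<bullet> x) / R\<^sup>2)"
  have m: "0 \<le> ?m" "?m \<le> 1" using bump_cut[OF R, of x] by auto
  have "\<bar>x $ j\<bar> \<le> R" using component_le_norm_cart[of x j] False by linarith
  then have 1: "\<bar>2 * x $ j / R\<^sup>2\<bar> \<le> 2 / R"
    using R by (simp add: abs_mult power2_eq_square divide_simps mult_right_mono)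
  then have "(2 * x $ j / R\<^sup>2)\<^sup>2 \<le> (2 / R)\<^sup>2" using R by (intro abs_le_square_iff[THEN iffD1]) simp
  then have 3: "(2 * x $ j / R\<^sup>2)\<^sup>2 \<le> 4 / R\<^sup>2" by (simp add: power_divide)
  have "?m * (2 * x $ j / R\<^sup>2)\<^sup>2 \<le> 1 * (4 / R\<^sup>2)" using 3 m by (intro mult_mono) auto
  moreover have "0 \<le> ?m * (2 * x $ j / R\<^sup>2)\<^sup>2" using m by simp
  moreover have "?m\<^sup>2 / R\<^sup>2 \<le> 1 / R\<^sup>2" using m by (intro divide_right_mono power_le_one) auto
  moreover have "0 \<le> ?m\<^sup>2 / R\<^sup>2" by simp
  moreover have "bump2 R j x = 6 * (?m * (2 * x $ j / R\<^sup>2)\<^sup>2) - 6 * (?m\<^sup>2 / R\<^sup>2)" by (simp add: bump2_def)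
  moreover have "4 / R\<^sup>2 = 4 * (1 / R\<^sup>2)" "30 / R\<^sup>2 = 30 * (1 / R\<^sup>2)" "0 \<le> 1 / R\<^sup>2" by simp_all
  ultimately show ?thesis unfolding abs_le_iff by linarith
qed

abbreviation (input) cfun :: "('a \<Rightarrow> real) \<Rightarrow> 'a \<Rightarrow> complex" where
  "cfun f \<equiv> (\<lambda>x. complex_of_real (f x))"

lemma bump_bdd_meas:
  assumes "0 < R"
  shows "bdd_meas (cfun (bump R))" "bdd_meas (cfun (bump1 R j))" "bdd_meas (cfun (bump2 R j))"
proof -
  have "\<bar>bump R x\<bar> \<le> 1" for x :: "real^'d" using bump_bound[OF assms, of x] by simp
  then show "bdd_meas (cfun (bump R :: real^'d \<Rightarrow> real))" by (auto simp: bdd_meas_def)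
  show "bdd_meas (cfun (bump1 R j))" "bdd_meas (cfun (bump2 R j))"
    using bump1_bound[OF assms, of j] bump2_bound[OF assms, of j] by (auto simp: bdd_meas_def)
qed

text \<open>Integration by parts: the directional derivative of the product of \<open>f\<close> with
  the wave integrates to zero, and differentiating the wave produces the factor
  \<open>2 * pi * \<i> * k $ j\<close>.\<close>

lemma ibp_wave:
  fixes f f' :: "real^'d \<Rightarrow> real"
  assumes [measurable]: "f \<in> borel_measurable borel" "f' \<in> borel_measurable borel"
    and deriv: "\<And>x. ((\<lambda>t. f (x + t *\<^sub>R axis j 1)) has_real_derivative f' x) (at 0)"
    and supp: "\<And>x. \<rho> \<le> norm x \<Longrightarrow> f x = 0" "\<And>x. \<rho> \<le> norm x \<Longrightarrow> f' x = 0"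
    and B: "\<And>x. \<bar>f x\<bar> \<le> B" "\<And>x. \<bar>f' x\<bar> \<le> B'"
  shows "(LINT x|lborel. cfun f' x * wave k x) = - (2 * pi * \<i> * k $ j) * (LINT x|lborel. cfun f x * wave k x)"
proof -
  have w: "((\<lambda>t. wave k (x + t *\<^sub>R axis j 1)) has_vector_derivative (2 * pi * \<i> * k $ j) * wave k x) (at 0)" for x
  proof -
    have "((\<lambda>t. cis (2 * pi * k $ j * t)) has_vector_derivative (2 * pi * \<i> * k $ j)) (at 0)"
    proof -
      have "((\<lambda>z. exp (\<i> * (complex_of_real (2 * pi * k $ j) * z))) has_field_derivative 2 * pi * \<i> * k $ j) (at (of_real 0))"
        by (auto intro!: derivative_eq_intros)
      from has_vector_derivative_real_field[OF this] show ?thesis by (simp add: cis_conv_exp)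
    qed
    then have "((\<lambda>t. cis (2 * pi * k $ j * t) * wave k x) has_vector_derivative (2 * pi * \<i> * k $ j) * wave k x) (at 0)"
      by (rule has_vector_derivative_mult_left)
    then show ?thesis by (simp add: wave_translate)
  qed
  have int: "integrable lborel (\<lambda>x. cfun g x * wave k x)"
    if [measurable]: "g \<in> borel_measurable borel" and g: "\<And>x. \<rho> \<le> norm x \<Longrightarrow> g x = 0" and D: "\<And>x. \<bar>g x\<bar> \<le> D" for g :: "real^'d \<Rightarrow> real" and D
  proof (rule Bochner_Integration.integrable_bound)
    show "integrable lborel (\<lambda>x :: real^'d. D * indicator (cball 0 \<rho>) x)"
      by (intro integrable_mult_right integrable_real_indicator emeasure_bounded_finite) auto
    have "0 \<le> D" using order_trans[OF abs_ge_zero D] by blast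
    then show "AE x in lborel. norm (cfun g x * wave k x) \<le> norm (D * indicator (cball 0 \<rho>) x)"
      using D g by (intro AE_I2) (auto simp: indicator_def norm_mult)
  qed measurable
  have "(LINT x|lborel. cfun f' x * wave k x + (2 * pi * \<i> * k $ j) * (cfun f x * wave k x)) = 0"
  proof (rule integral_directional_derivative_zero[where G = "\<lambda>x. cfun f x * wave k x" and e = "axis j 1" and \<rho> = \<rho> and C = B
       and B = "B' + cmod (2 * pi * \<i> * k $ j) * B"])
    fix x
    have f: "((\<lambda>t. cfun f (x + t *\<^sub>R axis j 1)) has_vector_derivative cfun f' x) (at 0)"
      using deriv[of x] by (intro has_vector_derivative_of_real) (simp add: has_real_derivative_iff_has_vector_derivative)
    show "((\<lambda>t. cfun f (x + t *\<^sub>R axis j 1) * wave k (x + t *\<^sub>R axis j 1)) has_vector_derivative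
        cfun f' x * wave k x + (2 * pi * \<i> * k $ j) * (cfun f x * wave k x)) (at 0)"
      using has_vector_derivative_mult[OF f w] by (simp add: algebra_simps)
    show "cmod (cfun f x * wave k x) \<le> B" using B(1) by (simp add: norm_mult)
    have "cmod ((2 * pi * \<i> * k $ j) * (cfun f x * wave k x)) \<le> cmod (2 * pi * \<i> * k $ j) * B"
      unfolding norm_mult[of "2 * pi * \<i> * k $ j"] using B(1) by (intro mult_left_mono) (auto simp: norm_mult)
    moreover have "cmod (cfun f' x * wave k x) \<le> B'" using B(2) by (simp add: norm_mult)
    ultimately show "cmod (cfun f' x * wave k x + (2 * pi * \<i> * k $ j) * (cfun f x * wave k x)) \<le> B' + cmod (2 * pi * \<i> * k $ j) * B"
      using norm_triangle_ineq[of "cfun f' x * wave k x" "(2 * pi * \<i> * k $ j) * (cfun f x * wave k x)"] by linarith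
  qed (use supp in auto)
  moreover have "(LINT x|lborel. cfun f' x * wave k x + (2 * pi * \<i> * k $ j) * (cfun f x * wave k x)) =
      (LINT x|lborel. cfun f' x * wave k x) + (2 * pi * \<i> * k $ j) * (LINT x|lborel. cfun f x * wave k x)"
  proof -
    have "integrable lborel (\<lambda>x. cfun f' x * wave k x)" by (rule int[OF _ supp(2) B(2)]) measurable
    moreover have "integrable lborel (\<lambda>x. cfun f x * wave k x)" by (rule int[OF _ supp(1) B(1)]) measurable
    then have "integrable lborel (\<lambda>x. (2 * pi * \<i> * k $ j) * (cfun f x * wave k x))" by (rule integrable_mult_right)
    ultimately show ?thesis by (simp only: Bochner_Integration.integral_add integral_mult_right_zero)
  qed
  ultimately show ?thesis by (simp add: eq_neg_iff_add_eq_0)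
qed

lemma bump_fourier:
  fixes k :: "real^'d"
  assumes R: "0 < R"
  shows "(LINT x|lborel. cfun (bump1 R j) x * wave k x) = - (2 * pi * \<i> * k $ j) * (LINT x|lborel. cfun (bump R) x * wave k x)"
    "(LINT x|lborel. cfun (bump2 R j) x * wave k x) = - (4 * pi\<^sup>2 * (k $ j)\<^sup>2) * (LINT x|lborel. cfun (bump R) x * wave k x)"
proof -
  have b: "\<bar>bump R x\<bar> \<le> 1" for x :: "real^'d" using bump_bound[OF R, of x] by simp
  show 1: "(LINT x|lborel. cfun (bump1 R j) x * wave k x) = - (2 * pi * \<i> * k $ j) * (LINT x|lborel. cfun (bump R) x * wave k x)"
    by (rule ibp_wave[OF _ _ DERIV_bump bump_support(1)[OF R] bump_support(2)[OF R] b bump1_bound[OF R]]) measurable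
  have "(LINT x|lborel. cfun (bump2 R j) x * wave k x) = - (2 * pi * \<i> * k $ j) * (LINT x|lborel. cfun (bump1 R j) x * wave k x)"
    by (rule ibp_wave[OF _ _ DERIV_bump1 bump_support(2)[OF R] bump_support(3)[OF R] bump1_bound[OF R] bump2_bound[OF R]]) measurable
  then show "(LINT x|lborel. cfun (bump2 R j) x * wave k x) = - (4 * pi\<^sup>2 * (k $ j)\<^sup>2) * (LINT x|lborel. cfun (bump R) x * wave k x)"
    unfolding 1 by (simp add: power2_eq_square)
qed

section \<open>Comparison of the resolvents for two periods\<close>

lemma ball_subset_box_L:
  assumes "norm (x :: real^'d) < R" "R \<le> L / 2"
  shows "x \<in> box_L L"
proof -
  have "- L / 2 \<le> x $ i \<and> x $ i < L / 2" for i
    using component_le_norm_cart[of x i] assms by linarith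
  then show ?thesis by (simp add: box_L_def)
qed

lemma mult_L2_supported:
  fixes m :: "real^'d \<Rightarrow> complex"
  assumes m: "bdd_meas m" and supp: "\<And>x. R \<le> norm x \<Longrightarrow> m x = 0" and R: "R \<le> L / 2"
  shows "mult_L2 m f \<in> H_box L" "mult_L2 m (mult_L2 (indicator (box_L L)) f) = mult_L2 m f"
proof -
  have "(\<lambda>x. m x * indicator (box_L L) x) = m"
  proof
    fix x show "m x * indicator (box_L L) x = m x"
      using ball_subset_box_L[of x R L] supp[of x] R by (cases "norm x < R") (auto simp: indicator_def)
  qed
  then show 1: "mult_L2 m (mult_L2 (indicator (box_L L)) f) = mult_L2 m f"
    by (simp add: mult_L2_mult_L2 m)
  then show "mult_L2 m f \<in> H_box L"
    by (simp add: H_box_def mult_L2_commute[OF bdd_meas_box m])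
qed

text \<open>As the support of \<open>f\<close> lies in both boxes, their indicators disappear and
  what remains is a Fourier integral over the whole space at \<open>p - q\<close>. It makes sense
  although \<open>p\<close> and \<open>q\<close> may come from unrelated lattices.\<close>

lemma cinner_E_mult_E:
  fixes f :: "real^'d \<Rightarrow> real"
  assumes m: "bdd_meas (cfun f)" and supp: "\<And>x. R \<le> norm x \<Longrightarrow> f x = 0" and R: "R \<le> L / 2" "R \<le> L' / 2"
  shows "cinner (E_box L' q) (mult_L2 (cfun f) (E_box L p)) =
    complex_of_real (1 / sqrt (vol L' TYPE('d))) * complex_of_real (1 / sqrt (vol L TYPE('d))) *
      (LINT x|lborel. cfun f x * wave (p - q) x)"
proof -
  let ?c' = "complex_of_real (1 / sqrt (vol L' TYPE('d)))" and ?c = "complex_of_real (1 / sqrt (vol L TYPE('d)))"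
  note l2 = L2_on_l2_fun[OF L2_on_wave]
  have "cinner (E_box L' q) (mult_L2 (cfun f) (E_box L p)) =
     (LINT x|lborel. cnj (indicator (box_L L') x * (?c' * wave q x)) * (cfun f x * (indicator (box_L L) x * (?c * wave p x))))"
    unfolding E_box_def mult_abs_L2[OF m l2] by (rule cinner_abs_L2[OF l2 l2_fun_bdd_meas[OF m l2]])
  also have "\<dots> = (LINT x|lborel. (?c' * ?c) * (cfun f x * wave (p - q) x))"
  proof (intro Bochner_Integration.integral_cong refl)
    fix x
    show "cnj (indicator (box_L L') x * (?c' * wave q x)) * (cfun f x * (indicator (box_L L) x * (?c * wave p x)))
        = (?c' * ?c) * (cfun f x * wave (p - q) x)"
    proof (cases "norm x < R")
      case True
      then have "x \<in> box_L L" "x \<in> box_L L'" using ball_subset_box_L R by blast+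
      moreover have "wave (p - q) x = wave (- q) x * wave p x" by (simp add: wave_mult)
      ultimately show ?thesis by (simp add: wave_cnj mult_ac)
    qed (simp add: supp)
  qed
  also have "\<dots> = ?c' * ?c * (LINT x|lborel. cfun f x * wave (p - q) x)" by (rule integral_mult_right_zero)
  finally show ?thesis .
qed

lemma has_sum_sum:
  fixes f :: "'j \<Rightarrow> 'i \<Rightarrow> 'b::topological_comm_monoid_add"
  assumes "\<And>j. j \<in> J \<Longrightarrow> (f j has_sum s j) I"
  shows "((\<lambda>i. \<Sum>j\<in>J. f j i) has_sum (\<Sum>j\<in>J. s j)) I"
  using assms by (induction J rule: infinite_finite_induct) (auto intro: has_sum_add)

text \<open>The Leibniz rule \<open>- \<Delta> (\<chi> u) = - \<chi> \<Delta> u - 2 \<nabla>\<chi> \<cdot> \<nabla>u - (\<Delta>\<chi>) u\<close>; because the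
  support of \<open>\<chi>\<close> fits into both boxes, it moves an element of the domain for period \<open>L\<close> to the domain
  for period \<open>L'\<close>. It is checked on each plane wave and extended by summing the Fourier series of \<open>u\<close>.\<close>

lemma cutoff_T_box:
  fixes u g :: "(real^'d) L2" and w :: "'d \<Rightarrow> (real^'d) L2"
  assumes L: "0 < L" and R: "0 < R" "R \<le> L / 2" "R \<le> L' / 2" and T: "(u, g) \<in> T_box L"
    and w: "\<And>j. w j \<in> H_box L"
      "\<And>j p. p \<in> dual_lattice L \<Longrightarrow> cinner (E_box L p) (w j) = 2 * pi * \<i> * p $ j * cinner (E_box L p) u"
  shows "(mult_L2 (cfun (bump R)) u,
     mult_L2 (cfun (bump R)) g - (2 *\<^sub>C (\<Sum>j\<in>UNIV. mult_L2 (cfun (bump1 R j)) (w j)) + (\<Sum>j\<in>UNIV. mult_L2 (cfun (bump2 R j)) u)))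
     \<in> T_box L'"
proof -
  interpret onb "E_box L" "dual_lattice L" "H_box L :: (real^'d) L2 set" by (rule onb_box[OF L])
  interpret onb': onb "E_box L'" "dual_lattice L'" "H_box L' :: (real^'d) L2 set"
    using R by (intro onb_box) simp
  note bdd = bump_bdd_meas[OF R(1)]
  have supp: "R \<le> norm x \<Longrightarrow> cfun (bump R) x = 0" "R \<le> norm x \<Longrightarrow> cfun (bump1 R j) x = 0"
     "R \<le> norm x \<Longrightarrow> cfun (bump2 R j) x = 0" for x :: "real^'d" and j
    using bump_support[OF R(1)] by simp_all
  have ug: "u \<in> H_box L" "g \<in> H_box L"
    and g: "\<And>p. p \<in> dual_lattice L \<Longrightarrow> cinner (E_box L p) g = of_real ((2 * pi * norm p)\<^sup>2) * cinner (E_box L p) u"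
    using T by (auto simp: T_box_def)
  let ?h = "mult_L2 (cfun (bump R)) g - (2 *\<^sub>C (\<Sum>j\<in>UNIV. mult_L2 (cfun (bump1 R j)) (w j)) + (\<Sum>j\<in>UNIV. mult_L2 (cfun (bump2 R j)) u))"
  have H: "mult_L2 (cfun (bump R)) u \<in> H_box L'" "?h \<in> H_box L'"
    by (intro onb'.H_diff onb'.H_add onb'.H_scaleC onb'.H_sum mult_L2_supported(1)[OF bdd(1) supp(1) R(3)]
      mult_L2_supported(1)[OF bdd(2) supp(2) R(3)] mult_L2_supported(1)[OF bdd(3) supp(3) R(3)]; assumption)+
  have "cinner (E_box L' q) ?h = of_real ((2 * pi * norm q)\<^sup>2) * cinner (E_box L' q) (mult_L2 (cfun (bump R)) u)" for q :: "real^'d"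
  proof -
    \<comment> \<open>Matrix elements of a multiplier between plane waves of the two periods.
      Expanding \<open>f\<close> in the waves of period \<open>L\<close> expresses the coefficient
      of its product with \<open>m\<close> at \<open>q\<close> as the unordered sum in
      \<open>hs\<close>.\<close>
    let ?J = "\<lambda>m p. cinner (E_box L' q) (mult_L2 m (E_box L p))"
    have hs: "((\<lambda>p. cinner (E_box L p) f * ?J m p) has_sum cinner (E_box L' q) (mult_L2 m f)) (dual_lattice L)"
      if "f \<in> H_box L" "bdd_meas m" for f m
    proof -
      have "bounded_linear (\<lambda>f. cinner (E_box L' q) (mult_L2 m f))"
        by (rule bounded_linear_compose[OF bounded_linear_cinner bounded_linear_mult_L2[OF that(2)]])
      from has_sum_bounded_linear[OF this expansion[OF that(1)]]
      show ?thesis by (simp add: o_def mult_L2_scaleC that(2) cinner_scaleC_right)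
    qed
    let ?F = "\<lambda>p. cinner (E_box L p) g * ?J (cfun (bump R)) p
        + ((- 2) * (\<Sum>j\<in>UNIV. cinner (E_box L p) (w j) * ?J (cfun (bump1 R j)) p)
        + (- 1) * (\<Sum>j\<in>UNIV. cinner (E_box L p) u * ?J (cfun (bump2 R j)) p))"
    have 1: "(?F has_sum cinner (E_box L' q) (mult_L2 (cfun (bump R)) g)
        + ((- 2) * (\<Sum>j\<in>UNIV. cinner (E_box L' q) (mult_L2 (cfun (bump1 R j)) (w j)))
        + (- 1) * (\<Sum>j\<in>UNIV. cinner (E_box L' q) (mult_L2 (cfun (bump2 R j)) u)))) (dual_lattice L)"
      by (intro has_sum_add has_sum_cmult_right has_sum_sum hs ug w(1) bdd)
    have 2: "((\<lambda>p. of_real ((2 * pi * norm q)\<^sup>2) * (cinner (E_box L p) u * ?J (cfun (bump R)) p)) has_sum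
        of_real ((2 * pi * norm q)\<^sup>2) * cinner (E_box L' q) (mult_L2 (cfun (bump R)) u)) (dual_lattice L)"
      by (intro has_sum_cmult_right hs ug bdd)
    have F: "?F p = of_real ((2 * pi * norm q)\<^sup>2) * (cinner (E_box L p) u * ?J (cfun (bump R)) p)"
      if p: "p \<in> dual_lattice L" for p
    proof -
      let ?k = "p - q" and ?c = "cinner (E_box L p) u" and ?Z = "?J (cfun (bump R)) p"
      have J0: "?Z = complex_of_real (1 / sqrt (vol L' TYPE('d))) * complex_of_real (1 / sqrt (vol L TYPE('d))) *
          (LINT x|lborel. cfun (bump R) x * wave ?k x)"
        by (rule cinner_E_mult_E[OF bdd(1) _ R(2,3)]) (rule bump_support(1)[OF R(1)])
      have J1: "?J (cfun (bump1 R j)) p = - (2 * pi * \<i> * ?k $ j) * ?Z" for j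
      proof -
        have "?J (cfun (bump1 R j)) p = complex_of_real (1 / sqrt (vol L' TYPE('d))) * complex_of_real (1 / sqrt (vol L TYPE('d))) *
            (LINT x|lborel. cfun (bump1 R j) x * wave ?k x)"
          by (rule cinner_E_mult_E[OF bdd(2) _ R(2,3)]) (rule bump_support(2)[OF R(1)])
        then show ?thesis unfolding J0 bump_fourier(1)[OF R(1)] by (simp only: mult_ac)
      qed
      have J2: "?J (cfun (bump2 R j)) p = - (4 * pi\<^sup>2 * (?k $ j)\<^sup>2) * ?Z" for j
      proof -
        have "?J (cfun (bump2 R j)) p = complex_of_real (1 / sqrt (vol L' TYPE('d))) * complex_of_real (1 / sqrt (vol L TYPE('d))) *
            (LINT x|lborel. cfun (bump2 R j) x * wave ?k x)"
          by (rule cinner_E_mult_E[OF bdd(3) _ R(2,3)]) (rule bump_support(3)[OF R(1)])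
        then show ?thesis unfolding J0 bump_fourier(2)[OF R(1)] by (simp only: mult_ac)
      qed
      have inner_sum: "(\<Sum>j\<in>UNIV. c * (complex_of_real (x $ j * y $ j) * d)) = c * (of_real (x \<bullet> y) * d)"
        for c d and x y :: "real^'d"
      proof -
        have "complex_of_real (x \<bullet> y) = (\<Sum>j\<in>UNIV. complex_of_real (x $ j * y $ j))"
          by (simp add: inner_vec_def)
        then show ?thesis by (simp only: sum_distrib_left sum_distrib_right)
      qed
      have s1: "(\<Sum>j\<in>UNIV. cinner (E_box L p) (w j) * ?J (cfun (bump1 R j)) p) = of_real (4 * pi\<^sup>2) * (of_real (p \<bullet> ?k) * (?c * ?Z))"
      proof -
        have "cinner (E_box L p) (w j) * ?J (cfun (bump1 R j)) p = of_real (4 * pi\<^sup>2) * (of_real (p $ j * ?k $ j) * (?c * ?Z))" for j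
        proof -
          have "(2 * P * \<iota> * a * c) * (- (2 * P * \<iota> * b) * d) = (\<iota> * \<iota>) * (- (4 * (P * P)) * ((a * b) * (c * d)))"
            for P \<iota> a b c d :: complex by algebra
          from this[of "complex_of_real pi" \<i> "complex_of_real (p $ j)" ?c "complex_of_real (?k $ j)" ?Z]
          show ?thesis unfolding w(2)[OF p] J1 by (simp add: power2_eq_square)
        qed
        then show ?thesis by (simp only: inner_sum)
      qed
      have s2: "(\<Sum>j\<in>UNIV. ?c * ?J (cfun (bump2 R j)) p) = - of_real (4 * pi\<^sup>2) * (of_real (?k \<bullet> ?k) * (?c * ?Z))"
      proof -
        have "?c * ?J (cfun (bump2 R j)) p = - of_real (4 * pi\<^sup>2) * (of_real (?k $ j * ?k $ j) * (?c * ?Z))" for j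
          unfolding J2 by (simp add: power2_eq_square mult_ac)
        then show ?thesis by (simp only: inner_sum)
      qed
      \<comment> \<open>The product rule on the Fourier side: with \<open>k = p - q\<close>, the
        terms for \<open>\<chi> \<Delta>u\<close>, \<open>\<nabla>\<chi> \<cdot> \<nabla>u\<close>
        and \<open>(\<Delta>\<chi>) u\<close> combine to the square of
        \<open>p - k = q\<close>.\<close>
      have "(2 * pi * norm p)\<^sup>2 - 2 * (4 * pi\<^sup>2 * (p \<bullet> ?k)) + 4 * pi\<^sup>2 * (?k \<bullet> ?k) = (2 * pi * norm q)\<^sup>2"
        by (simp add: power_mult_distrib power2_norm_eq_inner inner_diff_left inner_diff_right inner_commute algebra_simps)
      then have "of_real ((2 * pi * norm q)\<^sup>2) * (?c * ?Z) =
          of_real ((2 * pi * norm p)\<^sup>2 - 2 * (4 * pi\<^sup>2 * (p \<bullet> ?k)) + 4 * pi\<^sup>2 * (?k \<bullet> ?k)) * (?c * ?Z)" by (simp only:)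
      also have "\<dots> = ?F p"
        unfolding s1 s2 g[OF p] of_real_add of_real_diff of_real_mult by (simp add: algebra_simps)
      finally show ?thesis by simp
    qed
    have "(?F has_sum of_real ((2 * pi * norm q)\<^sup>2) * cinner (E_box L' q) (mult_L2 (cfun (bump R)) u)) (dual_lattice L)"
      by (rule has_sum_cong[THEN iffD2, OF F 2])
    from has_sum_unique[OF 1 this] show ?thesis
      by (simp add: cinner_diff_right cinner_add_right cinner_scaleC_right cinner_sum_right algebra_simps)
  qed
  then show ?thesis using H by (simp add: T_box_def)
qed

text \<open>\<open>w\<close> is the weak derivative of \<open>u\<close> in direction
  \<open>j\<close>, constructed from its Fourier coefficients. By Parseval
  \<open>Re (cinner u g)\<close> is the sum of \<open>(2 * pi * norm p)\<^sup>2\<close> times the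
  squared coefficients of \<open>u\<close>, which dominates the same sum with \<open>p $ j\<close>
  in place of \<open>norm p\<close>.\<close>

lemma T_box_gradient:
  fixes u g :: "(real^'d) L2"
  assumes L: "0 < L" and T: "(u, g) \<in> T_box L"
  obtains w :: "(real^'d) L2" where "w \<in> H_box L"
    "\<And>p. p \<in> dual_lattice L \<Longrightarrow> cinner (E_box L p) w = 2 * pi * \<i> * p $ j * cinner (E_box L p) u"
    "(norm w)\<^sup>2 \<le> Re (cinner u g)"
proof -
  interpret onb "E_box L" "dual_lattice L" "H_box L :: (real^'d) L2 set" by (rule onb_box[OF L])
  have ug: "u \<in> H_box L" "g \<in> H_box L"
    and g: "\<And>p. p \<in> dual_lattice L \<Longrightarrow> cinner (E_box L p) g = of_real ((2 * pi * norm p)\<^sup>2) * cinner (E_box L p) u"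
    using T by (auto simp: T_box_def)
  define a where "a p = 2 * pi * \<i> * p $ j * cinner (E_box L p) u" for p :: "real^'d"
  let ?e = "\<lambda>p. (2 * pi * norm p)\<^sup>2 * (cmod (cinner (E_box L p) u))\<^sup>2"
  have "((\<lambda>p. Re (cnj (cinner (E_box L p) u) * cinner (E_box L p) g)) has_sum Re (cinner u g)) (dual_lattice L)"
    by (rule has_sum_bounded_linear[OF bounded_linear_Re Parseval[OF ug(2)], unfolded o_def])
  moreover have "Re (cnj (cinner (E_box L p) u) * cinner (E_box L p) g) = ?e p" if "p \<in> dual_lattice L" for p
  proof -
    have "cnj c * (of_real r * c) = of_real (r * (cmod c)\<^sup>2)" for c and r :: real
    proof -
      have "cnj c * (of_real r * c) = of_real r * (c * cnj c)" by (simp only: mult_ac)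
      then show ?thesis by (simp only: complex_norm_square[symmetric] of_real_mult)
    qed
    then show ?thesis unfolding g[OF that] by (simp only: Re_complex_of_real)
  qed
  ultimately have e: "(?e has_sum Re (cinner u g)) (dual_lattice L)"
    using has_sum_cong[of "dual_lattice L" _ ?e] by (metis (no_types, lifting))
  have ae: "(cmod (a p))\<^sup>2 \<le> ?e p" for p
  proof -
    have "(2 * pi * \<bar>p $ j\<bar>)\<^sup>2 \<le> (2 * pi * norm p)\<^sup>2"
      by (intro power_mono mult_left_mono component_le_norm_cart) auto
    moreover have "(cmod (a p))\<^sup>2 = (2 * pi * \<bar>p $ j\<bar>)\<^sup>2 * (cmod (cinner (E_box L p) u))\<^sup>2"
      by (simp add: a_def norm_mult power_mult_distrib)
    ultimately show ?thesis by (simp add: mult_right_mono)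
  qed
  have "(\<lambda>p. (cmod (a p))\<^sup>2) summable_on dual_lattice L"
    by (rule summable_on_comparison_test[OF has_sum_imp_summable[OF e] ae]) simp
  then obtain w where w: "w \<in> H_box L" "\<And>p. p \<in> dual_lattice L \<Longrightarrow> cinner (E_box L p) w = a p"
    using Riesz_Fischer by metis
  have "((\<lambda>p. Re (cnj (cinner (E_box L p) w) * cinner (E_box L p) w)) has_sum Re (cinner w w)) (dual_lattice L)"
    by (rule has_sum_bounded_linear[OF bounded_linear_Re Parseval[OF w(1)], unfolded o_def])
  then have "Re (cinner w w) \<le> Re (cinner u g)"
  proof (rule has_sum_mono[OF _ e])
    fix p :: "real^'d" assume p: "p \<in> dual_lattice L"
    have "cnj (a p) * a p = of_real ((cmod (a p))\<^sup>2)" by (metis complex_norm_square mult.commute)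
    then show "Re (cnj (cinner (E_box L p) w) * cinner (E_box L p) w) \<le> ?e p"
      unfolding w(2)[OF p] using ae[of p] by (simp only: Re_complex_of_real)
  qed
  then show ?thesis using that w by (simp add: a_def cinner_self)
qed

text \<open>\<open>U\<close> bounds the solution \<open>u\<close> and \<open>S\<close> its gradient.
  The cut-off solution solves the equation for \<open>L'\<close> up to errors from truncating
  \<open>phi\<close>, from the difference of the potentials and from the two derivatives of the
  cutoff; \<open>resolvent_bound\<close> for \<open>L'\<close> turns them into a distance. The
  second \<open>t\<close> arises from replacing \<open>u\<close> by its cut-off in the form itself.
  The gradient is estimated for \<open>u\<close> alone, so the right-hand side depends neither on
  \<open>L'\<close> nor on \<open>M'\<close>, as a Cauchy criterion in \<open>L\<close>
  demands.\<close>

lemma resolvent_form_compare: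
  fixes V V' :: "real^'d \<Rightarrow> real" and phi :: "real^'d \<Rightarrow> complex"
  assumes "box_potential L V M" "box_potential L' V' M'"
    and R: "0 < R" "R \<le> L / 2" "R \<le> L' / 2" and z: "Im z \<noteq> 0" and phi: "l2_fun phi"
    and \<delta>: "0 \<le> \<delta>" "\<And>x. norm x < R \<Longrightarrow> \<bar>V x - V' x\<bar> \<le> \<delta>"
  defines "N \<equiv> norm (abs_L2 phi)" and "t \<equiv> norm (abs_L2 phi - mult_L2 (cfun (bump R)) (abs_L2 phi))"
  defines "U \<equiv> N / \<bar>Im z\<bar>"
  defines "S \<equiv> sqrt (U * (N + (cmod z + M) * U))"
  shows "cmod (resolvent_form L V z phi - resolvent_form L' V' z phi) \<le>
     U * (2 * t + \<delta> * U + 12 * CARD('d) / R * S + 30 * CARD('d) / R\<^sup>2 * U)"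
proof -
  interpret A: box_potential L V M by fact
  interpret B: box_potential L' V' M' by fact
  let ?P = "\<lambda>L. mult_L2 (indicator (box_L L :: (real^'d) set))"
  define \<Phi> where "\<Phi> = abs_L2 phi"
  define X where "X = mult_L2 (cfun (bump R :: real^'d \<Rightarrow> real))"
  note bdd = bump_bdd_meas[OF R(1)]
  have supp: "R \<le> norm x \<Longrightarrow> cfun (bump R) x = 0" for x :: "real^'d"
    using bump_support[OF R(1)] by simp
  have N: "0 \<le> N" and U: "0 \<le> U" and t0: "0 \<le> t" by (auto simp: N_def U_def t_def)
  have normP: "norm (?P L f) \<le> norm f" for L f
    using norm_mult_L2_le[OF bdd_meas_box, of L 1 f] by (simp add: indicator_def)
  have phiH: "res L phi \<in> H_box L" "res L' phi \<in> H_box L'" by (auto intro: res_H l2_fun_L2_on phi)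
  have res: "res L phi = ?P L \<Phi>" "res L' phi = ?P L' \<Phi>" by (simp_all add: res_l2_fun phi \<Phi>_def)
  define u where "u = A.R z (res L phi)"
  define u' where "u' = B.R z (res L' phi)"
  have uA: "(u, res L phi + z *\<^sub>C u) \<in> A_box L V" unfolding u_def by (rule A.R_A[OF z phiH(1)])
  have uA': "(u', res L' phi + z *\<^sub>C u') \<in> A_box L' V'" unfolding u'_def by (rule B.R_A[OF z phiH(2)])
  obtain g where T: "(u, g) \<in> T_box L" and g: "res L phi + z *\<^sub>C u = g + mult_L2 (pot L V) u"
    using uA by (auto simp: A_box_def)
  have uH: "u \<in> H_box L" "u' \<in> H_box L'" using uA uA' A.A_H B.A_H by blast+
  have uU: "norm u \<le> U"
  proof -
    have "norm u \<le> norm (res L phi) / \<bar>Im z\<bar>" unfolding u_def by (rule A.norm_R_le[OF z phiH(1)])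
    also have "\<dots> \<le> U" unfolding U_def N_def using normP[of L \<Phi>] by (intro divide_right_mono) (auto simp: res \<Phi>_def)
    finally show ?thesis .
  qed
  have gS: "Re (cinner u g) \<le> S\<^sup>2"
  proof -
    have geq: "g = res L phi + (z *\<^sub>C u - mult_L2 (pot L V) u)" using g by (simp add: algebra_simps)
    have Vu: "norm (mult_L2 (pot L V) u) \<le> M * norm u"
      by (rule norm_mult_L2_le) (simp_all add: A.pot_le)
    have "norm g \<le> norm (res L phi) + norm (z *\<^sub>C u - mult_L2 (pot L V) u)"
      unfolding geq by (rule norm_triangle_ineq)
    also have "\<dots> \<le> N + (cmod z * norm u + M * norm u)"
      using normP[of L \<Phi>] Vu norm_triangle_ineq4[of "z *\<^sub>C u" "mult_L2 (pot L V) u"] by (simp add: res N_def \<Phi>_def)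
    also have "\<dots> \<le> N + (cmod z + M) * U"
      using mult_left_mono[OF uU, of "cmod z + M"] A.M_nonneg by (simp add: distrib_right)
    finally have gN: "norm g \<le> N + (cmod z + M) * U" .
    have "Re (cinner u g) \<le> norm u * norm g"
      using complex_Re_le_cmod cinner_Cauchy_Schwarz order_trans by blast
    also have "\<dots> \<le> U * (N + (cmod z + M) * U)" using uU gN U by (intro mult_mono) auto
    also have "\<dots> = S\<^sup>2" unfolding S_def using U N A.M_nonneg by simp
    finally show ?thesis .
  qed
  have S0: "0 \<le> S" unfolding S_def using U N A.M_nonneg by simp
  have "\<exists>w. w \<in> H_box L \<and> (\<forall>p\<in>dual_lattice L. cinner (E_box L p) w = 2 * pi * \<i> * p $ j * cinner (E_box L p) u) \<and> norm w \<le> S" for j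
  proof -
    obtain w where w: "w \<in> H_box L" "\<And>p. p \<in> dual_lattice L \<Longrightarrow> cinner (E_box L p) w = 2 * pi * \<i> * p $ j * cinner (E_box L p) u"
      "(norm w)\<^sup>2 \<le> Re (cinner u g)" using T_box_gradient[OF A.L T, of j] by blast
    have "norm w \<le> S" by (rule power2_le_imp_le[OF order_trans[OF w(3) gS] S0])
    then show ?thesis using w by blast
  qed
  then obtain w where w: "\<And>j. w j \<in> H_box L"
      "\<And>j p. p \<in> dual_lattice L \<Longrightarrow> cinner (E_box L p) (w j) = 2 * pi * \<i> * p $ j * cinner (E_box L p) u"
      "\<And>j. norm (w j) \<le> S" by metis
  define v where "v = X u"
  define s1 where "s1 = (\<Sum>j\<in>UNIV. mult_L2 (cfun (bump1 R j)) (w j))"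
  define s2 where "s2 = (\<Sum>j\<in>UNIV. mult_L2 (cfun (bump2 R j)) u)"
  have "(v, X g - (2 *\<^sub>C s1 + s2)) \<in> T_box L'"
    unfolding v_def X_def s1_def s2_def by (rule cutoff_T_box[OF A.L R T w(1,2)])
  then have vA: "(v, X g - (2 *\<^sub>C s1 + s2) + mult_L2 (pot L' V') v) \<in> A_box L' V'" by (auto simp: A_box_def)
  \<comment> \<open>The mismatch of the potentials. The cutoff confines it to
    \<open>norm x < R\<close>, where the two differ by at most \<open>\<delta>\<close>.\<close>
  define e where "e = mult_L2 (pot L' V') v - X (mult_L2 (pot L V) u)"
  have Xlin: "X (f - h) = X f - X h" "X (f + h) = X f + X h" "X (c *\<^sub>C f) = c *\<^sub>C X f" for f h c
    unfolding X_def by (simp_all add: mult_L2_diff mult_L2_add mult_L2_scaleC bdd)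
  have Xres: "X (res L phi) = X \<Phi>"
    unfolding res X_def by (rule mult_L2_supported(2)[OF bdd(1) supp R(2)])
  have "X g = X \<Phi> + z *\<^sub>C v - X (mult_L2 (pot L V) u)"
  proof -
    have "g = res L phi + z *\<^sub>C u - mult_L2 (pot L V) u" using g by (simp add: algebra_simps)
    then show ?thesis by (simp add: Xlin Xres v_def)
  qed
  \<comment> \<open>Difference of the equations for \<open>v\<close> and for \<open>u'\<close> in
    the box of period \<open>L'\<close>; the right-hand side collects the errors estimated in
    \<open>n1\<close> to \<open>n4\<close>.\<close>
  then have eq: "(X g - (2 *\<^sub>C s1 + s2) + mult_L2 (pot L' V') v - (res L' phi + z *\<^sub>C u')) - z *\<^sub>C (v - u') =
      (X \<Phi> - res L' phi) + (e - (2 *\<^sub>C s1 + s2))"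
    by (simp add: e_def scaleC_diff_right algebra_simps)
  have n1: "norm (X \<Phi> - res L' phi) \<le> t"
  proof -
    have "?P L' (X \<Phi>) = X \<Phi>"
      using mult_L2_supported(1)[OF bdd(1) supp R(3), of \<Phi>] by (simp add: H_box_def X_def)
    then have "X \<Phi> - res L' phi = - ?P L' (\<Phi> - X \<Phi>)" by (simp add: res mult_L2_diff)
    then show ?thesis using normP[of L' "\<Phi> - X \<Phi>"] by (simp add: t_def \<Phi>_def X_def)
  qed
  have n2: "norm e \<le> \<delta> * U"
  proof -
    let ?m = "\<lambda>x. pot L' V' x * cfun (bump R) x + (-1) * (cfun (bump R) x * pot L V x)"
    have b: "bdd_meas (\<lambda>x. pot L' V' x * cfun (bump R) x)" "bdd_meas (\<lambda>x. cfun (bump R) x * pot L V x)"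
      "bdd_meas (\<lambda>x. (-1) * (cfun (bump R) x * pot L V x))"
      by (intro bdd_meas_mult bdd bdd_meas_const A.pot_bdd_meas B.pot_bdd_meas)+
    have "e = mult_L2 ?m u"
    proof -
      have "mult_L2 (\<lambda>x. (-1) * (cfun (bump R) x * pot L V x)) u = - mult_L2 (\<lambda>x. cfun (bump R) x * pot L V x) u"
        using mult_L2_mult_L2[OF bdd_meas_const[of "-1"] b(2), of u] by (simp add: mult_L2_const scaleC_minus_one)
      then show ?thesis
        unfolding mult_L2_plus_fun[OF b(1,3)] by (simp add: e_def v_def X_def mult_L2_mult_L2 bdd)
    qed
    moreover have "cmod (?m x) \<le> \<delta>" for x
    proof (cases "norm x < R")
      case True
      then have "x \<in> box_L L" "x \<in> box_L L'" using ball_subset_box_L R by blast+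
      then have "?m x = of_real (bump R x * (V' x - V x))" by (simp add: pot_def algebra_simps)
      then have "cmod (?m x) = bump R x * \<bar>V x - V' x\<bar>"
        using bump_bound(1)[OF R(1), of x] by (simp only: norm_of_real abs_mult abs_of_nonneg abs_minus_commute)
      also have "\<dots> \<le> 1 * \<delta>" using bump_bound[OF R(1), of x] \<delta>(2)[OF True] by (intro mult_mono) auto
      finally show ?thesis by simp
    qed (use supp \<delta>(1) in simp)
    ultimately have "norm e \<le> \<delta> * norm u" using norm_mult_L2_le[OF bdd_meas_add[OF b(1,3)]] by simp
    then show ?thesis using mult_left_mono[OF uU \<delta>(1)] by linarith
  qed
  have n3: "norm (2 *\<^sub>C s1) \<le> 12 * CARD('d) / R * S"
  proof -
    have "norm s1 \<le> (\<Sum>j\<in>(UNIV :: 'd set). 6 / R * S)"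
      unfolding s1_def
    proof (rule sum_norm_le)
      fix j
      have "norm (mult_L2 (cfun (bump1 R j)) (w j)) \<le> 6 / R * norm (w j)"
        by (rule norm_mult_L2_le[OF bdd(2)]) (simp add: bump1_bound R)
      also have "\<dots> \<le> 6 / R * S" using R w(3) by (intro mult_left_mono) auto
      finally show "norm (mult_L2 (cfun (bump1 R j)) (w j)) \<le> 6 / R * S" .
    qed
    then have "norm s1 \<le> CARD('d) * (6 / R * S)" by simp
    then have "2 * norm s1 \<le> 2 * (CARD('d) * (6 / R * S))" by linarith
    also have "\<dots> = 12 * CARD('d) / R * S" by simp
    finally show ?thesis by simp
  qed
  have n4: "norm s2 \<le> 30 * CARD('d) / R\<^sup>2 * U"
  proof -
    have "norm s2 \<le> (\<Sum>j\<in>(UNIV :: 'd set). 30 / R\<^sup>2 * U)"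
      unfolding s2_def
    proof (rule sum_norm_le)
      fix j
      have "norm (mult_L2 (cfun (bump2 R j)) u) \<le> 30 / R\<^sup>2 * norm u"
        by (rule norm_mult_L2_le[OF bdd(3)]) (simp add: bump2_bound R)
      also have "\<dots> \<le> 30 / R\<^sup>2 * U" using uU by (intro mult_left_mono) auto
      finally show "norm (mult_L2 (cfun (bump2 R j)) u) \<le> 30 / R\<^sup>2 * U" .
    qed
    then show ?thesis by (simp add: mult_ac)
  qed
  define D where "D = t + \<delta> * U + 12 * CARD('d) / R * S + 30 * CARD('d) / R\<^sup>2 * U"
  have vu': "norm (v - u') \<le> D / \<bar>Im z\<bar>"
  proof -
    have "\<bar>Im z\<bar> * norm (v - u') \<le> norm ((X \<Phi> - res L' phi) + (e - (2 *\<^sub>C s1 + s2)))"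
      using B.resolvent_bound[OF B.A_diff[OF vA uA'], of z] unfolding eq .
    also have "\<dots> \<le> norm (X \<Phi> - res L' phi) + (norm e + (norm (2 *\<^sub>C s1) + norm s2))"
      by (intro order_trans[OF norm_triangle_ineq] add_mono order_trans[OF norm_triangle_ineq4] order_refl norm_triangle_ineq)
    also have "\<dots> \<le> D" using n1 n2 n3 n4 by (simp add: D_def)
    finally show ?thesis using z by (simp add: field_simps)
  qed
  have cin: "cinner (?P L f) x = cinner f x" if "x \<in> H_box L" for L f x
  proof -
    have i: "(\<lambda>t. cnj (indicator (box_L L :: (real^'d) set) t)) = indicator (box_L L)"
      by (simp add: indicator_def fun_eq_iff)
    have "cinner (?P L f) x = cinner f (?P L x)" using cinner_mult_L2[OF bdd_meas_box, of f L x] unfolding i by simp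
    then show ?thesis using that by (simp add: H_box_def)
  qed
  \<comment> \<open>The cutoff is real, hence its multiplication operator moves to the other side of
    the inner product, where it meets \<open>\<Phi>\<close>, for which the truncation error is known
    to be small.\<close>
  have sym: "cinner \<Phi> (u - v) = cinner (\<Phi> - X \<Phi>) u"
    using cinner_mult_L2[OF bdd(1), of \<Phi> u] by (simp add: v_def X_def cinner_diff_left cinner_diff_right)
  have "resolvent_form L V z phi - resolvent_form L' V' z phi = cinner \<Phi> u - cinner \<Phi> u'"
    unfolding A.resolvent_form_eq[OF z phi] B.resolvent_form_eq[OF z phi] u_def[symmetric] u'_def[symmetric]
    by (simp only: res cin[OF uH(1)] cin[OF uH(2)])
  also have "\<dots> = cinner (\<Phi> - X \<Phi>) u + cinner \<Phi> (v - u')"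
    unfolding sym[symmetric] by (simp add: cinner_diff_right)
  also have "cmod \<dots> \<le> t * U + N * (D / \<bar>Im z\<bar>)"
  proof (intro order_trans[OF norm_triangle_ineq] add_mono order_trans[OF cinner_Cauchy_Schwarz] mult_mono)
    show "norm (\<Phi> - X \<Phi>) \<le> t" by (simp add: t_def \<Phi>_def X_def)
    show "norm \<Phi> \<le> N" by (simp add: N_def \<Phi>_def)
  qed (use uU vu' t0 N in auto)
  also have "\<dots> = U * (2 * t + \<delta> * U + 12 * CARD('d) / R * S + 30 * CARD('d) / R\<^sup>2 * U)"
  proof -
    have "N * (D / \<bar>Im z\<bar>) = U * D" by (simp add: U_def)
    then show ?thesis by (simp add: D_def algebra_simps)
  qed
  finally show ?thesis .
qed

lemma bump_approx:
  fixes phi :: "real^'d \<Rightarrow> complex"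
  assumes phi: "l2_fun phi"
  shows "((\<lambda>R. norm (abs_L2 phi - mult_L2 (cfun (bump R)) (abs_L2 phi))) \<longlongrightarrow> 0) at_top"
proof -
  have [measurable]: "phi \<in> borel_measurable borel" using l2_fun_meas[OF phi] by simp
  have lim: "((\<lambda>R. bump R x) \<longlongrightarrow> 1) at_top" for x :: "real^'d"
  proof -
    have "((\<lambda>R. (max 0 (1 - (x \<bullet> x) * (inverse R)\<^sup>2)) ^ 3) \<longlongrightarrow> (max 0 (1 - (x \<bullet> x) * 0\<^sup>2)) ^ 3) at_top"
      by (intro tendsto_intros tendsto_inverse_0_at_top filterlim_ident)
    then show ?thesis by (simp add: bump_def power_inverse divide_inverse)
  qed
  have "((\<lambda>R. LINT x|lborel. (cmod (phi x - cfun (bump R) x * phi x))\<^sup>2) \<longlongrightarrow> (LINT x :: real^'d|lborel. 0)) at_top"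
  proof (rule integral_dominated_convergence_at_top[where w = "\<lambda>x. (cmod (phi x))\<^sup>2"])
    show "integrable lborel (\<lambda>x. (cmod (phi x))\<^sup>2)" by (rule l2_fun_int[OF phi])
    show "AE x in lborel. ((\<lambda>R. (cmod (phi x - cfun (bump R) x * phi x))\<^sup>2) \<longlongrightarrow> 0) at_top"
    proof (rule AE_I2)
      fix x
      have "((\<lambda>R. (cmod (phi x - cfun (bump R) x * phi x))\<^sup>2) \<longlongrightarrow> (cmod (phi x - complex_of_real 1 * phi x))\<^sup>2) at_top"
        by (intro tendsto_intros lim)
      then show "((\<lambda>R. (cmod (phi x - cfun (bump R) x * phi x))\<^sup>2) \<longlongrightarrow> 0) at_top" by simp
    qed
    show "\<forall>\<^sub>F R in at_top. AE x in lborel. norm ((cmod (phi x - cfun (bump R) x * phi x))\<^sup>2) \<le> (cmod (phi x))\<^sup>2"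
      using eventually_gt_at_top[of 0]
    proof eventually_elim
      fix R :: real assume R: "0 < R"
      show "AE x in lborel. norm ((cmod (phi x - cfun (bump R) x * phi x))\<^sup>2) \<le> (cmod (phi x))\<^sup>2"
      proof (rule AE_I2)
        fix x
        have "phi x - cfun (bump R) x * phi x = of_real (1 - bump R x) * phi x" by (simp add: algebra_simps)
        then have "cmod (phi x - cfun (bump R) x * phi x) = (1 - bump R x) * cmod (phi x)"
          using bump_bound[OF R, of x] by (simp only: norm_mult norm_of_real abs_of_nonneg diff_ge_0_iff_ge)
        also have "\<dots> \<le> 1 * cmod (phi x)" using bump_bound[OF R, of x] by (intro mult_right_mono) auto
        finally show "norm ((cmod (phi x - cfun (bump R) x * phi x))\<^sup>2) \<le> (cmod (phi x))\<^sup>2"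
          by (simp add: power_mono)
      qed
    qed
  qed measurable
  then have "((\<lambda>R. sqrt (LINT x|lborel. (cmod (phi x - cfun (bump R) x * phi x))\<^sup>2)) \<longlongrightarrow> sqrt 0) at_top"
    by (intro tendsto_real_sqrt) simp
  moreover have "\<forall>\<^sub>F R in at_top. sqrt (LINT x|lborel. (cmod (phi x - cfun (bump R) x * phi x))\<^sup>2) =
      norm (abs_L2 phi - mult_L2 (cfun (bump R)) (abs_L2 phi))"
    using eventually_gt_at_top[of 0]
  proof eventually_elim
    fix R :: real assume "0 < R"
    then have b: "bdd_meas (cfun (bump R :: real^'d \<Rightarrow> real))" by (rule bump_bdd_meas)
    have "abs_L2 phi - mult_L2 (cfun (bump R)) (abs_L2 phi) = abs_L2 (\<lambda>x. phi x - cfun (bump R) x * phi x)"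
      by (simp add: mult_abs_L2 b phi abs_L2_diff l2_fun_bdd_meas)
    moreover have "l2_fun (\<lambda>x. phi x - cfun (bump R) x * phi x)"
      by (intro l2_fun_diff l2_fun_bdd_meas phi b)
    ultimately show "sqrt (LINT x|lborel. (cmod (phi x - cfun (bump R) x * phi x))\<^sup>2) =
      norm (abs_L2 phi - mult_L2 (cfun (bump R)) (abs_L2 phi))"
      by (simp add: norm_abs_L2_sq[symmetric])
  qed
  ultimately show ?thesis by (simp add: Lim_transform_eventually)
qed

text \<open>Turns the growth hypothesis into a bound for the potential on the box that is linear in
  the side length. This linear rate is the source of the factor \<open>L powr (1/2)\<close> in the
  gradient bound.\<close>

lemma jbr_le:
  assumes "1 \<le> L" "x \<in> box_L L"
  shows "jbr (x :: real^'d) \<le> (1 + CARD('d) / 2) * L"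
proof -
  have "jbr x \<le> 1 + norm x"
    unfolding jbr_def by (rule real_le_lsqrt) (auto simp: power2_eq_square algebra_simps)
  also have "\<dots> \<le> L + CARD('d) * (L / 2)" using norm_box_L[OF assms(2)] assms(1) by simp
  finally show ?thesis by (simp add: algebra_simps)
qed

theorem theorem3p2:
  fixes W :: "real \<Rightarrow> real^'d \<Rightarrow> real"
    and phi :: "real^'d \<Rightarrow> complex"
  assumes per: "\<And>L. L \<ge> 1 \<Longrightarrow> periodic_L L (W L)"
    and meas: "\<And>L. L \<ge> 1 \<Longrightarrow> W L \<in> borel_measurable lborel"
    and growth: "\<exists>C. \<forall>L\<ge>1. \<forall>x \<in> box_L L. \<bar>W L x\<bar> \<le> C * jbr x"
    and conv: "\<exists>C \<alpha> \<epsilon> L0. \<alpha> > 0 \<and> \<epsilon> > 0 \<and>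
                 (\<forall>L L'. L0 \<le> L \<longrightarrow> 1 \<le> L \<longrightarrow> L \<le> L' \<longrightarrow>
                    (\<forall>x \<in> box_L L.
                       \<bar>indicator ((\<lambda>y. (L powr (1/2 + \<alpha>)) *\<^sub>R y) ` box_L (1/2)) x
                          * (W L x - W L' x)\<bar> \<le> C * L powr (- \<epsilon>)))"
    and phi_meas: "phi \<in> borel_measurable lborel"
    and phi_L2: "integrable lborel (\<lambda>x. (cmod (phi x))\<^sup>2)"
  shows "(\<forall>z. Im z \<noteq> 0 \<longrightarrow>
            (\<exists>l. ((\<lambda>L. resolvent_form L (W L) z phi) \<longlongrightarrow> l) at_top)) \<and>
         (\<forall>f. C_infty f \<longrightarrow>
            (\<exists>l. ((\<lambda>L. fcalc_form L (W L) f phi) \<longlongrightarrow> l) at_top))"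
proof -
  have phi: "l2_fun phi" using phi_meas phi_L2 by (simp add: l2_fun_def)
  obtain C1 where C1: "\<And>L x. 1 \<le> L \<Longrightarrow> x \<in> box_L L \<Longrightarrow> \<bar>W L x\<bar> \<le> C1 * jbr x" using growth by blast
  define K where "K = \<bar>C1\<bar> * (1 + CARD('d) / 2)"
  have K0: "0 \<le> K" by (simp add: K_def)
  have pot: "box_potential L (W L) (K * L)" if L: "1 \<le> L" for L
  proof
    show "\<bar>W L x\<bar> \<le> K * L" if x: "x \<in> box_L L" for x
    proof -
      have "\<bar>W L x\<bar> \<le> \<bar>C1\<bar> * jbr x"
        by (rule order_trans[OF C1[OF L x] mult_right_mono]) (auto simp: jbr_def)
      also have "\<dots> \<le> \<bar>C1\<bar> * ((1 + CARD('d) / 2) * L)" by (intro mult_left_mono jbr_le L x) simp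
      finally show ?thesis by (simp add: K_def mult.assoc)
    qed
  qed (use L meas[OF L] in auto)
  obtain C2 \<alpha>' \<epsilon> L0 where \<alpha>': "0 < \<alpha>'" and \<epsilon>: "0 < \<epsilon>"
    and C2: "\<And>L L' x. L0 \<le> L \<Longrightarrow> 1 \<le> L \<Longrightarrow> L \<le> L' \<Longrightarrow> x \<in> box_L L \<Longrightarrow>
       \<bar>indicator ((\<lambda>y. (L powr (1/2 + \<alpha>')) *\<^sub>R y) ` box_L (1/2)) x * (W L x - W L' x)\<bar> \<le> C2 * L powr (- \<epsilon>)"
    using conv by blast
  \<comment> \<open>Lowering the exponent only shrinks the region in which the potentials are
    compared. With \<open>1/2 + \<alpha> \<le> 1\<close> the cutoff of radius \<open>R L\<close>
    fits into the box for every \<open>L \<ge> 1\<close>.\<close>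
  define \<alpha> where "\<alpha> = min \<alpha>' (1/2)"
  have \<alpha>: "0 < \<alpha>" "\<alpha> \<le> \<alpha>'" "\<alpha> \<le> 1/2" using \<alpha>' by (auto simp: \<alpha>_def)
  \<comment> \<open>The cube \<open>box_L (1/2)\<close> has half-width \<open>1/4\<close>, so the
    ball of radius \<open>R L\<close> lies inside the scaled cube of the hypothesis.\<close>
  define R where "R L = L powr (1/2 + \<alpha>) / 4" for L :: real
  have R: "0 < R L" "R L \<le> L / 2" "R L \<le> L powr (1/2 + \<alpha>') / 4" if "1 \<le> L" for L
  proof -
    have "L powr (1/2 + \<alpha>) \<le> L powr 1" using \<alpha> that by (intro powr_mono) auto
    then show "R L \<le> L / 2" using that by (simp add: R_def)
    show "R L \<le> L powr (1/2 + \<alpha>') / 4" unfolding R_def using \<alpha> that by (intro divide_right_mono powr_mono) auto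
  qed (use that in \<open>simp add: R_def\<close>)
  have close: "\<bar>W L x - W L' x\<bar> \<le> \<bar>C2\<bar> * L powr (- \<epsilon>)"
    if L: "L0 \<le> L" "1 \<le> L" "L \<le> L'" and x: "norm x < R L" for L L' x
  proof -
    have xbox: "x \<in> box_L L" by (rule ball_subset_box_L[OF x R(2)[OF L(2)]])
    let ?s = "L powr (1/2 + \<alpha>')"
    have s: "0 < ?s" using L by simp
    have "norm ((1 / ?s) *\<^sub>R x) < 1 / 4" using x R(3)[OF L(2)] s by (simp add: field_simps)
    then have "(1 / ?s) *\<^sub>R x \<in> box_L (1/2)" by (rule ball_subset_box_L) simp
    then have "x \<in> (\<lambda>y. ?s *\<^sub>R y) ` box_L (1/2)" using s by (intro image_eqI[of _ _ "(1 / ?s) *\<^sub>R x"]) simp_all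
    then have "\<bar>W L x - W L' x\<bar> \<le> C2 * L powr (- \<epsilon>)" using C2[OF L xbox] by simp
    also have "\<dots> \<le> \<bar>C2\<bar> * L powr (- \<epsilon>)" by (intro mult_right_mono) auto
    finally show ?thesis .
  qed
  have lim1: "\<exists>l. ((\<lambda>L. resolvent_form L (W L) z phi) \<longlongrightarrow> l) at_top" if z: "Im z \<noteq> 0" for z
  proof -
    define N where "N = norm (abs_L2 phi)"
    define U where "U = N / \<bar>Im z\<bar>"
    \<comment> \<open>Chosen so that the squared gradient bound with \<open>M = K * L\<close> is at
      most \<open>Q * L\<close> once \<open>L \<ge> 1\<close>.\<close>
    define Q where "Q = U * (N + cmod z * U) + U * U * K"
    define t where "t r = norm (abs_L2 phi - mult_L2 (cfun (bump r)) (abs_L2 phi))" for r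
    have N0: "0 \<le> N" and U0: "0 \<le> U" by (simp_all add: N_def U_def)
    have Q0: "0 \<le> Q" using N0 U0 K0 by (simp add: Q_def)
    \<comment> \<open>The bound of \<open>resolvent_form_compare\<close> as a function of
      \<open>L\<close> alone. The factor 4 in \<open>1 / R L\<close> turns 12 into 48 and 30 into
      \<open>30 * 16\<close>, and the product of \<open>L powr (1/2)\<close> with
      \<open>L powr (- (1/2 + \<alpha>))\<close> leaves \<open>L powr (- \<alpha>)\<close>.\<close>
    define D where "D L = U * (2 * t (R L) + (\<bar>C2\<bar> * L powr (- \<epsilon>)) * U + 48 * CARD('d) * sqrt Q * L powr (- \<alpha>)
       + 480 * CARD('d) * (L powr (- (1/2 + \<alpha>)))\<^sup>2 * U)" for L
    have bound: "cmod (resolvent_form L (W L) z phi - resolvent_form L' (W L') z phi) \<le> D L"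
      if L: "L0 \<le> L" "1 \<le> L" "L \<le> L'" for L L'
    proof -
      have L': "1 \<le> L'" using L by simp
      define S where "S = sqrt (U * (N + (cmod z + K * L) * U))"
      have "cmod (resolvent_form L (W L) z phi - resolvent_form L' (W L') z phi) \<le>
         U * (2 * t (R L) + (\<bar>C2\<bar> * L powr (- \<epsilon>)) * U + 12 * CARD('d) / R L * S + 30 * CARD('d) / (R L)\<^sup>2 * U)"
        unfolding S_def t_def U_def N_def
        by (rule resolvent_form_compare[OF pot[OF L(2)] pot[OF L'] R(1,2)[OF L(2)] _ z phi _ close[OF L]])
           (use R(2)[OF L(2)] L in auto)
      also have "\<dots> \<le> D L"
      proof -
        have "U * (N + (cmod z + K * L) * U) \<le> Q * L"
        proof -
          have "U * (N + cmod z * U) * 1 \<le> U * (N + cmod z * U) * L"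
            using L N0 U0 by (intro mult_left_mono) auto
          then show ?thesis by (simp add: Q_def algebra_simps)
        qed
        then have "S \<le> sqrt Q * L powr (1/2)"
          unfolding S_def using L by (simp add: powr_half_sqrt real_sqrt_mult[symmetric])
        then have "12 * CARD('d) / R L * S \<le> 12 * CARD('d) / R L * (sqrt Q * L powr (1/2))"
          using R(1)[OF L(2)] by (intro mult_left_mono) auto
        also have "\<dots> = 48 * CARD('d) * sqrt Q * (L powr (1/2) / L powr (1/2 + \<alpha>))" by (simp add: R_def)
        also have "L powr (1/2) / L powr (1/2 + \<alpha>) = L powr (- \<alpha>)" by (simp add: powr_diff[symmetric])
        finally have 1: "12 * CARD('d) / R L * S \<le> 48 * CARD('d) * sqrt Q * L powr (- \<alpha>)" .
        have R2: "1 / (R L)\<^sup>2 = 16 * (L powr (- (1/2 + \<alpha>)))\<^sup>2"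
        proof -
          have "1 / (a / 4)\<^sup>2 = 16 * (inverse a)\<^sup>2" for a :: real
            by (cases "a = 0") (simp_all add: power2_eq_square field_simps)
          then show ?thesis unfolding R_def powr_minus .
        qed
        have "30 * CARD('d) / (R L)\<^sup>2 * U = 30 * CARD('d) * (1 / (R L)\<^sup>2) * U" by simp
        then have 2: "30 * CARD('d) / (R L)\<^sup>2 * U = 480 * CARD('d) * (L powr (- (1/2 + \<alpha>)))\<^sup>2 * U"
          unfolding R2 by simp
        show ?thesis unfolding D_def 2 using 1 by (intro mult_left_mono U0) simp
      qed
      finally show ?thesis .
    qed
    have "((\<lambda>L. t (R L)) \<longlongrightarrow> 0) at_top"
    proof (rule filterlim_compose[OF bump_approx[OF phi, folded t_def]])
      have "filterlim (\<lambda>L. L powr (1/2 + \<alpha>) * (1 / 4)) at_top at_top"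
        using \<alpha> by (intro filterlim_at_top_mult_tendsto_pos[OF tendsto_const] real_powr_at_top) auto
      then show "filterlim R at_top at_top" by (simp add: R_def[abs_def])
    qed
    moreover have "((\<lambda>L. L powr (- \<epsilon>)) \<longlongrightarrow> 0) at_top" "((\<lambda>L. L powr (- \<alpha>)) \<longlongrightarrow> 0) at_top"
      "((\<lambda>L. L powr (- (1/2 + \<alpha>))) \<longlongrightarrow> 0) at_top"
      using \<epsilon> \<alpha> by (auto intro!: tendsto_neg_powr filterlim_ident)
    ultimately have "(D \<longlongrightarrow> U * (2 * 0 + (\<bar>C2\<bar> * 0) * U + 48 * CARD('d) * sqrt Q * 0 + real (480 * CARD('d)) * 0\<^sup>2 * U)) at_top"
      unfolding D_def[abs_def] by (intro tendsto_add tendsto_mult tendsto_const tendsto_power)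
    then have D0: "(D \<longlongrightarrow> 0) at_top" by simp
    show ?thesis
    proof (rule cauchy_at_top)
      fix e :: real assume "0 < e"
      then have "\<forall>\<^sub>F L in at_top. D L < e" by (rule order_tendstoD(2)[OF D0])
      then obtain L1 where L1: "\<And>L. L1 \<le> L \<Longrightarrow> D L < e" by (auto simp: eventually_at_top_linorder)
      have "dist (resolvent_form L (W L) z phi) (resolvent_form L' (W L') z phi) < e"
        if "max (max L0 1) L1 \<le> L" "L \<le> L'" for L L'
        using bound[of L L'] L1[of L] that by (simp add: dist_norm)
      then show "\<exists>K. \<forall>L L'. K \<le> L \<longrightarrow> L \<le> L' \<longrightarrow>
          dist (resolvent_form L (W L) z phi) (resolvent_form L' (W L') z phi) < e" by blast
    qed
  qed
  have "\<exists>l. ((\<lambda>L. fcalc_form L (W L) f phi) \<longlongrightarrow> l) at_top" if f: "C_infty f" for f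
  proof -
    \<comment> \<open>\<open>stieltjes_limit\<close> speaks of a family indexed by all real
      \<open>L\<close>; below 1, where nothing is known about \<open>W L\<close>, the null measure
      satisfies its hypotheses and does not affect the limit. The choice among spectral measures is
      immaterial by \<open>fcalc_form_eq\<close>.\<close>
    define \<mu> where "\<mu> L = (if 1 \<le> L then SOME \<mu>. spectral_measure L (W L) phi \<mu> else null_measure borel)" for L
    have \<mu>: "spectral_measure L (W L) phi (\<mu> L)" if "1 \<le> L" for L
      using someI_ex[OF box_potential.spectral_measure_exists[OF pot[OF that] phi]] that by (simp add: \<mu>_def)
    have st: "stieltjes (\<mu> L) z = resolvent_form L (W L) z phi" if "1 \<le> L" "Im z \<noteq> 0" for L z
      using \<mu>[OF that(1)] that(2) by (simp add: spectral_measure_def stieltjes_def)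
    have "\<exists>l. ((\<lambda>L. LINT t|\<mu> L. f t) \<longlongrightarrow> l) at_top"
    proof (rule stieltjes_limit[OF _ _ _ f])
      show "finite_borel_measure (\<mu> L)" for L
      proof (cases "1 \<le> L")
        case True
        then show ?thesis using \<mu>[OF True]
          by (auto simp: spectral_measure_def finite_borel_measure_def finite_borel_measure_axioms_def)
      next
        case False
        then show ?thesis
          by (auto simp: \<mu>_def finite_borel_measure_def finite_borel_measure_axioms_def intro: finite_measureI)
      qed
      show "cmod (stieltjes (\<mu> L) z) \<le> (norm (abs_L2 phi))\<^sup>2 / \<bar>Im z\<bar>" if z: "Im z \<noteq> 0" for L z
      proof (cases "1 \<le> L")
        case True
        then show ?thesis using box_potential.norm_resolvent_form_le[OF pot[OF True] z phi] st[OF True z] by simp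
      next
        case False
        then show ?thesis by (simp add: \<mu>_def stieltjes_def)
      qed
      show "\<exists>l. ((\<lambda>L. stieltjes (\<mu> L) z) \<longlongrightarrow> l) at_top" if z: "Im z \<noteq> 0" for z
      proof -
        obtain l where l: "((\<lambda>L. resolvent_form L (W L) z phi) \<longlongrightarrow> l) at_top" using lim1[OF z] by blast
        have "\<forall>\<^sub>F L in at_top. resolvent_form L (W L) z phi = stieltjes (\<mu> L) z"
          using eventually_ge_at_top[of 1] by eventually_elim (simp add: st z)
        from Lim_transform_eventually[OF l this] show ?thesis by blast
      qed
    qed
    then obtain l where l: "((\<lambda>L. LINT t|\<mu> L. f t) \<longlongrightarrow> l) at_top" by blast
    have "\<forall>\<^sub>F L in at_top. (LINT t|\<mu> L. f t) = fcalc_form L (W L) f phi"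
      using eventually_ge_at_top[of 1] by eventually_elim (simp add: fcalc_form_eq[OF \<mu> f])
    from Lim_transform_eventually[OF l this] show ?thesis by blast
  qed
  then show ?thesis using lim1 by blast
qed

end
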